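(* Let $\mathfrak g$ be a Lie algebra over a field $\mathbb K$ of characteristic $0$ and let $Z\in\wedge^3(\mathfrak g)^{\mathfrak g}$. Then there exists $\varphi\in(\mathfrak m_{\mathfrak g^*}^{\widehat\otimes 3})^{\mathfrak g}$ (note $\mathfrak m_{\mathfrak g^*}^{\widehat\otimes 3}\subset \mathfrak m_{(\mathfrak g^* )^3}^2$) such that the image of $\varphi$ under $$\mathfrak m_{\mathfrak g^*}^{\widehat\otimes 3}\to(\mathfrak m_{\mathfrak g^*}/\mathfrak m_{\mathfrak g^*}^2)^{\otimes 3}=\mathfrak g^{\otimes 3}\xrightarrow{\mathrm{Alt}}\wedge^3(\mathfrak g)$$ equals $Z$, and such that $\varphi$ satisfies the functional pentagon equation $$\varphi^{1,2,34}\star\varphi^{12,3,4}=\varphi^{2,3,4}\star\varphi^{1,23,4}\star\varphi^{1,2,3}.$$ Moreover such a $\varphi$ (called a lift of $Z$) is unique up to the action of an element of $(\mathfrak m_{\mathfrak g^*}^{\widehat\otimes 2})^{\mathfrak g}$: if $\varphi,\varphi'$ are two lifts of $Z$, there exists $\sigma\in(\mathfrak m_{\mathfrak g^*}^{\widehat\otimes 2})^{\mathfrak g}$ such that $$\varphi'=\sigma\cdot\varphi:=\sigma^{2,3}\star\sigma^{1,23}\star\varphi\star(-\sigma)^{12,3}\star(-\sigma)^{1,2}.$$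
   Context: $\mathcal O_{\mathfrak g^*}=\widehat S(\mathfrak g)=\prod_{n\ge 0}S^n(\mathfrak g)$ is the ring of formal functions at $0$ on $\mathfrak g^*$, with maximal ideal $\mathfrak m_{\mathfrak g^*}=\prod_{n\ge1}S^n(\mathfrak g)$, and with the linear (Lie–Poisson) bracket extending the Lie bracket of $\mathfrak g$, $\{x,y\}=[x,y]$ for $x,y\in\mathfrak g$. For $k\ge1$, $\mathcal O_{(\mathfrak g^* )^k}=\widehat S(\mathfrak g)^{\widehat\otimes k}=\widehat S(\mathfrak g^{\oplus k})$ is the corresponding Poisson ring for $\mathfrak g^{\oplus k}$, $\mathfrak m_{(\mathfrak g^* )^k}$ is its maximal ideal and $\mathfrak m_{(\mathfrak g^* )^k}^i$ its $i$-th power; $\mathfrak m_{\mathfrak g^*}^{\widehat\otimes k}\subset\mathcal O_{(\mathfrak g^* )^k}$ is the completed tensor power. $\mathfrak g$ acts diagonally by the adjoint action and the superscript $\mathfrak g$ denotes invariants. For $f,g\in\mathfrak m_{(\mathfrak g^* )^k}^2$, $f\star g=f+g+\frac12\{f,g\}+\cdots$ is the (convergent) Baker–Campbell–Hausdorff series for the Poisson bracket; $\star$ is a group law on $\mathfrak m_{(\mathfrak g^* )^k}^2$. Coproduct-insertion notation: for $f\in\mathcal O_{\mathfrak g^*}^{\widehat\otimes n}$ and disjoint subsets $P_1,\dots,P_n\subset\{1,\dots,m\}$, $f^{P_1,\dots,P_n}\in\mathcal O_{\mathfrak g^*}^{\widehat\otimes m}$ is obtained by applying to the $i$-th factor of $f$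 the iterated cocommutative coproduct $\mathcal O_{\mathfrak g^*}\to\mathcal O_{\mathfrak g^*}^{\widehat\otimes|P_i|}$ (dual to addition of $\mathfrak g^*$, so $x\mapsto x\otimes1+1\otimes x$ for $x\in\mathfrak g$) and placing the result in the positions in $P_i$ (with $1$ elsewhere); e.g. $f^{12,3}=(\Delta_0\otimes\mathrm{id})(f)$, $f^{1,23}=(\mathrm{id}\otimes\Delta_0)(f)$. Formally, $f^{P_1,\dots,P_n}(\xi_1,\dots,\xi_m)=f(\sum_{i\in P_1}\xi_i,\dots,\sum_{i\in P_n}\xi_i)$. $\mathrm{Alt}:\mathfrak g^{\otimes3}\to\wedge^3(\mathfrak g)\subset\mathfrak g^{\otimes 3}$ is the total antisymmetrization map, i.e. a fixed nonzero rational multiple of $\sum_{\tau\in S_3}\mathrm{sgn}(\tau)\tau$ (the normalization is immaterial here). *)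

theory Defs
  imports Complex_Main "HOL-Library.Poly_Mapping" "HOL-Combinatorics.Permutations"
begin

(* With B a basis of the Lie algebra g, the symmetric algebra S(g^k) is realised as the polynomial
   ring on the variables (b, s) with b in B and s in {1..k}; the variable (b, s) is the basis vector
   b in the s-th summand of g^k = g + ... + g.  An element of the
   completed symmetric algebra, i.e. of the product of the S^n(g^k) over all n, is the sequence of
   its homogeneous components. *)

type_synonym ('g, 'k) pol = "('g \<times> nat \<Rightarrow>\<^sub>0 nat) \<Rightarrow>\<^sub>0 'k"
type_synonym ('g, 'k) ser = "nat \<Rightarrow> ('g, 'k) pol"

definition Var :: "'v \<Rightarrow> ('v \<Rightarrow>\<^sub>0 nat) \<Rightarrow>\<^sub>0 'k::comm_ring_1"
  where "Var v = Poly_Mapping.single (Poly_Mapping.single v 1) 1"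

definition Const :: "'k \<Rightarrow> ('v \<Rightarrow>\<^sub>0 nat) \<Rightarrow>\<^sub>0 'k::comm_ring_1"
  where "Const c = Poly_Mapping.single 0 c"

definition vars :: "(('v \<Rightarrow>\<^sub>0 nat) \<Rightarrow>\<^sub>0 'k::comm_ring_1) \<Rightarrow> 'v set"
  where "vars p = (\<Union>m\<in>Poly_Mapping.keys p. Poly_Mapping.keys m)"

definition mdeg :: "('v \<Rightarrow>\<^sub>0 nat) \<Rightarrow> nat"
  where "mdeg m = (\<Sum>v\<in>Poly_Mapping.keys m. Poly_Mapping.lookup m v)"

definition slot_deg :: "nat \<Rightarrow> ('g \<times> nat \<Rightarrow>\<^sub>0 nat) \<Rightarrow> nat"
  where "slot_deg s m = (\<Sum>v \<in> {v \<in> Poly_Mapping.keys m. snd v = s}. Poly_Mapping.lookup m v)"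

definition pdv :: "'v \<Rightarrow> (('v \<Rightarrow>\<^sub>0 nat) \<Rightarrow>\<^sub>0 'k::comm_ring_1) \<Rightarrow> (('v \<Rightarrow>\<^sub>0 nat) \<Rightarrow>\<^sub>0 'k)"
  where "pdv v p = (\<Sum>m\<in>Poly_Mapping.keys p.
     Poly_Mapping.single (m - Poly_Mapping.single v 1)
       (of_nat (Poly_Mapping.lookup m v) * Poly_Mapping.lookup p m))"

definition subst_pol ::
  "('v \<Rightarrow> ('w \<Rightarrow>\<^sub>0 nat) \<Rightarrow>\<^sub>0 'k::comm_ring_1) \<Rightarrow> (('v \<Rightarrow>\<^sub>0 nat) \<Rightarrow>\<^sub>0 'k) \<Rightarrow> (('w \<Rightarrow>\<^sub>0 nat) \<Rightarrow>\<^sub>0 'k)"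
  where "subst_pol \<theta> p = (\<Sum>m\<in>Poly_Mapping.keys p.
     Const (Poly_Mapping.lookup p m) *
       (\<Prod>v\<in>Poly_Mapping.keys m. \<theta> v ^ Poly_Mapping.lookup m v))"

(* ins_pol [P1, ..., Pn] f is f^{P1,...,Pn}: since the coproduct is the algebra morphism with
   x |-> x (x) 1 + 1 (x) x on g, the variable b in slot i goes to the sum over p in Pi of b in
   slot p.  Slots count from 1, list positions from 0. *)
definition ins_pol :: "nat set list \<Rightarrow> ('g, 'k::comm_ring_1) pol \<Rightarrow> ('g, 'k) pol"
  where "ins_pol P = subst_pol (\<lambda>(b, i). \<Sum>p \<in> P ! (i - 1). Var (b, p))"

definition ins :: "nat set list \<Rightarrow> ('g, 'k::comm_ring_1) ser \<Rightarrow> ('g, 'k) ser"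
  where "ins P f = (\<lambda>n. ins_pol P (f n))"

definition neg :: "('g, 'k::comm_ring_1) ser \<Rightarrow> ('g, 'k) ser"
  where "neg f = (\<lambda>n. - f n)"

definition Alt :: "rat \<Rightarrow> ('g, 'k::field_char_0) pol \<Rightarrow> ('g, 'k) pol"
  where "Alt q p = Const (of_rat q) *
     (\<Sum>\<tau> | \<tau> permutes {1, 2, 3}. Const (of_int (sign \<tau>)) * ins_pol [{\<tau> 1}, {\<tau> 2}, {\<tau> 3}] p)"

(* The indices ((r1, s1), ..., (rn, sn)) of the terms of total degree N in Dynkin's formula *)
definition dynkin_indices :: "nat \<Rightarrow> (nat \<times> nat) list set"
  where "dynkin_indices N =
     {ps. (\<forall>(r, s) \<in> set ps. r + s > 0) \<and> (\<Sum>(r, s) \<leftarrow> ps. r + s) = N}"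

locale lie_algebra = vector_space scale
  for scale :: "'k::field_char_0 \<Rightarrow> 'g::ab_group_add \<Rightarrow> 'g" (infixr \<open>*s\<close> 75) +
  fixes br :: "'g \<Rightarrow> 'g \<Rightarrow> 'g"
  assumes br_add_left: "br (x + y) z = br x z + br y z"
    and br_add_right: "br x (y + z) = br x y + br x z"
    and br_scale_left: "br (c *s x) y = c *s br x y"
    and br_scale_right: "br x (c *s y) = c *s br x y"
    and br_self: "br x x = 0"
    and jacobi: "br x (br y z) + br y (br z x) + br z (br x y) = 0"

locale based_lie_algebra = lie_algebra scale br
  for scale :: "'k::field_char_0 \<Rightarrow> 'g::ab_group_add \<Rightarrow> 'g" (infixr \<open>*s\<close> 75)
    and br :: "'g \<Rightarrow> 'g \<Rightarrow> 'g" +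
  fixes B :: "'g set"
  assumes independent_B: "independent B" and span_B: "span B = UNIV"
begin

(* The vector x of g in the s-th summand of g^k *)
definition lin :: "nat \<Rightarrow> 'g \<Rightarrow> ('g, 'k) pol"
  where "lin s x = (\<Sum>b | representation B x b \<noteq> 0. Const (representation B x b) * Var (b, s))"

definition Sym :: "nat \<Rightarrow> nat \<Rightarrow> ('g, 'k) pol set"
  where "Sym k n = {p. \<forall>m\<in>Poly_Mapping.keys p. Poly_Mapping.keys m \<subseteq> B \<times> {1..k} \<and> mdeg m = n}"

(* The ring of formal functions on the k-th power of the dual of g *)
definition formal_fun :: "nat \<Rightarrow> ('g, 'k) ser set"
  where "formal_fun k = {f. \<forall>n. f n \<in> Sym k n}"

(* The completed k-th tensor power of the maximal ideal: positive degree in every slot *)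
definition max_tensor :: "nat \<Rightarrow> ('g, 'k) ser set"
  where "max_tensor k =
     {f \<in> formal_fun k. \<forall>n. \<forall>m\<in>Poly_Mapping.keys (f n). \<forall>s\<in>{1..k}. slot_deg s m \<ge> 1}"

(* The diagonal adjoint action, extended from g^k by derivations *)
definition ad_act :: "'g \<Rightarrow> ('g, 'k) pol \<Rightarrow> ('g, 'k) pol"
  where "ad_act x p = (\<Sum>(b, s)\<in>vars p. lin s (br x b) * pdv (b, s) p)"

definition invariants :: "('g, 'k) ser set"
  where "invariants = {f. \<forall>x n. ad_act x (f n) = 0}"

(* The biderivation extending the Lie bracket of g^k *)
definition poisson_pol :: "('g, 'k) pol \<Rightarrow> ('g, 'k) pol \<Rightarrow> ('g, 'k) pol"
  where "poisson_pol p q = (\<Sum>(a, s)\<in>vars p. \<Sum>(b, t)\<in>vars q.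
     if s = t then pdv (a, s) p * pdv (b, t) q * lin s (br a b) else 0)"

(* The bracket of S^i and S^j lies in S^(i+j-1) *)
definition poisson :: "('g, 'k) ser \<Rightarrow> ('g, 'k) ser \<Rightarrow> ('g, 'k) ser"
  where "poisson f g = (\<lambda>n. \<Sum>i\<le>n + 1. poisson_pol (f i) (g (n + 1 - i)))"

fun nested_poisson :: "('g, 'k) ser list \<Rightarrow> ('g, 'k) ser"
  where
    "nested_poisson [] = (\<lambda>n. 0)"
  | "nested_poisson [f] = f"
  | "nested_poisson (f # g # fs) = poisson f (nested_poisson (g # fs))"

(* The terms of degree N in (f, g) of the Baker-Campbell-Hausdorff series log(exp f exp g), by
   Dynkin's formula: the sum over n and r1, s1, ..., rn, sn of
     (-1)^(n-1) / n * [f^r1 g^s1 ... f^rn g^sn] / (N * r1! s1! ... rn! sn!)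
   where N = r1 + s1 + ... + rn + sn, and [f1 ... fN] = {f1, {f2, ... {f(N-1), fN}...}}.
   For N = 0 the coefficient is 1 / 0 = 0. *)
definition bch_term :: "nat \<Rightarrow> ('g, 'k) ser \<Rightarrow> ('g, 'k) ser \<Rightarrow> ('g, 'k) ser"
  where "bch_term N f g = (\<lambda>d. \<Sum>ps\<in>dynkin_indices N.
     Const ((- 1) ^ (length ps - 1) /
        (of_nat (length ps) * of_nat N * (\<Prod>(r, s) \<leftarrow> ps. fact r * fact s))) *
     nested_poisson (concat (map (\<lambda>(r, s). replicate r f @ replicate s g) ps)) d)"

(* If f and g have no components of degree < 2, then bch_term N f g has none of degree < N + 1, so
   that in each degree d only finitely many N contribute. *)
definition star :: "('g, 'k) ser \<Rightarrow> ('g, 'k) ser \<Rightarrow> ('g, 'k) ser" (infixl \<open>\<star>\<close> 65)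
  where "f \<star> g = (\<lambda>d. Sum_any (\<lambda>N. bch_term N f g d))"

(* The third tensor power of g, as the part of S(g^3) of degree 1 in each of the three slots *)
definition tensor3 :: "('g, 'k) pol set"
  where "tensor3 = {p \<in> Sym 3 3. \<forall>m\<in>Poly_Mapping.keys p. \<forall>s\<in>{1..3}. slot_deg s m = 1}"

(* The third exterior power of g, as the antisymmetric tensors *)
definition wedge3 :: "('g, 'k) pol set"
  where "wedge3 = {p \<in> tensor3. \<forall>\<tau>. \<tau> permutes {1, 2, 3} \<longrightarrow>
     ins_pol [{\<tau> 1}, {\<tau> 2}, {\<tau> 3}] p = Const (of_int (sign \<tau>)) * p}"

definition wedge3_inv :: "('g, 'k) pol set"
  where "wedge3_inv = {p \<in> wedge3. \<forall>x. ad_act x p = 0}"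

(* The reduction of max_tensor 3 modulo the square of the maximal ideal in each slot *)
definition lead3 :: "('g, 'k) ser \<Rightarrow> ('g, 'k) pol"
  where "lead3 f = (\<Sum>m | m \<in> Poly_Mapping.keys (f 3) \<and> (\<forall>s\<in>{1..3}. slot_deg s m = 1).
     Poly_Mapping.single m (Poly_Mapping.lookup (f 3) m))"

definition pentagon :: "('g, 'k) ser \<Rightarrow> bool"
  where "pentagon \<phi> \<longleftrightarrow>
     ins [{1}, {2}, {3, 4}] \<phi> \<star> ins [{1, 2}, {3}, {4}] \<phi> =
     ins [{2}, {3}, {4}] \<phi> \<star> ins [{1}, {2, 3}, {4}] \<phi> \<star> ins [{1}, {2}, {3}] \<phi>"

definition is_lift :: "rat \<Rightarrow> ('g, 'k) pol \<Rightarrow> ('g, 'k) ser \<Rightarrow> bool"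
  where "is_lift q Z \<phi> \<longleftrightarrow>
     \<phi> \<in> max_tensor 3 \<inter> invariants \<and> Alt q (lead3 \<phi>) = Z \<and> pentagon \<phi>"

definition twist :: "('g, 'k) ser \<Rightarrow> ('g, 'k) ser \<Rightarrow> ('g, 'k) ser"
  where "twist \<sigma> \<phi> =
     ins [{2}, {3}] \<sigma> \<star> ins [{1}, {2, 3}] \<sigma> \<star> \<phi> \<star>
     ins [{1, 2}, {3}] (neg \<sigma>) \<star> ins [{1}, {2}] (neg \<sigma>)"

end

end

theory Submission
  imports Defs "HOL-Library.Function_Algebras" "HOL-Library.Product_Plus" "HOL-Computational_Algebra.Polynomial" "HOL-Computational_Algebra.Formal_Power_Series"
begin

text \<open>
  Only two things about the equation matter: how it looks to first order, and that it is an equation in a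
  group.

  \<^bold>\<open>Linearization.\<close> On series without terms of degree \<open>0\<close> and \<open>1\<close> a bracket strictly raises the degree.  If
  \<open>\<phi>\<close> is changed by \<open>x\<close> in degree \<open>n\<close> and arbitrarily in higher degrees, both sides of the pentagon equation
  therefore stay the same below degree \<open>n\<close>, and in degree \<open>n\<close> their difference changes by \<open>bd 3 x\<close>, where \<open>bd\<close>
  is the differential of the cobar complex of the symmetric coalgebra (\<open>upd_sides\<close>).  Likewise a change of
  \<open>\<sigma>\<close> by \<open>x\<close> changes \<open>\<sigma> \<cdot> \<phi>\<close> by \<open>bd 2 x\<close> (\<open>upd_twist\<close>).  This makes existence and uniqueness a matter
  of obstruction theory in the complex of invariant polynomials that have positive degree in every slot.

  \<^bold>\<open>Cohomology.\<close> The cobar complex of the symmetric coalgebra computes the exterior algebra: there is cohomology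
  in \<open>K\<close> slots only in degree \<open>K\<close>, and there it is detected by antisymmetrization.  What the proof uses is that
  an invariant cocycle in \<open>K\<close> slots of degree larger than \<open>K\<close> is the coboundary of an invariant cochain
  (\<open>cocycle_exact\<close>), and that so is one in three slots of degree three whose antisymmetrization vanishes
  (\<open>alt_zero_exact\<close>).  The first holds because a cocycle can be made linear in one slot after the other, from
  the last slot to the first, by subtracting coboundaries given by an explicit formula that commutes with the
  adjoint action; and a polynomial that is linear in all \<open>K\<close> slots has degree \<open>K\<close>.

  \<^bold>\<open>Existence\<close> (\<open>lift_exists\<close>).  The construction starts in degree \<open>3\<close> with a multiple of \<open>Z\<close>, which is closed
  because it is trilinear.  If the equation holds up to degree \<open>N\<close>, its error in degree \<open>N + 1\<close> is closed
  (\<open>obstruction_cocycle\<close>): the equation can be read as a relation between two ways of rebracketing four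
  factors, and its images under the six cofaces to five slots fit together to the associahedron with its six
  pentagons and three squares.  The squares commute because an invariant series Poisson commutes with
  every series that depends on the slots of the former only through their sum (\<open>invariant_commute\<close>).  By
  exactness the error is removed by a correction of \<open>\<phi>\<close> in degree \<open>N + 1\<close>.

  \<^bold>\<open>Uniqueness\<close> (\<open>lift_unique\<close>).  The same commutation property shows that \<open>\<sigma> \<cdot> \<phi>\<close> solves the equation if \<open>\<phi>\<close>
  does (\<open>twist_pentagon\<close>).  The first difference between \<open>\<sigma> \<cdot> \<phi>\<close> and another lift \<open>\<phi>'\<close> is then a closed
  cochain in three slots, hence exact, in degree \<open>3\<close> because both antisymmetrizations equal \<open>Z\<close>; and it is removed
  by a correction of \<open>\<sigma>\<close>.

  \<^bold>\<open>The group.\<close> Computations with \<open>\<star>\<close> are moved to an associative ring.  A series \<open>f\<close> acts by its Hamiltonian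
  vector field; together with the derivation that multiplies by the weight this gives a faithful representation
  \<open>hat f\<close> by power series whose coefficients are additive endomorphisms, and \<open>\<Phi> f\<close>, the exponential of \<open>hat f\<close>,
  satisfies \<open>\<Phi> (f \<star> g) = \<Phi> f * \<Phi> g\<close> (\<open>\<Phi>_star\<close>).  This last equation is Dynkin's theorem, that the sum of words
  that is the logarithm of \<open>exp x exp y\<close> does not change when each word of length \<open>N\<close> is replaced by
  \<open>1 / N\<close> times its nested commutator (\<open>dynkin_assoc\<close>).
\<close>

section \<open>Polynomials with finitely supported exponents\<close>

type_synonym ('v, 'k) mpol = "('v \<Rightarrow>\<^sub>0 nat) \<Rightarrow>\<^sub>0 'k"

lemma Const_simps [simp]: "Const 0 = 0" "Const 1 = 1"
  "Const (a + b) = Const a + Const b" "Const (a * b) = Const a * Const b"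
  "Const (- a) = - Const a" "Const (a - b) = Const a - Const b"
  by (simp_all add: Const_def single_add mult_single single_uminus single_diff)

lemma Const_of_nat: "Const (of_nat n) = of_nat n"
  by (induction n) auto

lemma pm_expand: "p = (\<Sum>m\<in>Poly_Mapping.keys p. Poly_Mapping.single m (Poly_Mapping.lookup p m))"
proof (rule poly_mapping_eqI)
  fix k
  have "(\<Sum>m\<in>Poly_Mapping.keys p. Poly_Mapping.lookup (Poly_Mapping.single m (Poly_Mapping.lookup p m)) k)
    = (\<Sum>m\<in>Poly_Mapping.keys p. if m = k then Poly_Mapping.lookup p k else 0)"
    by (rule sum.cong) (auto simp: lookup_single)
  also have "\<dots> = Poly_Mapping.lookup p k"
    by (simp add: in_keys_iff)
  finally show "Poly_Mapping.lookup p k =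
     Poly_Mapping.lookup (\<Sum>m\<in>Poly_Mapping.keys p. Poly_Mapping.single m (Poly_Mapping.lookup p m)) k"
    by (simp add: lookup_sum)
qed

lemma single_induct [case_names zero single add]:
  assumes "P 0" and "\<And>m c. m \<in> Poly_Mapping.keys p \<Longrightarrow> P (Poly_Mapping.single m c)"
    and "\<And>f g. P f \<Longrightarrow> P g \<Longrightarrow> P (f + g)"
  shows "P (p :: ('v, 'k::comm_ring_1) mpol)"
proof -
  have "P (\<Sum>m\<in>S. Poly_Mapping.single m (Poly_Mapping.lookup p m))"
    if "S \<subseteq> Poly_Mapping.keys p" "finite S" for S
    using that(2,1) by (induction S) (auto simp: assms)
  from this[of "Poly_Mapping.keys p"] show ?thesis using pm_expand[of p] by simp
qed

lemma in_vars_iff: "vars p \<subseteq> W \<longleftrightarrow> (\<forall>m\<in>Poly_Mapping.keys p. Poly_Mapping.keys m \<subseteq> W)"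
  by (auto simp: vars_def)

lemma finite_vars [simp]: "finite (vars p)"
  by (auto simp: vars_def)

lemma mdeg_superset:
  assumes "finite S" "Poly_Mapping.keys m \<subseteq> S"
  shows "mdeg m = sum (Poly_Mapping.lookup m) S"
  unfolding mdeg_def by (rule sum.mono_neutral_left) (use assms in \<open>auto simp: in_keys_iff\<close>)

lemma mdeg_simps [simp]: "mdeg 0 = 0" "mdeg (Poly_Mapping.single x n) = n"
  "mdeg (m + m') = mdeg m + mdeg m'"
proof -
  show "mdeg (m + m') = mdeg m + mdeg m'"
    using mdeg_superset[of "Poly_Mapping.keys m \<union> Poly_Mapping.keys m'" m]
      mdeg_superset[of "Poly_Mapping.keys m \<union> Poly_Mapping.keys m'" m']
      mdeg_superset[of "Poly_Mapping.keys m \<union> Poly_Mapping.keys m'" "m + m'"]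
      Poly_Mapping.keys_add[of m m']
    by (simp add: lookup_add sum.distrib)
qed (auto simp: mdeg_def)

lemma exponent_split:
  assumes "Poly_Mapping.lookup m x > (0::nat)"
  shows "m = Poly_Mapping.single x 1 + (m - Poly_Mapping.single x 1)"
  by (rule poly_mapping_eqI) (use assms in \<open>auto simp: lookup_add lookup_minus lookup_single when_def\<close>)

lemma mpol_induct_in [consumes 1, case_names Const add Var]:
  assumes "vars p \<subseteq> W"
    and "\<And>c. P (Const c)" and "\<And>f g. P f \<Longrightarrow> P g \<Longrightarrow> P (f + g)"
    and "\<And>x f. x \<in> W \<Longrightarrow> P f \<Longrightarrow> P (Var x * f)"
  shows "P (p :: ('v, 'k::comm_ring_1) mpol)"
proof -
  have single: "P (Poly_Mapping.single m c)" if "Poly_Mapping.keys m \<subseteq> W" for m c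
    using that
  proof (induction "mdeg m" arbitrary: m rule: less_induct)
    case less
    show ?case
    proof (cases "Poly_Mapping.keys m = {}")
      case True
      then show ?thesis using assms(2)[of c] by (simp add: Const_def)
    next
      case False
      then obtain x where x: "x \<in> Poly_Mapping.keys m" by blast
      define m' where "m' = m - Poly_Mapping.single x 1"
      have m: "m = Poly_Mapping.single x 1 + m'"
        using exponent_split[of m x] x by (simp add: m'_def in_keys_iff)
      have "Poly_Mapping.keys m' \<subseteq> Poly_Mapping.keys m"
        by (auto simp: m'_def in_keys_iff lookup_minus)
      moreover have "mdeg m = Suc (mdeg m')" by (subst m) simp
      then have "mdeg m' < mdeg m" by simp
      ultimately have "P (Poly_Mapping.single m' c)" using less by blast
      moreover have "Poly_Mapping.single m c = Var x * Poly_Mapping.single m' c"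
        by (subst m) (simp add: Var_def mult_single)
      ultimately show ?thesis using assms(4) x less.prems by auto
    qed
  qed
  show ?thesis
    by (induction p rule: single_induct) (use assms(1,3) single single[of 0 0] in \<open>auto simp: in_vars_iff\<close>)
qed

lemma mpol_induct [case_names Const add Var]:
  assumes "\<And>c. P (Const c)" and "\<And>f g. P f \<Longrightarrow> P g \<Longrightarrow> P (f + g)"
    and "\<And>x f. P f \<Longrightarrow> P (Var x * f)"
  shows "P (p :: ('v, 'k::comm_ring_1) mpol)"
  by (rule mpol_induct_in[where W = UNIV]) (use assms in auto)

subsection \<open>Evaluation homomorphisms\<close>

definition mon :: "('v \<Rightarrow> 'r::comm_monoid_mult) \<Rightarrow> ('v \<Rightarrow>\<^sub>0 nat) \<Rightarrow> 'r"
  where "mon \<theta> m = (\<Prod>x\<in>Poly_Mapping.keys m. \<theta> x ^ Poly_Mapping.lookup m x)"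

lemma mon_superset:
  assumes "finite S" "Poly_Mapping.keys m \<subseteq> S"
  shows "mon \<theta> m = (\<Prod>x\<in>S. \<theta> x ^ Poly_Mapping.lookup m x)"
  unfolding mon_def by (rule prod.mono_neutral_left) (use assms in \<open>auto simp: in_keys_iff\<close>)

lemma mon_simps [simp]: "mon \<theta> 0 = 1" "mon \<theta> (Poly_Mapping.single x (Suc 0)) = \<theta> x"
  "mon \<theta> (m + m') = mon \<theta> m * mon \<theta> m'"
proof -
  show "mon \<theta> (m + m') = mon \<theta> m * mon \<theta> m'"
    using mon_superset[of "Poly_Mapping.keys m \<union> Poly_Mapping.keys m'" m \<theta>]
      mon_superset[of "Poly_Mapping.keys m \<union> Poly_Mapping.keys m'" m' \<theta>]
      mon_superset[of "Poly_Mapping.keys m \<union> Poly_Mapping.keys m'" "m + m'" \<theta>]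
      Poly_Mapping.keys_add[of m m']
    by (simp add: lookup_add prod.distrib power_add)
qed (auto simp: mon_def)

definition rhom :: "('a::comm_ring_1 \<Rightarrow> 'b::comm_ring_1) \<Rightarrow> bool"
  where "rhom \<kappa> \<longleftrightarrow> \<kappa> 0 = 0 \<and> \<kappa> 1 = 1 \<and> (\<forall>a b. \<kappa> (a + b) = \<kappa> a + \<kappa> b) \<and> (\<forall>a b. \<kappa> (a * b) = \<kappa> a * \<kappa> b)"

definition mev :: "('k::comm_ring_1 \<Rightarrow> 'r::comm_ring_1) \<Rightarrow> ('v \<Rightarrow> 'r) \<Rightarrow> ('v, 'k) mpol \<Rightarrow> 'r"
  where "mev \<kappa> \<theta> p = (\<Sum>m\<in>Poly_Mapping.keys p. \<kappa> (Poly_Mapping.lookup p m) * mon \<theta> m)"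

lemma mev_superset:
  assumes "rhom \<kappa>" "finite S" "Poly_Mapping.keys p \<subseteq> S"
  shows "mev \<kappa> \<theta> p = (\<Sum>m\<in>S. \<kappa> (Poly_Mapping.lookup p m) * mon \<theta> m)"
  unfolding mev_def by (rule sum.mono_neutral_left) (use assms in \<open>auto simp: in_keys_iff rhom_def\<close>)

lemma mev_single: "rhom \<kappa> \<Longrightarrow> mev \<kappa> \<theta> (Poly_Mapping.single m c) = \<kappa> c * mon \<theta> m"
  using mev_superset[of \<kappa> "{m}" "Poly_Mapping.single m c" \<theta>] by (simp split: if_splits)

lemma mev_add: "rhom \<kappa> \<Longrightarrow> mev \<kappa> \<theta> (p + q) = mev \<kappa> \<theta> p + mev \<kappa> \<theta> q"
  using mev_superset[of \<kappa> "Poly_Mapping.keys p \<union> Poly_Mapping.keys q" p \<theta>]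
    mev_superset[of \<kappa> "Poly_Mapping.keys p \<union> Poly_Mapping.keys q" q \<theta>]
    mev_superset[of \<kappa> "Poly_Mapping.keys p \<union> Poly_Mapping.keys q" "p + q" \<theta>]
    Poly_Mapping.keys_add[of p q]
  by (simp add: lookup_add rhom_def distrib_right sum.distrib)

lemma mev_mult:
  assumes "rhom \<kappa>" shows "mev \<kappa> \<theta> (p * q) = mev \<kappa> \<theta> p * mev \<kappa> \<theta> q"
proof -
  have 0: "mev \<kappa> \<theta> 0 = 0" by (simp add: mev_def)
  show ?thesis
proof (induction p rule: single_induct)
  case (single m c)
  show ?case
  proof (induction q rule: single_induct)
    case (single m' c')
    then show ?case using assms by (simp add: mult_single mev_single rhom_def algebra_simps)
  qed (simp_all add: 0 mev_add[OF assms] algebra_simps)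
qed (simp_all add: 0 mev_add[OF assms] algebra_simps)
qed

lemma mev_Const: "rhom \<kappa> \<Longrightarrow> mev \<kappa> \<theta> (Const c) = \<kappa> c"
  by (simp add: Const_def mev_single)

lemma mev_Var: "rhom \<kappa> \<Longrightarrow> mev \<kappa> \<theta> (Var x) = \<theta> x"
  by (simp add: Var_def mev_single) (simp add: rhom_def)

lemma rhom_mev: "rhom \<kappa> \<Longrightarrow> rhom (mev \<kappa> \<theta>)"
  using mev_Const[of \<kappa> \<theta> 0] mev_Const[of \<kappa> \<theta> 1]
  by (auto simp: rhom_def[of "mev \<kappa> \<theta>"] mev_add mev_mult) (auto simp: rhom_def)

lemma rhom_simps:
  assumes "rhom \<kappa>"
  shows "\<kappa> 0 = 0" "\<kappa> 1 = 1" "\<kappa> (a + b) = \<kappa> a + \<kappa> b" "\<kappa> (a * b) = \<kappa> a * \<kappa> b"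
    "\<kappa> (- a) = - \<kappa> a" "\<kappa> (a - b) = \<kappa> a - \<kappa> b" "\<kappa> (sum f A) = (\<Sum>x\<in>A. \<kappa> (f x))"
    "\<kappa> (a ^ n) = \<kappa> a ^ n"
proof -
  note * = assms[unfolded rhom_def]
  show "\<kappa> 0 = 0" "\<kappa> 1 = 1" "\<kappa> (a + b) = \<kappa> a + \<kappa> b" "\<kappa> (a * b) = \<kappa> a * \<kappa> b" using * by auto
  show m: "\<kappa> (- a) = - \<kappa> a" for a
    using * by (metis add.right_inverse add_eq_0_iff)
  show "\<kappa> (a - b) = \<kappa> a - \<kappa> b" using m * by (metis add_uminus_conv_diff)
  show "\<kappa> (sum f A) = (\<Sum>x\<in>A. \<kappa> (f x))"
    by (induction A rule: infinite_finite_induct) (use * in auto)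
  show "\<kappa> (a ^ n) = \<kappa> a ^ n" by (induction n) (use * in auto)
qed

lemma rhom_Const: "rhom Const"
  by (simp add: rhom_def)

lemma subst_pol_eq_mev: "subst_pol \<theta> = mev Const \<theta>"
  by (rule ext) (simp add: subst_pol_def mev_def mon_def)

lemma mev_compose:
  assumes "rhom \<kappa>" "rhom h" "\<And>c. h (\<kappa>' c) = \<kappa> c" "rhom \<kappa>'"
  shows "h (mev \<kappa>' \<theta> p) = mev \<kappa> (\<lambda>x. h (\<theta> x)) p"
  by (induction p rule: mpol_induct)
    (simp_all add: mev_Const mev_add mev_mult mev_Var assms rhom_simps[OF assms(2)])

lemma mev_subst_pol:
  "rhom \<kappa> \<Longrightarrow> mev \<kappa> \<phi> (subst_pol \<theta> p) = mev \<kappa> (\<lambda>x. mev \<kappa> \<phi> (\<theta> x)) p"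
  unfolding subst_pol_eq_mev
  by (rule mev_compose) (auto simp: rhom_mev mev_Const rhom_Const)

lemma mev_cong:
  assumes "\<And>x. x \<in> vars p \<Longrightarrow> \<theta> x = \<theta>' x"
  shows "mev \<kappa> \<theta> p = mev \<kappa> \<theta>' p"
proof -
  have "\<theta> x = \<theta>' x" if "m \<in> Poly_Mapping.keys p" "x \<in> Poly_Mapping.keys m" for m x
    by (rule assms) (use that in \<open>auto simp: vars_def\<close>)
  then show ?thesis
    unfolding mev_def mon_def by (intro sum.cong refl arg_cong2[where f = "(*)"] prod.cong) auto
qed

lemmas subst_pol_simps = rhom_simps[OF rhom_mev[OF rhom_Const], folded subst_pol_eq_mev]
  mev_Const[OF rhom_Const, folded subst_pol_eq_mev] mev_Var[OF rhom_Const, folded subst_pol_eq_mev]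

subsection \<open>Derivations\<close>

lemma lookup_pdv: "Poly_Mapping.lookup (pdv x p) m =
  of_nat (Poly_Mapping.lookup m x + 1) * Poly_Mapping.lookup p (m + Poly_Mapping.single x 1)"
proof -
  have eq: "(m' - Poly_Mapping.single x 1 = m) = (m' = m + Poly_Mapping.single x 1)"
    if "Poly_Mapping.lookup m' x > 0" for m'
    using exponent_split[OF that] by (metis add.commute add_right_cancel)
  have "Poly_Mapping.lookup (pdv x p) m = (\<Sum>m'\<in>Poly_Mapping.keys p.
     if m' = m + Poly_Mapping.single x 1
     then of_nat (Poly_Mapping.lookup m' x) * Poly_Mapping.lookup p m' else 0)"
    unfolding pdv_def lookup_sum
  proof (intro sum.cong refl)
    fix m' assume "m' \<in> Poly_Mapping.keys p"
    show "Poly_Mapping.lookup (Poly_Mapping.single (m' - Poly_Mapping.single x 1)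
        (of_nat (Poly_Mapping.lookup m' x) * Poly_Mapping.lookup p m')) m =
      (if m' = m + Poly_Mapping.single x 1
       then of_nat (Poly_Mapping.lookup m' x) * Poly_Mapping.lookup p m' else 0)"
      by (cases "Poly_Mapping.lookup m' x = 0")
        (use eq[of m'] in \<open>auto simp: lookup_single lookup_add when_def\<close>)
  qed
  also have "\<dots> = of_nat (Poly_Mapping.lookup m x + 1) * Poly_Mapping.lookup p (m + Poly_Mapping.single x 1)"
    by (auto simp: in_keys_iff lookup_add)
  finally show ?thesis .
qed

lemma pdv_add: "pdv x (p + q) = pdv x p + pdv x q"
  by (rule poly_mapping_eqI) (simp add: lookup_pdv lookup_add algebra_simps)

lemma pdv_single: "pdv x (Poly_Mapping.single m c) =
   Poly_Mapping.single (m - Poly_Mapping.single x 1) (of_nat (Poly_Mapping.lookup m x) * c)"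
  by (auto simp: pdv_def)

lemma pdv_0 [simp]: "pdv x 0 = 0"
  by (simp add: pdv_def)

lemma pdv_mult: "pdv x (p * q) = pdv x p * q + p * pdv x q"
proof (induction p rule: single_induct)
  case (single m c)
  show ?case
  proof (induction q rule: single_induct)
    case (single m' c')
    let ?x = "Poly_Mapping.single x (1::nat)"
    have 1: "Poly_Mapping.single (m + m' - ?x) (of_nat (Poly_Mapping.lookup m x) * (c * c')) =
        Poly_Mapping.single (m - ?x + m') (of_nat (Poly_Mapping.lookup m x) * (c * c'))" for m m' c c'
    proof (cases "Poly_Mapping.lookup m x = 0")
      case False
      then have "m + m' - ?x = m - ?x + m'"
        by (intro poly_mapping_eqI) (auto simp: lookup_add lookup_minus lookup_single when_def)
      then show ?thesis by simp
    qed simp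
    show ?case
      using 1[of m m' c c'] 1[of m' m c c']
      by (simp add: mult_single pdv_single lookup_add algebra_simps single_add)
  qed (simp_all add: pdv_add algebra_simps)
qed (simp_all add: pdv_add algebra_simps)

lemma pdv_Const [simp]: "pdv x (Const c) = 0"
  by (simp add: Const_def pdv_single)

lemma pdv_Var: "pdv x (Var y) = (if x = y then 1 else 0)"
  by (auto simp: Var_def pdv_single lookup_single)

lemma vars_add: "vars (p + q) \<subseteq> vars p \<union> vars q"
  using Poly_Mapping.keys_add[of p q] by (auto simp: vars_def)

lemma vars_mult: "vars (p * q) \<subseteq> vars p \<union> vars q"
proof
  fix x assume "x \<in> vars (p * q)"
  then obtain m where "m \<in> Poly_Mapping.keys (p * q)" "x \<in> Poly_Mapping.keys m" by (auto simp: vars_def)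
  moreover obtain a b where "a \<in> Poly_Mapping.keys p" "b \<in> Poly_Mapping.keys q" "m = a + b"
    using keys_mult[of p q] calculation(1) by blast
  ultimately show "x \<in> vars p \<union> vars q" using Poly_Mapping.keys_add[of a b] by (auto simp: vars_def)
qed

lemma vars_Const [simp]: "vars (Const c) = {}"
  by (auto simp: vars_def Const_def)

lemma vars_Var [simp]: "vars (Var x :: ('v, 'k::comm_ring_1) mpol) = {x}"
  by (auto simp: vars_def Var_def)

lemma vars_sum: "vars (sum f A) \<subseteq> (\<Union>x\<in>A. vars (f x))"
proof (induction A rule: infinite_finite_induct)
  case (insert x A)
  then show ?case using vars_add[of "f x" "sum f A"] by auto
qed (auto simp: vars_def)

lemma vars_zero [simp]: "vars 0 = {}" by (simp add: vars_def)

lemma pdv_eq_0: "x \<notin> vars p \<Longrightarrow> pdv x p = 0"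
proof (rule poly_mapping_eqI)
  fix m :: "'a \<Rightarrow>\<^sub>0 nat" assume "x \<notin> vars p"
  moreover have "x \<in> Poly_Mapping.keys (m + Poly_Mapping.single x 1)"
    by (simp add: in_keys_iff lookup_add lookup_single)
  ultimately have "m + Poly_Mapping.single x 1 \<notin> Poly_Mapping.keys p"
    unfolding vars_def by blast
  then have "Poly_Mapping.lookup p (m + Poly_Mapping.single x 1) = 0"
    by (simp only: in_keys_iff not_not)
  then show "Poly_Mapping.lookup (pdv x p) m = Poly_Mapping.lookup 0 m"
    unfolding lookup_pdv by simp
qed

text \<open>The derivation of the polynomial ring with prescribed values on the variables.\<close>
definition der :: "('v \<Rightarrow> ('v, 'k::comm_ring_1) mpol) \<Rightarrow> ('v, 'k) mpol \<Rightarrow> ('v, 'k) mpol"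
  where "der \<phi> p = (\<Sum>x\<in>vars p. \<phi> x * pdv x p)"

lemma der_superset:
  assumes "finite S" "vars p \<subseteq> S"
  shows "der \<phi> p = (\<Sum>x\<in>S. \<phi> x * pdv x p)"
  unfolding der_def by (rule sum.mono_neutral_left) (use assms in \<open>auto simp: pdv_eq_0\<close>)

lemma der_add: "der \<phi> (p + q) = der \<phi> p + der \<phi> q"
  using der_superset[of "vars p \<union> vars q" p \<phi>] der_superset[of "vars p \<union> vars q" q \<phi>]
    der_superset[of "vars p \<union> vars q" "p + q" \<phi>] vars_add[of p q]
  by (simp add: pdv_add sum.distrib distrib_left)

lemma der_mult: "der \<phi> (p * q) = der \<phi> p * q + p * der \<phi> q"
  using der_superset[of "vars p \<union> vars q" p \<phi>] der_superset[of "vars p \<union> vars q" q \<phi>]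
    der_superset[of "vars p \<union> vars q" "p * q" \<phi>] vars_mult[of p q]
  by (simp add: pdv_mult sum.distrib distrib_left sum_distrib_left sum_distrib_right algebra_simps)

lemma der_Const [simp]: "der \<phi> (Const c) = 0"
  by (simp add: der_def)

lemma der_Var [simp]: "der \<phi> (Var x) = \<phi> x"
  by (simp add: der_def pdv_Var)

lemma der_0 [simp]: "der \<phi> 0 = 0"
  by (simp add: der_def)

lemma der_sum: "der \<phi> (sum f A) = (\<Sum>x\<in>A. der \<phi> (f x))"
  by (induction A rule: infinite_finite_induct) (auto simp: der_add)

lemma der_Const_mult: "der \<phi> (Const c * p) = Const c * der \<phi> p"
  by (simp add: der_mult)

lemma der_minus: "der \<phi> (- p) = - der \<phi> p"
  using der_Const_mult[of \<phi> "-1" p] by simp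

lemma der_diff: "der \<phi> (p - q) = der \<phi> p - der \<phi> q"
  using der_add[of \<phi> p "- q"] by (simp add: der_minus)

lemma der_fun_add: "der (\<lambda>x. \<phi> x + \<psi> x) p = der \<phi> p + der \<psi> p"
  by (simp add: der_def distrib_right sum.distrib)

lemma der_fun_mult: "der (\<lambda>x. q * \<phi> x) p = q * der \<phi> p"
  by (simp add: der_def sum_distrib_left mult.assoc)

lemma der_cong: "(\<And>x. x \<in> vars p \<Longrightarrow> \<phi> x = \<psi> x) \<Longrightarrow> der \<phi> p = der \<psi> p"
  by (simp add: der_def)

subsection \<open>Polynomials as functions\<close>

definition pev :: "('v \<Rightarrow> 'k::comm_ring_1) \<Rightarrow> ('v, 'k) mpol \<Rightarrow> 'k"
  where "pev v = mev (\<lambda>c. c) v"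

definition line :: "('v \<Rightarrow> 'k::comm_ring_1) \<Rightarrow> ('v \<Rightarrow> 'k) \<Rightarrow> ('v, 'k) mpol \<Rightarrow> 'k poly"
  where "line v w = mev (\<lambda>c. [:c:]) (\<lambda>x. [:v x, w x:])"

text \<open>The derivative of \<open>p\<close> at \<open>v\<close> in the direction \<open>w\<close> is the linear coefficient of \<open>p\<close> on the line
  \<open>v + t w\<close>. In this form it is determined by the values of \<open>p\<close>, without reference to the
  coefficients.\<close>
definition dd :: "('v \<Rightarrow> 'k::comm_ring_1) \<Rightarrow> ('v \<Rightarrow> 'k) \<Rightarrow> ('v, 'k) mpol \<Rightarrow> 'k"
  where "dd v w p = coeff (line v w p) 1"

lemma rhom_id: "rhom (\<lambda>c. c)" by (simp add: rhom_def)
lemma rhom_pCons: "rhom (\<lambda>c. [:c:])" by (simp add: rhom_def one_pCons)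
lemma rhom_pev: "rhom (pev v)" unfolding pev_def by (rule rhom_mev[OF rhom_id])
lemma rhom_line: "rhom (line v w)" unfolding line_def by (rule rhom_mev[OF rhom_pCons])

lemmas pev_simps = rhom_simps[OF rhom_pev] mev_Const[OF rhom_id, folded pev_def] mev_Var[OF rhom_id, folded pev_def]

lemma line_Const: "line v w (Const c) = [:c:]" and line_Var: "line v w (Var x) = [:v x, w x:]"
  by (simp_all add: line_def mev_Const[OF rhom_pCons] mev_Var[OF rhom_pCons])

lemmas line_simps = rhom_simps[OF rhom_line] line_Const line_Var

lemma poly_line: "poly (line v w p) t = pev (\<lambda>x. v x + t * w x) p"
proof -
  have "rhom (\<lambda>q. poly q t)" by (simp add: rhom_def)
  from mev_compose[OF rhom_id this _ rhom_pCons, of "\<lambda>x. [:v x, w x:]" p] show ?thesis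
    by (simp add: line_def pev_def)
qed

lemma coeff_line_0: "coeff (line v w p) 0 = pev v p"
  using poly_line[of v w p 0] by (simp add: poly_0_coeff_0)

lemma dd_simps: "dd v w (p + q) = dd v w p + dd v w q"
  "dd v w (p * q) = dd v w p * pev v q + pev v p * dd v w q"
  "dd v w (Const c) = 0" "dd v w (Var x) = w x" "dd v w 0 = 0"
  by (simp_all add: dd_def line_simps coeff_mult coeff_line_0 algebra_simps)

lemma pev_der: "pev v (der \<phi> p) = dd v (\<lambda>x. pev v (\<phi> x)) p"
  by (induction p rule: mpol_induct) (simp_all add: pev_simps dd_simps der_add der_mult)

lemma dd_add_right: "dd v (\<lambda>x. w x + w' x) p = dd v w p + dd v w' p"
  by (induction p rule: mpol_induct) (simp_all add: dd_simps algebra_simps)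

lemma dd_scale_right: "dd v (\<lambda>x. c * w x) p = c * dd v w p"
  by (induction p rule: mpol_induct) (simp_all add: dd_simps algebra_simps)

lemma pev_subst_pol: "pev v (subst_pol \<theta> p) = pev (\<lambda>x. pev v (\<theta> x)) p"
  unfolding pev_def by (rule mev_subst_pol[OF rhom_id])

lemma pev_cong: "(\<And>x. x \<in> vars p \<Longrightarrow> v x = v' x) \<Longrightarrow> pev v p = pev v' p"
  unfolding pev_def by (rule mev_cong)

lemma dd_cong: "(\<And>x. x \<in> vars p \<Longrightarrow> v x = v' x) \<Longrightarrow> (\<And>x. x \<in> vars p \<Longrightarrow> w x = w' x) \<Longrightarrow> dd v w p = dd v' w' p"
  unfolding dd_def line_def by (metis (mono_tags, lifting) mev_cong)

lemma poly_eq_all: "(\<And>t. poly p t = poly q (t::'k::field_char_0)) \<Longrightarrow> p = q"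
  using poly_eq_poly_eq_iff[of p q] by (auto simp: fun_eq_iff)

lemma mpol_Const_if_pdv_zero:
  assumes "\<And>x. pdv x p = (0 :: ('v, 'k::field_char_0) mpol)"
  shows "p = Const (Poly_Mapping.lookup p 0)"
proof (rule poly_mapping_eqI)
  fix m
  show "Poly_Mapping.lookup p m = Poly_Mapping.lookup (Const (Poly_Mapping.lookup p 0)) m"
  proof (cases "Poly_Mapping.keys m = {}")
    case True
    then show ?thesis by (simp add: Const_def)
  next
    case False
    then obtain x where x: "x \<in> Poly_Mapping.keys m" by blast
    then have m: "m = (m - Poly_Mapping.single x 1) + Poly_Mapping.single x 1"
      using exponent_split[of m x] by (simp add: in_keys_iff add.commute)
    have "Poly_Mapping.lookup (pdv x p) (m - Poly_Mapping.single x 1) = 0" using assms by simp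
    then have "Poly_Mapping.lookup p m = 0"
      unfolding lookup_pdv using m[symmetric] of_nat_neq_0 by (metis Suc_eq_plus1 mult_eq_0_iff)
    moreover have "m \<noteq> 0" using False by auto
    ultimately show ?thesis by (simp add: Const_def lookup_single when_def)
  qed
qed

text \<open>A nonzero polynomial of minimal degree with vanishing values would have vanishing partial
  derivatives, because a derivative is a coefficient of the restriction to a line; in
  characteristic \<open>0\<close> it would then be a constant.\<close>
lemma pev_zero_imp_zero:
  assumes "\<And>v. pev v p = (0 :: 'k::field_char_0)"
  shows "p = 0"
proof -
  have "p = 0" if "\<And>m. m \<in> Poly_Mapping.keys p \<Longrightarrow> mdeg m \<le> N" "\<And>v. pev v p = 0"
    for p :: "('v, 'k) mpol" and N
    using that
  proof (induction N arbitrary: p rule: less_induct)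
    case (less N)
    have "pdv x p = 0" for x
    proof (cases "x \<in> vars p")
      case True
      have "N > 0"
      proof (rule ccontr)
        assume "\<not> N > 0"
        with less.prems(1) True show False by (auto simp: vars_def mdeg_def in_keys_iff)
      qed
      have "pev v (pdv x p) = 0" for v
      proof -
        have "line v (\<lambda>y. if y = x then 1 else 0) p = 0"
          by (rule poly_eq_all) (simp add: poly_line less.prems(2))
        then have "dd v (\<lambda>y. if y = x then 1 else 0) p = 0" by (simp add: dd_def)
        moreover have "pdv x p = der (\<lambda>y. if y = x then 1 else 0) p"
          by (subst der_superset[of "insert x (vars p)"]) (auto intro!: sum.neutral simp: sum.insert_remove)
        ultimately show ?thesis
          by (simp add: pev_der if_distrib[of "pev v"] pev_simps cong: if_cong)
      qed
      moreover have "mdeg m \<le> N - 1" if "m \<in> Poly_Mapping.keys (pdv x p)" for m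
      proof -
        have "m + Poly_Mapping.single x 1 \<in> Poly_Mapping.keys p"
          using that unfolding in_keys_iff lookup_pdv by auto
        from less.prems(1)[OF this] show ?thesis by simp
      qed
      ultimately show ?thesis using less.IH[of "N - 1" "pdv x p"] \<open>N > 0\<close> by simp
    qed (rule pdv_eq_0)
    then have "p = Const (Poly_Mapping.lookup p 0)" by (rule mpol_Const_if_pdv_zero)
    moreover from this less.prems(2) have "Poly_Mapping.lookup p 0 = 0"
      by (metis pev_simps(9))
    ultimately show "p = 0" by simp
  qed
  from this[of p "Max (mdeg ` Poly_Mapping.keys p)"] assms show ?thesis by simp
qed

lemma mpol_eqI: "(\<And>v. pev v p = pev v q) \<Longrightarrow> p = (q :: ('v, 'k::field_char_0) mpol)"
  using pev_zero_imp_zero[of "p - q"] by (simp add: pev_simps)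

unbundle fps_syntax

section \<open>The Baker--Campbell--Hausdorff formula of Dynkin\<close>

subsection \<open>Rings of additive endomorphisms\<close>

text \<open>The second component of a pair will be the coefficient of an Euler derivation that is adjoined
  to the first. Its presence also makes the ring nontrivial for every choice of the first
  component.\<close>
typedef (overloaded) ('a, 'k) aend = "{f :: 'a::ab_group_add \<times> 'k::ring_1 \<Rightarrow> 'a \<times> 'k. \<forall>x y. f (x + y) = f x + f y}"
  morphisms app Aend
  by (rule exI[of _ "\<lambda>x. x"]) auto

setup_lifting type_definition_aend

lemma app_add [simp]: "app f (x + y) = app f x + app f y"
  by transfer auto

lemma aend_eqI: "(\<And>x. app f x = app g x) \<Longrightarrow> f = g"
  by transfer auto

instantiation aend :: (ab_group_add, ring_1) ring_1
begin
lift_definition zero_aend :: "('a, 'b) aend" is "\<lambda>x. 0" by simp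
lift_definition one_aend :: "('a, 'b) aend" is "\<lambda>x. x" by simp
lift_definition plus_aend :: "('a, 'b) aend \<Rightarrow> ('a, 'b) aend \<Rightarrow> ('a, 'b) aend" is "\<lambda>f g x. f x + g x"
  by (simp add: algebra_simps)
lift_definition minus_aend :: "('a, 'b) aend \<Rightarrow> ('a, 'b) aend \<Rightarrow> ('a, 'b) aend" is "\<lambda>f g x. f x - g x"
  by (simp add: algebra_simps)
lift_definition uminus_aend :: "('a, 'b) aend \<Rightarrow> ('a, 'b) aend" is "\<lambda>f x. - f x"
  by (simp add: algebra_simps)
lift_definition times_aend :: "('a, 'b) aend \<Rightarrow> ('a, 'b) aend \<Rightarrow> ('a, 'b) aend" is "\<lambda>f g x. f (g x)"
  by simp
instance
proof
  show "(0 :: ('a, 'b) aend) \<noteq> 1"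
  proof
    assume "(0 :: ('a, 'b) aend) = 1"
    then have "app (0 :: ('a, 'b) aend) (0, 1) = app 1 (0, 1)" by simp
    then show False by (simp add: zero_aend.rep_eq one_aend.rep_eq zero_prod_def)
  qed
qed (rule aend_eqI;
  simp add: zero_aend.rep_eq one_aend.rep_eq plus_aend.rep_eq minus_aend.rep_eq uminus_aend.rep_eq
    times_aend.rep_eq add_ac)+
end

lemma app_simps [simp]:
  "app 0 x = 0" "app 1 x = x" "app (f + g) x = app f x + app g x" "app (f - g) x = app f x - app g x"
  "app (- f) x = - app f x" "app (f * g) x = app f (app g x)"
  by (transfer; simp)+

lemma app_0 [simp]: "app f 0 = 0"
  using app_add[of f 0 0] by simp

lemma app_sum: "app (sum f A) x = (\<Sum>a\<in>A. app (f a) x)"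
  by (induction A rule: infinite_finite_induct) auto

lemma app_sum_right: "app f (sum h A) = (\<Sum>a\<in>A. app f (h a))"
  by (induction A rule: infinite_finite_induct) auto

lemma app_Aend: "(\<And>x y. f (x + y) = f x + f y) \<Longrightarrow> app (Aend f) x = f x"
  by (subst Aend_inverse) auto

lemma fst_sum': "fst (sum f A) = (\<Sum>x\<in>A. fst (f x))" and snd_sum': "snd (sum f A) = (\<Sum>x\<in>A. snd (f x))"
  by (induction A rule: infinite_finite_induct; simp)+

subsection \<open>Substitution of power series without constant term into rational power series\<close>

lemma fps_mult_nth_atMost: "(f * g) $ n = (\<Sum>i\<le>n. f $ i * g $ (n - i))"
  by (simp add: fps_mult_nth atLeast0AtMost)

lemma triangle_sum:
  fixes t :: "nat \<Rightarrow> nat \<Rightarrow> 'z::comm_monoid_add"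
  assumes "\<And>n m. n + m > i \<Longrightarrow> t n m = 0"
  shows "(\<Sum>n\<le>i. \<Sum>m\<le>i. t n m) = (\<Sum>s\<le>i. \<Sum>n\<le>s. t n (s - n))"
proof -
  have "(\<Sum>n\<le>i. \<Sum>m\<le>i. t n m) = (\<Sum>(n, m)\<in>{..i} \<times> {..i}. t n m)"
    by (simp add: sum.cartesian_product)
  also have "\<dots> = (\<Sum>(n, m)\<in>{(n, m). n + m \<le> i}. t n m)"
    by (rule sum.mono_neutral_right) (use assms not_le in auto)
  finally show ?thesis by (simp add: sum.triangle_reindex_eq)
qed

locale rat_scalars =
  fixes \<kappa> :: "rat \<Rightarrow> 'r::ring_1"
  assumes \<kappa>_1 [simp]: "\<kappa> 1 = 1"
    and \<kappa>_add [simp]: "\<kappa> (a + b) = \<kappa> a + \<kappa> b"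
    and \<kappa>_mult [simp]: "\<kappa> (a * b) = \<kappa> a * \<kappa> b"
begin

lemma \<kappa>_0 [simp]: "\<kappa> 0 = 0"
  using \<kappa>_add[of 0 0] by simp

lemma \<kappa>_minus [simp]: "\<kappa> (- a) = - \<kappa> a"
  using \<kappa>_add[of a "- a"] by (simp add: eq_neg_iff_add_eq_0 add.commute)

lemma \<kappa>_sum: "\<kappa> (sum f A) = (\<Sum>x\<in>A. \<kappa> (f x))"
  by (induction A rule: infinite_finite_induct) auto

lemma \<kappa>_of_nat [simp]: "\<kappa> (of_nat n) = of_nat n"
  by (induction n) auto

lemma \<kappa>_of_int [simp]: "\<kappa> (of_int n) = of_int n"
  by (cases n rule: int_cases2) auto

text \<open>Integers are central, and so are the inverses of central elements.\<close>
lemma \<kappa>_commute: "\<kappa> q * x = x * \<kappa> q"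
proof -
  obtain a b where q: "q = of_int a / of_int b" and b: "b > 0"
    by (metis Fract_of_int_quotient Rat_cases)
  let ?u = "\<kappa> (1 / of_int b)"
  have u: "?u * of_int b = 1" "of_int b * ?u = 1"
    using \<kappa>_mult[of "1 / of_int b" "of_int b"] \<kappa>_mult[of "of_int b" "1 / of_int b"] b by simp_all
  have "?u * x = ?u * x * (of_int b * ?u)" by (simp add: u)
  also have "\<dots> = ?u * (x * of_int b) * ?u" by (simp add: mult.assoc)
  also have "x * of_int b = of_int b * x" by (simp add: mult_of_int_commute)
  also have "?u * (of_int b * x) * ?u = (?u * of_int b) * x * ?u" by (simp add: mult.assoc)
  also have "\<dots> = x * ?u" by (simp add: u)
  finally have ux: "?u * x = x * ?u" .
  have "\<kappa> q = of_int a * ?u" using \<kappa>_mult[of "of_int a" "1 / of_int b"] by (simp add: q)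
  then show ?thesis by (metis ux mult.assoc mult_of_int_commute)
qed

lemma \<kappa>_left_commute: "x * (\<kappa> q * y) = \<kappa> q * (x * y)"
  by (metis \<kappa>_commute mult.assoc)

text \<open>The value of \<open>F\<close> at a series \<open>a\<close> without constant term, over a ring that may be
  noncommutative; \<open>a ^ n\<close> contributes nothing to the coefficient of index \<open>i\<close> for \<open>n > i\<close>.\<close>
definition fev :: "rat fps \<Rightarrow> 'r fps \<Rightarrow> 'r fps"
  where "fev F a = Abs_fps (\<lambda>i. \<Sum>n\<le>i. \<kappa> (F $ n) * (a ^ n) $ i)"

lemma fev_nth:
  assumes "a $ 0 = 0" "i \<le> N"
  shows "fev F a $ i = (\<Sum>n\<le>N. \<kappa> (F $ n) * (a ^ n) $ i)"
  unfolding fev_def fps_nth_Abs_fps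
  by (rule sum.mono_neutral_left) (use assms startsby_zero_power_prefix[OF assms(1)] in auto)

lemma fev_0 [simp]: "fev F a $ 0 = \<kappa> (F $ 0)"
  by (simp add: fev_def)

lemma fev_add: "fev (F + G) a = fev F a + fev G a"
  by (rule fps_ext) (simp add: fev_def distrib_right sum.distrib)

lemma fev_minus: "fev (- F) a = - fev F a"
  by (rule fps_ext) (simp add: fev_def sum_negf)

lemma fev_diff: "fev (F - G) a = fev F a - fev G a"
  using fev_add[of F "- G" a] by (simp add: fev_minus)

lemma fev_1 [simp]: "fev 1 a = 1"
proof (rule fps_ext)
  fix i
  have "fev 1 a $ i = (\<Sum>n\<le>i. if n = 0 then 1 $ i else 0)"
    unfolding fev_def fps_nth_Abs_fps by (rule sum.cong) auto
  then show "fev 1 a $ i = 1 $ i" by simp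
qed

lemma fev_X:
  assumes "a $ 0 = 0" shows "fev fps_X a = a"
proof (rule fps_ext)
  fix i
  have "fev fps_X a $ i = (\<Sum>n\<le>Suc i. \<kappa> (fps_X $ n) * (a ^ n) $ i)"
    by (rule fev_nth) (use assms in auto)
  also have "\<dots> = (\<Sum>n\<le>Suc i. if n = 1 then a $ i else 0)"
    by (rule sum.cong) (auto simp: fps_X_nth)
  finally have "fev fps_X a $ i = (\<Sum>n\<le>Suc i. if n = 1 then a $ i else 0)" .
  then show "fev fps_X a $ i = a $ i" by simp
qed

text \<open>Both products below are the sum over \<open>n\<close> and \<open>m\<close> of the terms of bidegree \<open>(n, m)\<close>; the
  factors need not commute, only the scalars have to be central.\<close>
lemma fev_mult_gen:
  assumes a: "\<And>n i. i < n \<Longrightarrow> A n $ i = 0" and b: "\<And>n i. i < n \<Longrightarrow> B n $ i = 0"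
  shows "(Abs_fps (\<lambda>i. \<Sum>n\<le>i. \<kappa> (F n) * A n $ i) * Abs_fps (\<lambda>i. \<Sum>n\<le>i. \<kappa> (G n) * B n $ i)) $ i =
    (\<Sum>s\<le>i. \<Sum>n\<le>s. \<kappa> (F n * G (s - n)) * (A n * B (s - n)) $ i)"
proof -
  have 1: "(\<Sum>n\<le>j. \<kappa> (F n) * A n $ j) = (\<Sum>n\<le>i. \<kappa> (F n) * A n $ j)"
    if "\<And>n i. i < n \<Longrightarrow> A n $ i = 0" "j \<le> i"
    for j F and A :: "nat \<Rightarrow> 'r fps"
    by (rule sum.mono_neutral_left) (use that in auto)
  have "(Abs_fps (\<lambda>i. \<Sum>n\<le>i. \<kappa> (F n) * A n $ i) * Abs_fps (\<lambda>i. \<Sum>n\<le>i. \<kappa> (G n) * B n $ i)) $ i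
    = (\<Sum>j\<le>i. (\<Sum>n\<le>i. \<kappa> (F n) * A n $ j) * (\<Sum>m\<le>i. \<kappa> (G m) * B m $ (i - j)))"
    unfolding fps_mult_nth_atMost fps_nth_Abs_fps
    by (intro sum.cong refl arg_cong2[where f = "(*)"] 1) (use a b in auto)
  also have "\<dots> = (\<Sum>j\<le>i. \<Sum>n\<le>i. \<Sum>m\<le>i. \<kappa> (F n * G m) * (A n $ j * B m $ (i - j)))"
  proof -
    have "(x * y) * (z * w) = \<kappa> (p * q) * (y * w)" if "x = \<kappa> p" "z = \<kappa> q" for x y z w p q
      unfolding that \<kappa>_mult mult.assoc by (simp only: \<kappa>_left_commute[of y q w])
    then show ?thesis unfolding sum_product by (intro sum.cong refl) auto
  qed
  also have "\<dots> = (\<Sum>n\<le>i. \<Sum>j\<le>i. \<Sum>m\<le>i. \<kappa> (F n * G m) * (A n $ j * B m $ (i - j)))"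
    by (rule sum.swap)
  also have "\<dots> = (\<Sum>n\<le>i. \<Sum>m\<le>i. \<Sum>j\<le>i. \<kappa> (F n * G m) * (A n $ j * B m $ (i - j)))"
    by (intro sum.cong refl sum.swap)
  also have "\<dots> = (\<Sum>n\<le>i. \<Sum>m\<le>i. \<kappa> (F n * G m) * (A n * B m) $ i)"
    by (simp add: fps_mult_nth_atMost sum_distrib_left)
  also have "\<dots> = (\<Sum>s\<le>i. \<Sum>n\<le>s. \<kappa> (F n * G (s - n)) * (A n * B (s - n)) $ i)"
  proof (rule triangle_sum)
    fix n m assume nm: "i < n + m"
    have "(A n * B m) $ i = 0"
      unfolding fps_mult_nth_atMost
    proof (rule sum.neutral, intro ballI)
      fix j assume "j \<in> {..i}"
      then show "A n $ j * B m $ (i - j) = 0"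
        using nm a[of j n] b[of "i - j" m] by (cases "j < n") auto
    qed
    then show "\<kappa> (F n * G m) * (A n * B m) $ i = 0" by simp
  qed
  finally show ?thesis .
qed

lemma fev_mult:
  assumes "a $ 0 = 0" shows "fev (F * G) a = fev F a * fev G a"
proof (rule fps_ext)
  fix i
  have "(fev F a * fev G a) $ i =
      (\<Sum>s\<le>i. \<Sum>n\<le>s. \<kappa> (F $ n * G $ (s - n)) * (a ^ n * a ^ (s - n)) $ i)"
    unfolding fev_def by (rule fev_mult_gen) (use startsby_zero_power_prefix[OF assms] in auto)
  also have "\<dots> = (\<Sum>s\<le>i. \<kappa> ((F * G) $ s) * (a ^ s) $ i)"
    by (simp add: fps_mult_nth_atMost \<kappa>_sum sum_distrib_right flip: power_add)
  finally show "fev (F * G) a $ i = (fev F a * fev G a) $ i" by (simp add: fev_def)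
qed

lemma fev_power: "a $ 0 = 0 \<Longrightarrow> fev (F ^ n) a = fev F a ^ n"
  by (induction n) (auto simp: fev_mult)

lemma fev_compose:
  assumes a: "a $ 0 = 0" and G: "G $ 0 = 0" shows "fev (F oo G) a = fev F (fev G a)"
proof (rule fps_ext)
  fix i
  have "fev F (fev G a) $ i = (\<Sum>n\<le>i. \<kappa> (F $ n) * fev (G ^ n) a $ i)"
    by (subst fev_nth[of _ i i]) (auto simp: G fev_power a)
  also have "\<dots> = (\<Sum>n\<le>i. \<Sum>m\<le>i. \<kappa> (F $ n * (G ^ n) $ m) * (a ^ m) $ i)"
    by (simp add: fev_def sum_distrib_left mult.assoc)
  also have "\<dots> = (\<Sum>m\<le>i. \<kappa> (\<Sum>n\<le>i. F $ n * (G ^ n) $ m) * (a ^ m) $ i)"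
    by (subst sum.swap) (simp add: \<kappa>_sum sum_distrib_right)
  also have "\<dots> = fev (F oo G) a $ i"
    unfolding fev_def fps_nth_Abs_fps
  proof (intro sum.cong refl arg_cong2[where f = "(*)"] arg_cong[of _ _ \<kappa>])
    fix m assume m: "m \<in> {..i}"
    show "(\<Sum>n\<le>i. F $ n * (G ^ n) $ m) = (F oo G) $ m"
      unfolding fps_compose_nth atLeast0AtMost
      by (rule sum.mono_neutral_right) (use m startsby_zero_power_prefix[OF G] in auto)
  qed
  finally show "fev (F oo G) a $ i = fev F (fev G a) $ i" by simp
qed

lemma fev_commute:
  assumes "a $ 0 = 0" "a * b = b * a" shows "fev F a * b = b * fev F a"
proof (rule fps_ext)
  fix i
  have ab: "a ^ n * b = b * a ^ n" for n
    using power_commuting_commutes[OF assms(2)] .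
  have "(fev F a * b) $ i = (\<Sum>j\<le>i. (\<Sum>n\<le>i. \<kappa> (F $ n) * (a ^ n) $ j) * b $ (i - j))"
    unfolding fps_mult_nth_atMost by (intro sum.cong refl arg_cong2[where f = "(*)"] fev_nth assms(1)) auto
  also have "\<dots> = (\<Sum>n\<le>i. \<kappa> (F $ n) * (a ^ n * b) $ i)"
    by (simp add: fps_mult_nth_atMost sum_distrib_left sum_distrib_right mult.assoc) (rule sum.swap)
  also have "\<dots> = (\<Sum>n\<le>i. \<kappa> (F $ n) * (\<Sum>j\<le>i. b $ j * (a ^ n) $ (i - j)))"
    by (simp add: ab fps_mult_nth_atMost)
  also have "\<dots> = (\<Sum>j\<le>i. b $ j * (\<Sum>n\<le>i. \<kappa> (F $ n) * (a ^ n) $ (i - j)))"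
  proof -
    have "(\<Sum>n\<le>i. \<kappa> (F $ n) * (\<Sum>j\<le>i. b $ j * (a ^ n) $ (i - j))) =
       (\<Sum>n\<le>i. \<Sum>j\<le>i. b $ j * (\<kappa> (F $ n) * (a ^ n) $ (i - j)))"
      unfolding sum_distrib_left by (intro sum.cong refl \<kappa>_left_commute[symmetric])
    then show ?thesis unfolding sum_distrib_left by (subst sum.swap) simp
  qed
  also have "\<dots> = (b * fev F a) $ i"
    unfolding fps_mult_nth_atMost
    by (intro sum.cong refl arg_cong2[where f = "(*)"] fev_nth[symmetric] assms(1)) auto
  finally show "(fev F a * b) $ i = (b * fev F a) $ i" .
qed

definition ex :: "'r fps \<Rightarrow> 'r fps" where "ex = fev (fps_exp 1)"
definition lg :: "'r fps \<Rightarrow> 'r fps" where "lg u = fev (fps_ln 1) (u - 1)"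

lemma ex_nth_0 [simp]: "ex a $ 0 = 1" by (simp add: ex_def)
lemma lg_nth_0 [simp]: "lg a $ 0 = 0" by (simp add: lg_def)

lemma ln_exp_compose: "fps_ln 1 oo (fps_exp 1 - 1) = (fps_X :: rat fps)"
  "(fps_exp 1 - 1) oo fps_ln 1 = (fps_X :: rat fps)"
  using fps_inv_fps_exp_compose[of "1::rat"] by (simp_all add: fps_ln_fps_exp_inv)

lemma lg_ex: assumes "a $ 0 = 0" shows "lg (ex a) = a"
proof -
  have "ex a - 1 = fev (fps_exp 1 - 1) a" by (simp add: ex_def fev_diff)
  then have "lg (ex a) = fev (fps_ln 1 oo (fps_exp 1 - 1)) a"
    by (simp add: lg_def fev_compose assms)
  then show ?thesis unfolding ln_exp_compose by (simp add: fev_X assms)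
qed

lemma ex_lg: assumes "u $ 0 = 1" shows "ex (lg u) = u"
proof -
  have 0: "(u - 1) $ 0 = 0" using assms by simp
  have "ex (lg u) - 1 = fev (fps_exp 1 - 1) (lg u)" by (simp add: ex_def fev_diff)
  also have "\<dots> = fev ((fps_exp 1 - 1) oo fps_ln 1) (u - 1)"
    unfolding lg_def by (rule fev_compose[symmetric, OF 0]) simp
  also have "\<dots> = u - 1" unfolding ln_exp_compose by (rule fev_X[OF 0])
  finally show ?thesis by simp
qed

lemma ex_inj: "a $ 0 = 0 \<Longrightarrow> b $ 0 = 0 \<Longrightarrow> ex a = ex b \<Longrightarrow> a = b"
  by (metis lg_ex)

lemma ex_0 [simp]: "ex 0 = 1"
proof (rule fps_ext)
  fix i
  have "ex 0 $ i = (\<Sum>n\<le>i. if n = 0 then 1 $ i else 0)"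
    unfolding ex_def fev_def fps_nth_Abs_fps by (rule sum.cong) (auto simp: power_0_left)
  then show "ex 0 $ i = 1 $ i" by simp
qed

lemma ex_minus: assumes "a $ 0 = 0" shows "ex a * ex (- a) = 1"
proof -
  have "ex (- a) = fev (fps_exp (- 1)) a"
  proof (rule fps_ext)
    fix i
    have "(- a) ^ n = fps_const (\<kappa> ((- 1) ^ n)) * a ^ n" for n
      by (cases "even n") (auto simp flip: fps_const_neg)
    then have "((- a) ^ n) $ i = \<kappa> ((- 1) ^ n) * (a ^ n) $ i" for n by simp
    then show "ex (- a) $ i = fev (fps_exp (- 1)) a $ i"
      unfolding ex_def fev_def fps_nth_Abs_fps
      by (intro sum.cong refl) (simp add: mult.assoc[symmetric] flip: \<kappa>_mult)
  qed
  then have "ex a * ex (- a) = fev (fps_exp 1 * fps_exp (- 1)) a"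
    by (simp add: ex_def fev_mult assms)
  also have "fps_exp 1 * fps_exp (- 1) = (1 :: rat fps)"
    by (simp flip: fps_exp_add_mult)
  finally show ?thesis by simp
qed

lemma ex_commute: "a $ 0 = 0 \<Longrightarrow> b $ 0 = 0 \<Longrightarrow> a * b = b * a \<Longrightarrow> ex a * ex b = ex b * ex a"
  unfolding ex_def by (metis fev_commute)

end

subsection \<open>The logarithm of a product of two exponentials as a sum over words\<close>

text \<open>The coefficient of a word in the logarithm of \<open>exp x exp y\<close>. In Dynkin's Lie series it is
  divided by the length of the word in addition.\<close>
definition dynkin_coeff :: "(nat \<times> nat) list \<Rightarrow> rat"
  where "dynkin_coeff ps = (- 1) ^ (length ps - 1) / (of_nat (length ps) * (\<Prod>(r, s) \<leftarrow> ps. fact r * fact s))"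

definition word :: "'a \<Rightarrow> 'a \<Rightarrow> (nat \<times> nat) list \<Rightarrow> 'a list"
  where "word a b ps = concat (map (\<lambda>(r, s). replicate r a @ replicate s b) ps)"

definition wsize :: "(nat \<times> nat) list \<Rightarrow> nat"
  where "wsize ps = (\<Sum>(r, s) \<leftarrow> ps. r + s)"

lemma length_word: "length (word a b ps) = wsize ps"
  by (induction ps) (auto simp: word_def wsize_def)

lemma set_word: "set (word a b ps) \<subseteq> {a, b}"
  by (induction ps) (auto simp: word_def)

lemma map_word: "map f (word a b ps) = word (f a) (f b) ps"
  by (induction ps) (auto simp: word_def)

lemma word_simps [simp]: "word a b [] = []"
  "word a b ((r, s) # ps) = replicate r a @ replicate s b @ word a b ps"
  by (simp_all add: word_def)

lemma wsize_simps [simp]: "wsize [] = 0" "wsize ((r, s) # ps) = r + s + wsize ps"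
  by (simp_all add: wsize_def)

lemma length_le_wsize:
  assumes "\<And>r s. (r, s) \<in> set ps \<Longrightarrow> r + s > 0" shows "length ps \<le> wsize ps"
  using assms
proof (induction ps)
  case (Cons p ps)
  obtain r s where p: "p = (r, s)" by fastforce
  have "length ps \<le> wsize ps" by (rule Cons.IH) (use Cons.prems in auto)
  moreover have "r + s > 0" using Cons.prems[of r s] p by simp
  ultimately show ?case unfolding p wsize_simps length_Cons by linarith
qed simp

lemma pair_le_wsize: "(r, s) \<in> set ps \<Longrightarrow> r + s \<le> wsize ps"
  by (induction ps) (auto simp: wsize_def)

lemma dynkin_indices_alt:
  "dynkin_indices N = {ps. (\<forall>(r, s)\<in>set ps. r + s > 0) \<and> wsize ps = N}"
  by (simp add: dynkin_indices_def wsize_def)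

lemma wsize_dynkin: "ps \<in> dynkin_indices N \<Longrightarrow> wsize ps = N"
  by (simp add: dynkin_indices_alt)

lemma finite_dynkin_indices [simp]: "finite (dynkin_indices N)"
proof (rule finite_subset)
  show "dynkin_indices N \<subseteq> {ps. set ps \<subseteq> {..N} \<times> {..N} \<and> length ps \<le> N}"
  proof (clarify, intro conjI subsetI)
    fix ps assume ps: "ps \<in> dynkin_indices N"
    then show "length ps \<le> N" using length_le_wsize[of ps] by (auto simp: dynkin_indices_alt)
    fix x assume "x \<in> set ps"
    then show "x \<in> {..N} \<times> {..N}" using ps pair_le_wsize[of "fst x" "snd x" ps] by (auto simp: dynkin_indices_alt)
  qed
  show "finite {ps. set ps \<subseteq> {..N} \<times> {..N} \<and> length ps \<le> N}"
    by (rule finite_lists_length_le) simp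
qed

lemma sum_lists_Suc:
  assumes "finite A"
  shows "(\<Sum>xs | set xs \<subseteq> A \<and> length xs = Suc n. f xs) =
    (\<Sum>x\<in>A. \<Sum>xs | set xs \<subseteq> A \<and> length xs = n. f (x # xs))"
proof -
  have eq: "{xs. set xs \<subseteq> A \<and> length xs = Suc n} =
      (\<lambda>(x, xs). x # xs) ` (A \<times> {xs. set xs \<subseteq> A \<and> length xs = n})"
    by (auto simp: length_Suc_conv image_iff)
  have "inj_on (\<lambda>(x, xs). x # xs) (A \<times> {xs. set xs \<subseteq> A \<and> length xs = n})"
    by (auto simp: inj_on_def)
  from sum.reindex[OF this] show ?thesis
    unfolding eq by (simp add: sum.cartesian_product case_prod_unfold)
qed

lemma fps_power_nth_cong:
  assumes "\<And>j. j \<le> i \<Longrightarrow> f $ j = g $ j"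
  shows "(f ^ n) $ i = (g ^ n :: 'a::ring_1 fps) $ i"
  using assms
proof (induction n arbitrary: i)
  case (Suc n)
  have "(f * f ^ n) $ i = (g * g ^ n) $ i"
    unfolding fps_mult_nth by (intro sum.cong refl arg_cong2[where f = "(*)"] Suc) (use Suc.prems in auto)
  then show ?case by simp
qed simp

lemma fps_mult_low:
  assumes "\<And>i. i < m \<Longrightarrow> f $ i = 0" "\<And>i. i < n \<Longrightarrow> g $ i = 0" "i < m + n"
  shows "(f * g) $ i = (0 :: 'a::ring_1)"
  unfolding fps_mult_nth
proof (rule sum.neutral, intro ballI)
  fix j assume "j \<in> {0..i}"
  then show "f $ j * g $ (i - j) = 0"
    using assms(1)[of j] assms(2)[of "i - j"] assms(3) by (cases "j < m") auto
qed

lemma prod_word_low: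
  assumes "a $ 0 = 0" "b $ 0 = 0" "i < wsize ps"
  shows "prod_list (word a b ps) $ i = (0 :: 'a::ring_1)"
  using assms(3)
proof (induction ps arbitrary: i)
  case (Cons p ps)
  obtain r s where p: "p = (r, s)" by fastforce
  have "(a ^ r * (b ^ s * prod_list (word a b ps))) $ i = 0"
  proof (rule fps_mult_low[where m = r and n = "s + wsize ps"])
    show "(b ^ s * prod_list (word a b ps)) $ j = 0" if "j < s + wsize ps" for j
      by (rule fps_mult_low[where m = s and n = "wsize ps"])
        (use that Cons.IH startsby_zero_power_prefix[OF assms(2)] in auto)
  qed (use Cons.prems startsby_zero_power_prefix[OF assms(1)] in \<open>auto simp: p\<close>)
  then show ?case by (simp add: p)
qed simp

context rat_scalars
begin

definition sc :: "rat \<Rightarrow> 'r fps" where "sc q = fps_const (\<kappa> q)"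

lemma sc_simps: "sc 1 = 1" "sc (a * b) = sc a * sc b" "sc (a + b) = sc a + sc b" "sc 0 = 0"
  by (simp_all add: sc_def)

lemma sc_left_commute: "x * (sc q * y) = sc q * (x * y)"
proof -
  have "x * sc q = sc q * x"
    by (rule fps_ext) (simp add: sc_def \<kappa>_commute)
  then show ?thesis by (metis mult.assoc)
qed

text \<open>The base of the power on the left stands for \<open>exp a exp b - 1\<close> with only finitely many terms
  retained.\<close>
lemma power_sum_words:
  fixes a b :: "'r fps"
  assumes "finite S"
  shows "(\<Sum>(r, s)\<in>S. sc (1 / (fact r * fact s)) * (a ^ r * b ^ s)) ^ n =
    (\<Sum>ps | set ps \<subseteq> S \<and> length ps = n.
       sc (1 / (\<Prod>(r, s) \<leftarrow> ps. fact r * fact s)) * prod_list (word a b ps))"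
proof (induction n)
  case 0
  have "{ps. set ps \<subseteq> S \<and> length ps = 0} = {[]}" by auto
  then show ?case by (simp add: sc_simps)
next
  case (Suc n)
  have *: "sc (1 / (fact r * fact s)) * (a ^ r * b ^ s) *
      (sc (1 / (\<Prod>(r, s) \<leftarrow> ps. fact r * fact s)) * prod_list (word a b ps)) =
    sc (1 / (\<Prod>(r, s) \<leftarrow> (r, s) # ps. fact r * fact s)) * prod_list (word a b ((r, s) # ps))" for r s ps
  proof -
    have "sc (1 / (\<Prod>(r, s) \<leftarrow> (r, s) # ps. fact r * fact s)) =
        sc (1 / (fact r * fact s)) * sc (1 / (\<Prod>(r, s) \<leftarrow> ps. fact r * fact s))"
      unfolding sc_simps(2)[symmetric] by simp
    then show ?thesis
      by (simp add: mult.assoc sc_left_commute[of "b ^ s"] sc_left_commute[of "a ^ r"])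
  qed
  show ?case
    unfolding power_Suc Suc.IH sum_lists_Suc[OF assms] sum_product
    by (intro sum.cong refl) (auto simp: * simp del: word_simps)
qed

text \<open>Up to degree \<open>d\<close> the series \<open>exp a exp b - 1\<close> agrees with its part \<open>H\<close> of the terms with
  \<open>0 < r + s \<le> d\<close>, which can be inserted into the logarithm and expanded into words.\<close>
lemma lg_exp_exp:
  fixes a b :: "'r fps"
  assumes a: "a $ 0 = 0" and b: "b $ 0 = 0"
  shows "lg (ex a * ex b) $ d =
    (\<Sum>N\<le>d. \<Sum>ps\<in>dynkin_indices N. \<kappa> (dynkin_coeff ps) * prod_list (word a b ps) $ d)"
proof -
  define S where "S = {(r, s). r + s > 0 \<and> r + s \<le> d}"
  have finS: "finite S"
    by (rule finite_subset[of _ "{..d} \<times> {..d}"]) (auto simp: S_def)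
  define H where "H = (\<Sum>(r, s)\<in>S. sc (1 / (fact r * fact s)) * (a ^ r * b ^ s))"
  have ab0: "(a ^ r * b ^ s) $ i = 0" if "i < r + s" for r s i
    by (rule fps_mult_low[OF _ _ that])
      (use startsby_zero_power_prefix[OF a] startsby_zero_power_prefix[OF b] in auto)
  have H: "(ex a * ex b - 1) $ i = H $ i" if i: "i \<le> d" for i
  proof -
    define t where "t = (\<lambda>(r, s). \<kappa> (1 / fact r * (1 / fact s)) * (a ^ r * b ^ s) $ i)"
    have "(ex a * ex b) $ i = (\<Sum>k\<le>i. \<Sum>n\<le>k. t (n, k - n))"
      unfolding ex_def fev_def t_def prod.case
      by (subst fev_mult_gen) (use startsby_zero_power_prefix[OF a] startsby_zero_power_prefix[OF b] in auto)
    also have "\<dots> = (\<Sum>(n, m)\<in>{(n, m). n + m \<le> i}. t (n, m))"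
      by (rule sum.triangle_reindex_eq[symmetric])
    also have "\<dots> = (\<Sum>p\<in>insert (0, 0) S. t p)"
      unfolding case_prod_eta
    proof (rule sum.mono_neutral_left)
      have "t p = 0" if "fst p + snd p > i" for p
        using ab0[of i "fst p" "snd p"] that by (simp add: t_def case_prod_unfold)
      then show "\<forall>p\<in>insert (0, 0) S - {(n, m). n + m \<le> i}. t p = 0"
        by (auto simp del: not_le simp: not_le[symmetric]) (metis fst_conv snd_conv not_le)
    qed (use i finS in \<open>auto simp: S_def\<close>)
    also have "\<dots> = t (0, 0) + (\<Sum>p\<in>S. t p)"
      by (rule sum.insert) (auto simp: finS, auto simp: S_def)
    also have "t (0, 0) = 1 $ i" by (simp add: t_def)
    also have "(\<Sum>p\<in>S. t p) = H $ i"
      unfolding H_def fps_sum_nth by (intro sum.cong refl) (auto simp: t_def sc_def mult.assoc)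
    finally show ?thesis by simp
  qed
  \<comment> \<open>The coefficient of a word as it arises, from the logarithm series and the factorials; for the
    empty word both this and \<open>dynkin_coeff\<close> are zero.\<close>
  define cf :: "(nat \<times> nat) list \<Rightarrow> rat"
    where "cf ps = fps_ln 1 $ length ps * (1 / (\<Prod>(r, s) \<leftarrow> ps. fact r * fact s))" for ps :: "(nat \<times> nat) list"
  have cf: "cf ps = dynkin_coeff ps" for ps
    by (cases ps) (auto simp: cf_def dynkin_coeff_def fps_ln_nth)
  have "lg (ex a * ex b) $ d = (\<Sum>n\<le>d. \<kappa> (fps_ln 1 $ n) * ((ex a * ex b - 1) ^ n) $ d)"
    by (simp add: lg_def fev_def)
  also have "\<dots> = (\<Sum>n\<le>d. \<kappa> (fps_ln 1 $ n) * (H ^ n) $ d)"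
    by (intro sum.cong refl arg_cong2[where f = "(*)"] fps_power_nth_cong H)
  also have "\<dots> = (\<Sum>n\<le>d. \<Sum>ps | set ps \<subseteq> S \<and> length ps = n. \<kappa> (cf ps) * prod_list (word a b ps) $ d)"
  proof (intro sum.cong refl)
    fix n
    show "\<kappa> (fps_ln 1 $ n) * (H ^ n) $ d =
       (\<Sum>ps | set ps \<subseteq> S \<and> length ps = n. \<kappa> (cf ps) * prod_list (word a b ps) $ d)"
      unfolding H_def power_sum_words[OF finS] fps_sum_nth sum_distrib_left
      by (intro sum.cong refl) (auto simp: sc_def cf_def mult.assoc \<kappa>_mult simp del: times_divide_eq_right)
  qed
  also have "\<dots> = (\<Sum>ps | set ps \<subseteq> S \<and> length ps \<le> d. \<kappa> (cf ps) * prod_list (word a b ps) $ d)"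
    by (subst sum.UNION_disjoint[symmetric]) (auto simp: finite_lists_length_eq finS intro!: sum.cong)
  also have "\<dots> = (\<Sum>ps | set ps \<subseteq> S \<and> length ps \<le> d \<and> wsize ps \<le> d. \<kappa> (cf ps) * prod_list (word a b ps) $ d)"
  proof (rule sum.mono_neutral_right)
    show "\<forall>ps\<in>{ps. set ps \<subseteq> S \<and> length ps \<le> d} - {ps. set ps \<subseteq> S \<and> length ps \<le> d \<and> wsize ps \<le> d}.
        \<kappa> (cf ps) * prod_list (word a b ps) $ d = 0"
      using prod_word_low[OF a b, of d] by (metis (no_types, lifting) DiffE mem_Collect_eq mult_zero_right not_le)
  qed (auto simp: finite_lists_length_le finS)
  also have "{ps. set ps \<subseteq> S \<and> length ps \<le> d \<and> wsize ps \<le> d} = (\<Union>N\<le>d. dynkin_indices N)"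
  proof (intro set_eqI iffI)
    fix ps assume "ps \<in> {ps. set ps \<subseteq> S \<and> length ps \<le> d \<and> wsize ps \<le> d}"
    then show "ps \<in> (\<Union>N\<le>d. dynkin_indices N)" by (auto simp: dynkin_indices_alt S_def)
  next
    fix ps assume "ps \<in> (\<Union>N\<le>d. dynkin_indices N)"
    then have *: "wsize ps \<le> d" "\<And>r s. (r, s) \<in> set ps \<Longrightarrow> r + s > 0"
      by (auto simp: dynkin_indices_alt)
    then show "ps \<in> {ps. set ps \<subseteq> S \<and> length ps \<le> d \<and> wsize ps \<le> d}"
      using length_le_wsize[of ps] pair_le_wsize[of _ _ ps] by (force simp: S_def)
  qed
  also have "(\<Sum>ps\<in>(\<Union>N\<le>d. dynkin_indices N). \<kappa> (cf ps) * prod_list (word a b ps) $ d) =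
      (\<Sum>N\<le>d. \<Sum>ps\<in>dynkin_indices N. \<kappa> (cf ps) * prod_list (word a b ps) $ d)"
    by (rule sum.UNION_disjoint) (auto dest: wsize_dynkin)
  finally show ?thesis by (simp add: cf)
qed

end

subsection \<open>Dynkin's formula in an associative algebra\<close>

definition eulerD :: "'r::ring_1 fps \<Rightarrow> 'r fps"
  where "eulerD f = Abs_fps (\<lambda>n. of_nat n * f $ n)"

lemma eulerD_mult: "eulerD (f * g) = eulerD f * g + f * eulerD g"
proof (rule fps_ext)
  fix n
  have "of_nat n * (f $ i * g $ (n - i)) =
      of_nat i * f $ i * g $ (n - i) + f $ i * (of_nat (n - i) * g $ (n - i))" if "i \<le> n" for i
  proof -
    have "(of_nat n :: 'a) = of_nat i + of_nat (n - i)" using that by (simp flip: of_nat_add)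
    then show ?thesis by (simp add: distrib_right mult.assoc) (metis mult.assoc mult_of_nat_commute)
  qed
  then show "eulerD (f * g) $ n = (eulerD f * g + f * eulerD g) $ n"
    by (simp add: eulerD_def fps_mult_nth sum_distrib_left flip: sum.distrib)
qed

lemma eulerD_simps [simp]: "eulerD 0 = 0" "eulerD 1 = 0"
  by (auto intro!: fps_ext simp: eulerD_def)

fun nestc :: "'r::ring_1 list \<Rightarrow> 'r"
  where "nestc [] = 0" | "nestc [a] = a" | "nestc (a # b # l) = a * nestc (b # l) - nestc (b # l) * a"

context rat_scalars
begin

definition \<kappa>2 :: "rat \<Rightarrow> ('r, rat) aend"
  where "\<kappa>2 q = Aend (\<lambda>(z, c). (\<kappa> q * z, q * c))"

lemma app_\<kappa>2: "app (\<kappa>2 q) (z, c) = (\<kappa> q * z, q * c)"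
  unfolding \<kappa>2_def by (subst app_Aend) (auto simp: distrib_left)

lemma rat_scalars_\<kappa>2: "rat_scalars \<kappa>2"
  by unfold_locales (auto intro!: aend_eqI simp: app_\<kappa>2 distrib_right mult.assoc)

text \<open>The commutator with \<open>t\<^sup>n p\<close> on pairs \<open>(z, c)\<close>, which stand for \<open>z + c D\<close> with \<open>D\<close> the Euler
  derivation, so that \<open>[t\<^sup>n p, D] = - n t\<^sup>n p\<close>.\<close>
definition adhat :: "nat \<Rightarrow> 'r \<Rightarrow> ('r, rat) aend"
  where "adhat n p = Aend (\<lambda>(z, c). (p * z - z * p - \<kappa> (of_nat n * c) * p, 0))"

lemma app_adhat: "app (adhat n p) (z, c) = (p * z - z * p - \<kappa> (of_nat n * c) * p, 0)"
  unfolding adhat_def by (subst app_Aend) (auto simp: algebra_simps)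

definition Adhat :: "'r fps \<Rightarrow> ('r, rat) aend fps"
  where "Adhat P = Abs_fps (\<lambda>n. adhat n (P $ n))"

text \<open>Power series whose coefficients are endomorphisms act on sequences of pairs by convolution,
  and \<open>emb Z c\<close> is the sequence that stands for \<open>Z + c D\<close>.\<close>
definition act :: "('r, rat) aend fps \<Rightarrow> (nat \<Rightarrow> 'r \<times> rat) \<Rightarrow> nat \<Rightarrow> 'r \<times> rat"
  where "act U T = (\<lambda>n. \<Sum>j\<le>n. app (U $ j) (T (n - j)))"

definition emb :: "'r fps \<Rightarrow> rat \<Rightarrow> nat \<Rightarrow> 'r \<times> rat"
  where "emb Z c = (\<lambda>n. (Z $ n, if n = 0 then c else 0))"

lemma act_mult: "act (U * V) T = act U (act V T)"
proof
  fix n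
  have "act U (act V T) n = (\<Sum>j\<le>n. \<Sum>i\<le>n - j. app (U $ j) (app (V $ i) (T (n - (j + i)))))"
    by (simp add: act_def app_sum_right)
  also have "\<dots> = (\<Sum>(j, i)\<in>(SIGMA j:{..n}. {..n - j}). app (U $ j) (app (V $ i) (T (n - (j + i)))))"
    by (rule sum.Sigma) auto
  also have "(SIGMA j:{..n}. {..n - j}) = {(j, i). j + i \<le> n}" by auto
  also have "(\<Sum>(j, i)\<in>{(j, i). j + i \<le> n}. app (U $ j) (app (V $ i) (T (n - (j + i))))) =
     (\<Sum>k\<le>n. \<Sum>j\<le>k. app (U $ j) (app (V $ (k - j)) (T (n - k))))"
    by (subst sum.triangle_reindex_eq) (auto intro!: sum.cong)
  also have "\<dots> = act (U * V) T n"
    by (simp add: act_def fps_mult_nth app_sum atLeast0AtMost)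
  finally show "act (U * V) T n = act U (act V T) n" by simp
qed

lemma act_Adhat: "act (Adhat P) (emb Z c) = emb (P * Z - Z * P - sc c * eulerD P) 0"
proof
  fix n
  have fst: "fst (act (Adhat P) (emb Z c) n) = (\<Sum>j\<le>n. P $ j * Z $ (n - j) - Z $ (n - j) * P $ j -
      (if j = n then \<kappa> (of_nat n * c) * P $ n else 0))"
    unfolding act_def emb_def Adhat_def by (auto simp: fst_sum' app_adhat intro!: sum.cong)
  have "(\<Sum>j\<le>n. Z $ (n - j) * P $ j) = (Z * P) $ n"
    unfolding fps_mult_nth atLeast0AtMost
    by (rule sum.reindex_bij_witness[of _ "\<lambda>j. n - j" "\<lambda>j. n - j"]) auto
  moreover have scD: "\<kappa> (of_nat n * c) * P $ n = (sc c * eulerD P) $ n"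
    by (subst mult.commute) (simp add: sc_def eulerD_def mult.assoc)
  ultimately have "fst (act (Adhat P) (emb Z c) n) = (P * Z - Z * P - sc c * eulerD P) $ n"
    unfolding fst sum_subtractf
    using scD by (simp add: fps_mult_nth atLeast0AtMost)
  moreover have "snd (act (Adhat P) (emb Z c) n) = 0"
    unfolding act_def emb_def Adhat_def snd_sum' by (simp add: app_adhat)
  ultimately show "act (Adhat P) (emb Z c) n = emb (P * Z - Z * P - sc c * eulerD P) 0 n"
    by (simp add: emb_def prod_eq_iff)
qed

text \<open>\<open>U\<close> maps \<open>T = Z + c D\<close> to \<open>g T g\<^sup>-\<^sup>1 = Z' + c D\<close>; multiplied by \<open>g\<close> from the right and with
  \<open>D g = g D + eulerD g\<close> this becomes the equation for \<open>Z'\<close>.\<close>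
definition conj_by :: "('r, rat) aend fps \<Rightarrow> 'r fps \<Rightarrow> bool"
  where "conj_by U g \<longleftrightarrow> (\<forall>Z c. \<exists>Z'. act U (emb Z c) = emb Z' c \<and> Z' * g = g * Z - sc c * eulerD g)"

lemma conj_by_mult:
  assumes "conj_by U g" "conj_by V h" shows "conj_by (U * V) (g * h)"
  unfolding conj_by_def
proof (intro allI)
  fix Z c
  obtain Z1 where 1: "act V (emb Z c) = emb Z1 c" "Z1 * h = h * Z - sc c * eulerD h"
    using assms(2) unfolding conj_by_def by blast
  obtain Z2 where 2: "act U (emb Z1 c) = emb Z2 c" "Z2 * g = g * Z1 - sc c * eulerD g"
    using assms(1) unfolding conj_by_def by blast
  have "Z2 * (g * h) = g * (Z1 * h) - sc c * eulerD g * h"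
    unfolding mult.assoc[symmetric] 2(2) by (simp add: algebra_simps)
  also have "\<dots> = g * h * Z - (g * (sc c * eulerD h) + sc c * eulerD g * h)"
    unfolding 1(2) by (simp add: algebra_simps)
  also have "g * (sc c * eulerD h) + sc c * eulerD g * h = sc c * eulerD (g * h)"
    by (simp add: eulerD_mult sc_left_commute distrib_left mult.assoc add.commute)
  finally show "\<exists>Z'. act (U * V) (emb Z c) = emb Z' c \<and> Z' * (g * h) = g * h * Z - sc c * eulerD (g * h)"
    using 1(1) 2(1) by (auto simp: act_mult)
qed

lemma conj_by_unique:
  assumes "conj_by U g" "conj_by V g" "g * h = 1" shows "U = V"
proof (rule fps_ext, rule aend_eqI)
  fix n and x :: "'r \<times> rat"
  obtain z c where x: "x = (z, c)" by fastforce
  obtain Z1 where 1: "act U (emb (fps_const z) c) = emb Z1 c" "Z1 * g = g * fps_const z - sc c * eulerD g"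
    using assms(1) unfolding conj_by_def by blast
  obtain Z2 where 2: "act V (emb (fps_const z) c) = emb Z2 c" "Z2 * g = g * fps_const z - sc c * eulerD g"
    using assms(2) unfolding conj_by_def by blast
  have "Z1 = Z2" using 1(2) 2(2) assms(3) by (metis mult.assoc mult.right_neutral)
  have *: "act W (emb (fps_const z) c) n = app (W $ n) (z, c)" for W
  proof -
    have "act W (emb (fps_const z) c) n = (\<Sum>j\<le>n. if j = n then app (W $ n) (z, c) else 0)"
      unfolding act_def emb_def
      by (intro sum.cong refl) (auto simp: fps_const_def zero_prod_def[symmetric])
    then show ?thesis by simp
  qed
  show "app (U $ n) x = app (V $ n) x"
    using 1(1) 2(1) \<open>Z1 = Z2\<close> *[of U] *[of V] by (simp add: x)
qed

lemma Adhat_nth_0: "P $ 0 = 0 \<Longrightarrow> Adhat P $ 0 = 0"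
  by (auto intro!: aend_eqI simp: Adhat_def app_adhat zero_prod_def)

lemma fev_mult_right_nth:
  assumes "a $ 0 = 0" shows "(fev F a * b) $ i = (\<Sum>n\<le>i. \<kappa> (F $ n) * (a ^ n * b) $ i)"
proof -
  have "(fev F a * b) $ i = (\<Sum>j\<le>i. (\<Sum>n\<le>i. \<kappa> (F $ n) * (a ^ n) $ j) * b $ (i - j))"
    unfolding fps_mult_nth_atMost by (intro sum.cong refl arg_cong2[where f = "(*)"] fev_nth assms) auto
  then show ?thesis
    by (simp add: fps_mult_nth_atMost sum_distrib_left sum_distrib_right mult.assoc) (rule sum.swap)
qed

text \<open>The binomial expansion of \<open>P\<^sup>N T\<close> by iterated commutators \<open>ad\<^sub>P\<^sup>n T\<close>, for \<open>T = Z + c D\<close>; divided by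
  \<open>N!\<close> and summed over \<open>N\<close> it says that \<open>exp (ad P)\<close> is conjugation by \<open>exp P\<close>.\<close>
lemma conj_by_ex:
  assumes P: "P $ 0 = 0"
  shows "conj_by (rat_scalars.ex \<kappa>2 (Adhat P)) (ex P)"
proof -
  interpret R2: rat_scalars \<kappa>2 by (rule rat_scalars_\<kappa>2)
  show ?thesis
    unfolding conj_by_def
  proof (intro allI)
    fix Z c
    define Zs where "Zs = rec_nat Z (\<lambda>n z. P * z - z * P - (if n = 0 then sc c * eulerD P else 0))"
    have Zs_0: "Zs 0 = Z" and Zs_Suc: "Zs (Suc n) = P * Zs n - Zs n * P - (if n = 0 then sc c * eulerD P else 0)" for n
      by (simp_all add: Zs_def)
    have eP: "eulerD P $ 0 = 0" by (simp add: eulerD_def)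
    have Zs_low: "Zs n $ i = 0" if "i < n" for n i
      using that
    proof (induction n arbitrary: i)
      case (Suc n)
      have "(P * Zs n) $ i = 0"
        by (rule fps_mult_low[where m = 1 and n = n]) (use P Suc in auto)
      moreover have "(Zs n * P) $ i = 0"
        by (rule fps_mult_low[where m = n and n = 1]) (use P Suc in auto)
      moreover have "(sc c * eulerD P) $ i = 0" if "n = 0"
        using Suc.prems that eP by (simp add: sc_def)
      ultimately show ?case by (simp add: Zs_Suc)
    qed simp
    have act_pow: "act (Adhat P ^ n) (emb Z c) = emb (Zs n) (if n = 0 then c else 0)" for n
    proof (induction n)
      case 0
      have "act 1 T = T" for T
      proof
        fix n
        have "act 1 T n = (\<Sum>j\<le>n. if j = 0 then T n else 0)"
          unfolding act_def by (intro sum.cong refl) auto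
        then show "act 1 T n = T n" by simp
      qed
      then show ?case by (simp add: Zs_0)
    next
      case (Suc n)
      show ?case unfolding power_Suc act_mult Suc.IH act_Adhat by (simp add: Zs_Suc sc_simps)
    qed
    define Z' where "Z' = Abs_fps (\<lambda>i. \<Sum>n\<le>i. \<kappa> (1 / fact n) * Zs n $ i)"
    note AP0 = Adhat_nth_0[OF P]
    have "act (R2.ex (Adhat P)) (emb Z c) = emb Z' c"
    proof
      fix i
      have "act (R2.ex (Adhat P)) (emb Z c) i =
          (\<Sum>j\<le>i. app (\<Sum>n\<le>i. \<kappa>2 (1 / fact n) * (Adhat P ^ n) $ j) (emb Z c (i - j)))"
        unfolding act_def R2.ex_def
        by (intro sum.cong refl arg_cong2[where f = app]) (subst R2.fev_nth[OF AP0, of _ i], auto)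
      also have "\<dots> = (\<Sum>n\<le>i. app (\<kappa>2 (1 / fact n)) (act (Adhat P ^ n) (emb Z c) i))"
        unfolding act_def app_sum app_sum_right app_simps by (rule sum.swap)
      also have "\<dots> = (\<Sum>n\<le>i. (\<kappa> (1 / fact n) * Zs n $ i, if n = 0 then if i = 0 then c else 0 else 0))"
        unfolding act_pow by (intro sum.cong refl) (auto simp: emb_def app_\<kappa>2)
      also have "\<dots> = emb Z' c i"
        by (simp add: prod_eq_iff fst_sum' snd_sum' emb_def Z'_def)
      finally show "act (R2.ex (Adhat P)) (emb Z c) i = emb Z' c i" .
    qed
    moreover have "Z' * ex P = ex P * Z - sc c * eulerD (ex P)"
    proof -
      \<comment> \<open>The part without \<open>D\<close> in the expansion of \<open>P\<^sup>N T\<close>, up to the term \<open>c eulerD (P\<^sup>N)\<close> that arises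
        from \<open>D P\<^sup>N = P\<^sup>N D + eulerD (P\<^sup>N)\<close>.\<close>
      define A where "A N = (\<Sum>n\<le>N. of_nat (N choose n) * (Zs n * P ^ (N - n)))" for N
      have A_Suc: "A (Suc N) = P * A N - sc c * eulerD P * P ^ N" for N
      proof -
        have pascal: "(\<Sum>n\<le>Suc N. of_nat (Suc N choose n) * f n) =
          (\<Sum>n\<le>N. of_nat (N choose n) * f n) + (\<Sum>n\<le>N. of_nat (N choose n) * f (Suc n))"
          for f :: "nat \<Rightarrow> 'r fps"
        proof -
          have "(\<Sum>n\<le>N. of_nat (N choose n) * f n) = (\<Sum>n\<le>Suc N. of_nat (N choose n) * f n)"
            by (simp add: binomial_eq_0)
          also have "\<dots> = f 0 + (\<Sum>n\<le>N. of_nat (N choose Suc n) * f (Suc n))"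
            by (simp add: sum.atMost_Suc_shift del: sum.atMost_Suc)
          finally show ?thesis
            by (simp add: sum.atMost_Suc_shift distrib_right sum.distrib add_ac del: sum.atMost_Suc)
        qed
        have "(\<Sum>n\<le>N. of_nat (N choose n) * (Zs (Suc n) * P ^ (Suc N - Suc n))) =
            (\<Sum>n\<le>N. P * (of_nat (N choose n) * (Zs n * P ^ (N - n))) - of_nat (N choose n) * (Zs n * P ^ (Suc N - n))
              - (if n = 0 then sc c * eulerD P * P ^ N else 0))"
        proof (intro sum.cong refl)
          fix n assume n: "n \<in> {..N}"
          have "P ^ (Suc N - n) = P * P ^ (N - n)" using n by (simp add: Suc_diff_le)
          then show "of_nat (N choose n) * (Zs (Suc n) * P ^ (Suc N - Suc n)) =
              P * (of_nat (N choose n) * (Zs n * P ^ (N - n))) - of_nat (N choose n) * (Zs n * P ^ (Suc N - n))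
              - (if n = 0 then sc c * eulerD P * P ^ N else 0)"
            by (simp add: Zs_Suc left_diff_distrib right_diff_distrib mult.assoc)
              (metis mult.assoc mult_of_nat_commute)
        qed
        also have "\<dots> = P * A N - (\<Sum>n\<le>N. of_nat (N choose n) * (Zs n * P ^ (Suc N - n))) - sc c * eulerD P * P ^ N"
          by (simp add: A_def sum_subtractf sum_distrib_left)
        finally show ?thesis unfolding A_def[of "Suc N"] pascal by simp
      qed
      have A: "A N = P ^ N * Z - sc c * eulerD (P ^ N)" for N
      proof (induction N)
        case 0
        then show ?case by (simp add: A_def Zs_0)
      next
        case (Suc N)
        show ?case
          unfolding A_Suc Suc.IH
          by (simp add: eulerD_mult right_diff_distrib distrib_left mult.assoc sc_left_commute[of P])
      qed
      show ?thesis
      proof (rule fps_ext)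
        fix i
        have "(Z' * ex P) $ i = (\<Sum>s\<le>i. \<Sum>n\<le>s. \<kappa> (1 / fact n * (1 / fact (s - n))) * (Zs n * P ^ (s - n)) $ i)"
          unfolding Z'_def ex_def fev_def
          by (subst fev_mult_gen[symmetric]) (use Zs_low startsby_zero_power_prefix[OF P] in auto)
        also have "\<dots> = (\<Sum>s\<le>i. \<kappa> (1 / fact s) * A s $ i)"
        proof (intro sum.cong refl)
          fix s
          have of_nat_nth: "(of_nat m * f) $ i = \<kappa> (of_nat m) * f $ i" for m and f :: "'r fps"
            by (simp add: fps_of_nat[symmetric])
          have "\<kappa> (1 / fact n * (1 / fact (s - n))) = \<kappa> (1 / fact s) * \<kappa> (of_nat (s choose n))" if "n \<le> s" for n
            unfolding \<kappa>_mult[symmetric] by (simp add: binomial_fact that field_simps)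
          then show "(\<Sum>n\<le>s. \<kappa> (1 / fact n * (1 / fact (s - n))) * (Zs n * P ^ (s - n)) $ i) = \<kappa> (1 / fact s) * A s $ i"
            unfolding A_def fps_sum_nth sum_distrib_left
            by (intro sum.cong refl) (simp add: of_nat_nth mult.assoc del: \<kappa>_mult)
        qed
        also have "\<dots> = (\<Sum>s\<le>i. \<kappa> (1 / fact s) * (P ^ s * Z) $ i) - (\<Sum>s\<le>i. \<kappa> (1 / fact s) * (sc c * eulerD (P ^ s)) $ i)"
          unfolding A by (simp add: right_diff_distrib sum_subtractf)
        also have "(\<Sum>s\<le>i. \<kappa> (1 / fact s) * (P ^ s * Z) $ i) = (ex P * Z) $ i"
          unfolding ex_def fev_mult_right_nth[OF P] by simp
        also have "(\<Sum>s\<le>i. \<kappa> (1 / fact s) * (sc c * eulerD (P ^ s)) $ i) = (sc c * eulerD (ex P)) $ i"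
        proof -
          have "\<kappa> q * (\<kappa> c * (of_nat i * x)) = \<kappa> c * (of_nat i * (\<kappa> q * x))" for q x
            using \<kappa>_left_commute[of "\<kappa> c" q "of_nat i * x"] \<kappa>_left_commute[of "of_nat i" q x] by simp
          then show ?thesis
            by (simp add: sc_def eulerD_def ex_def fev_def sum_distrib_left)
        qed
        finally show "(Z' * ex P) $ i = (ex P * Z - sc c * eulerD (ex P)) $ i" by simp
      qed
    qed
    ultimately show "\<exists>Z'. act (R2.ex (Adhat P)) (emb Z c) = emb Z' c \<and> Z' * ex P = ex P * Z - sc c * eulerD (ex P)"
      by blast
  qed
qed

lemma prod_list_monomials:
  "prod_list (map (\<lambda>u. fps_const u * fps_X) l) = fps_const (prod_list l) * (fps_X :: 'z::ring_1 fps) ^ length l"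
proof (induction l)
  case (Cons u l)
  have "fps_const u * fps_X * (fps_const (prod_list l) * fps_X ^ length l) =
      fps_const u * (fps_X * fps_const (prod_list l)) * fps_X ^ length l" by (simp add: mult.assoc)
  also have "fps_X * fps_const (prod_list l) = fps_const (prod_list l) * fps_X"
    by (rule fps_mult_fps_X_commute)
  finally show ?case using Cons by (simp add: mult.assoc flip: fps_const_mult)
qed simp

lemma lg_exp_exp_linear:
  fixes x y :: 'r
  shows "lg (ex (fps_const x * fps_X) * ex (fps_const y * fps_X)) $ N =
    (\<Sum>ps\<in>dynkin_indices N. \<kappa> (dynkin_coeff ps) * prod_list (word x y ps))"
proof -
  have w: "prod_list (word (fps_const x * fps_X) (fps_const y * fps_X) ps) $ N =
      (if N = wsize ps then prod_list (word x y ps) else 0)" for ps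
    using prod_list_monomials[of "word x y ps"]
    by (simp add: map_word length_word fps_X_power_nth)
  have "lg (ex (fps_const x * fps_X) * ex (fps_const y * fps_X)) $ N =
    (\<Sum>M\<le>N. \<Sum>ps\<in>dynkin_indices M. \<kappa> (dynkin_coeff ps) * (if N = wsize ps then prod_list (word x y ps) else 0))"
    by (subst lg_exp_exp) (simp_all add: w)
  also have "\<dots> = (\<Sum>M\<le>N. if M = N then \<Sum>ps\<in>dynkin_indices N. \<kappa> (dynkin_coeff ps) * prod_list (word x y ps) else 0)"
    by (intro sum.cong refl) (auto simp: dynkin_indices_alt[of _] intro!: sum.cong sum.neutral)
  finally show ?thesis by simp
qed

text \<open>The element \<open>- D\<close> starts the nested commutator because \<open>[t x, - D] = t x\<close>.\<close>
lemma app_nested: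
  assumes "l \<noteq> []" shows "app (prod_list (map (adhat 1) l)) (0, - 1) = (nestc l, 0)"
  using assms by (induction l rule: nestc.induct) (auto simp: app_adhat)

text \<open>In degree \<open>N\<close> the logarithm of \<open>exp x exp y\<close> is reproduced, up to the factor \<open>N\<close>, when each word is
  replaced by its nested commutator.  With \<open>P\<close> this logarithm, \<open>exp (ad P) = exp (ad x) exp (ad y)\<close>,
  so \<open>ad P\<close> is the same combination of words in \<open>ad x\<close> and \<open>ad y\<close>; this is applied to \<open>- D\<close>, for which
  \<open>[x, - D] = x\<close> and \<open>[P\<^sub>N, - D] = N P\<^sub>N\<close>.\<close>
theorem dynkin_assoc:
  fixes x y :: 'r
  assumes "N > 0"
  shows "of_nat N * (\<Sum>ps\<in>dynkin_indices N. \<kappa> (dynkin_coeff ps) * prod_list (word x y ps)) =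
    (\<Sum>ps\<in>dynkin_indices N. \<kappa> (dynkin_coeff ps) * nestc (word x y ps))"
proof -
  interpret R2: rat_scalars \<kappa>2 by (rule rat_scalars_\<kappa>2)
  define X1 where "X1 = fps_const x * fps_X"
  define Y1 where "Y1 = fps_const y * fps_X"
  define P where "P = lg (ex X1 * ex Y1)"
  have exP: "ex P = ex X1 * ex Y1" unfolding P_def by (rule ex_lg) simp
  have P0: "P $ 0 = 0" by (simp add: P_def)
  have Ad: "Adhat (fps_const u * fps_X) = fps_const (adhat 1 u) * fps_X" for u
  proof (rule fps_ext)
    fix n
    have "adhat n 0 = 0" by (rule aend_eqI) (auto simp: app_adhat zero_prod_def)
    then show "Adhat (fps_const u * fps_X) $ n = (fps_const (adhat 1 u) * fps_X) $ n"
      by (simp add: Adhat_def fps_X_def)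
  qed
  have "R2.ex (Adhat P) = R2.ex (Adhat X1) * R2.ex (Adhat Y1)"
  proof (rule conj_by_unique)
    show "conj_by (R2.ex (Adhat P)) (ex P)" by (rule conj_by_ex[OF P0])
    show "conj_by (R2.ex (Adhat X1) * R2.ex (Adhat Y1)) (ex P)"
      unfolding exP by (intro conj_by_mult conj_by_ex) (simp_all add: X1_def Y1_def)
    show "ex P * ex (- P) = 1" by (rule ex_minus[OF P0])
  qed
  then have "R2.lg (R2.ex (Adhat X1) * R2.ex (Adhat Y1)) = Adhat P"
    using R2.lg_ex[of "Adhat P"] Adhat_nth_0[OF P0] by simp
  then have "Adhat P = R2.lg (R2.ex (fps_const (adhat 1 x) * fps_X) * R2.ex (fps_const (adhat 1 y) * fps_X))"
    by (simp only: X1_def Y1_def Ad)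
  then have "adhat N (P $ N) =
      (\<Sum>ps\<in>dynkin_indices N. \<kappa>2 (dynkin_coeff ps) * prod_list (word (adhat 1 x) (adhat 1 y) ps))"
    using R2.lg_exp_exp_linear[of "adhat 1 x" "adhat 1 y" N]
    by (metis Adhat_def fps_nth_Abs_fps)
  then have "app (adhat N (P $ N)) (0, - 1) =
      (\<Sum>ps\<in>dynkin_indices N. app (\<kappa>2 (dynkin_coeff ps)) (app (prod_list (word (adhat 1 x) (adhat 1 y) ps)) (0, - 1)))"
    by (simp add: app_sum)
  also have "\<dots> = (\<Sum>ps\<in>dynkin_indices N. (\<kappa> (dynkin_coeff ps) * nestc (word x y ps), 0))"
  proof (intro sum.cong refl)
    fix ps assume "ps \<in> dynkin_indices N"
    then have "word x y ps \<noteq> []"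
      using assms length_word[of x y ps] by (auto simp: dynkin_indices_alt)
    then show "app (\<kappa>2 (dynkin_coeff ps)) (app (prod_list (word (adhat 1 x) (adhat 1 y) ps)) (0, - 1)) =
        (\<kappa> (dynkin_coeff ps) * nestc (word x y ps), 0)"
      using app_nested[of "word x y ps"] by (simp add: map_word app_\<kappa>2)
  qed
  finally have "of_nat N * P $ N = (\<Sum>ps\<in>dynkin_indices N. \<kappa> (dynkin_coeff ps) * nestc (word x y ps))"
    by (simp add: app_adhat prod_eq_iff fst_sum')
  then show ?thesis by (simp add: P_def X1_def Y1_def lg_exp_exp_linear)
qed

end

section \<open>The Lie--Poisson bracket and slot substitutions\<close>

text \<open>Insertion with the target sets given by a function of the slot instead of a list, so that slot
  \<open>0\<close> is available for a parameter.\<close>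
definition ssub :: "(nat \<Rightarrow> nat set) \<Rightarrow> ('g, 'k::comm_ring_1) pol \<Rightarrow> ('g, 'k) pol"
  where "ssub S = subst_pol (\<lambda>(b, i). \<Sum>r\<in>S i. Var (b, r))"

lemma ins_pol_eq_ssub: "ins_pol P = ssub (\<lambda>i. P ! (i - 1))"
  by (simp add: ins_pol_def ssub_def)

lemma ssub_simps: "ssub S 0 = 0" "ssub S 1 = 1" "ssub S (p + q) = ssub S p + ssub S q"
  "ssub S (p * q) = ssub S p * ssub S q" "ssub S (- p) = - ssub S p" "ssub S (p - q) = ssub S p - ssub S q"
  "ssub S (sum f A) = (\<Sum>x\<in>A. ssub S (f x))" "ssub S (Const c) = Const c"
  "ssub S (Var (b, i)) = (\<Sum>r\<in>S i. Var (b, r))"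
  by (simp_all add: ssub_def subst_pol_simps)

lemma ssub_cong:
  assumes "vars p \<subseteq> UNIV \<times> I" "\<And>i. i \<in> I \<Longrightarrow> S i = T i"
  shows "ssub S p = ssub T p"
  unfolding ssub_def subst_pol_eq_mev by (rule mev_cong) (use assms in auto)

lemma ssub_ssub:
  assumes "vars p \<subseteq> UNIV \<times> I" "\<And>i. i \<in> I \<Longrightarrow> finite (T i)" "\<And>i j. i \<in> I \<Longrightarrow> j \<in> T i \<Longrightarrow> finite (S j)"
    and "\<And>i j k. i \<in> I \<Longrightarrow> j \<in> T i \<Longrightarrow> k \<in> T i \<Longrightarrow> j \<noteq> k \<Longrightarrow> S j \<inter> S k = {}"
  shows "ssub S (ssub T p) = ssub (\<lambda>i. \<Union>j\<in>T i. S j) p"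
  using assms(1)
proof (induction p rule: mpol_induct_in)
  case (Var x f)
  obtain b i where x: "x = (b, i)" "i \<in> I" using Var by auto
  have "(\<Sum>r\<in>(\<Union>j\<in>T i. S j). Var (b, r)) = (\<Sum>j\<in>T i. \<Sum>r\<in>S j. Var (b, r) :: ('a, 'b) pol)"
    by (rule sum.UNION_disjoint) (use assms x in auto)
  then show ?case using Var by (simp add: ssub_simps x)
qed (auto simp: ssub_simps)

lemma vars_ssub: "vars p \<subseteq> A \<times> I \<Longrightarrow> vars (ssub S p) \<subseteq> A \<times> (\<Union>i\<in>I. S i)"
proof (induction p rule: mpol_induct_in)
  case (Var x f)
  obtain b i where x: "x = (b, i)" "b \<in> A" "i \<in> I" using Var by auto
  have "vars (\<Sum>r\<in>S i. Var (b, r) :: ('a, 'b) pol) \<subseteq> A \<times> (\<Union>i\<in>I. S i)"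
    using vars_sum[of "\<lambda>r. Var (b, r) :: ('a, 'b) pol" "S i"] x by auto
  then show ?case
    using Var vars_mult[of "\<Sum>r\<in>S i. Var (b, r) :: ('a, 'b) pol" "ssub S f"] by (auto simp: ssub_simps x)
next
  case (add f g)
  then show ?case using vars_add[of "ssub S f" "ssub S g"] by (auto simp: ssub_simps)
qed (auto simp: ssub_simps)

context lie_algebra
begin

lemma br_zero [simp]: "br 0 x = 0" "br x 0 = 0"
  using br_add_left[of 0 0 x] br_add_right[of x 0 0] by auto

lemma br_anti: "br x y = - br y x"
proof -
  have "br x y + br y x = 0"
    using br_self[of "x + y"] unfolding br_add_left br_add_right by (simp add: br_self add.commute)
  then show ?thesis by (simp add: eq_neg_iff_add_eq_0)
qed

lemma br_minus: "br (- x) y = - br x y" "br x (- y) = - br x y"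
  using br_add_left[of x "- x" y] br_add_right[of x y "- y"] by (simp_all add: eq_neg_iff_add_eq_0 add.commute)

lemma br_sum_right: "br x (sum f A) = (\<Sum>a\<in>A. br x (f a))"
  by (induction A rule: infinite_finite_induct) (auto simp: br_add_right)

lemma jacobi': "br x (br y z) = br (br x y) z + br y (br x z)"
proof -
  have "br x (br y z) - br y (br x z) - br (br x y) z = 0"
    using jacobi[of x y z] unfolding br_anti[of z x] br_anti[of z "br x y"] br_minus by simp
  then show ?thesis by (simp add: algebra_simps)
qed

end

context based_lie_algebra
begin

lemma lin_superset:
  assumes "finite S" "{b. representation B x b \<noteq> 0} \<subseteq> S"
  shows "lin s x = (\<Sum>b\<in>S. Const (representation B x b) * Var (b, s))"
  unfolding lin_def by (rule sum.mono_neutral_left) (use assms in auto)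

lemma lin_add: "lin s (x + y) = lin s x + lin s y"
proof -
  have rep: "representation B (x + y) b = representation B x b + representation B y b" for b
    using representation_add[OF independent_B, of y x] by (simp add: span_B)
  let ?S = "{b. representation B x b \<noteq> 0} \<union> {b. representation B y b \<noteq> 0} \<union> {b. representation B (x + y) b \<noteq> 0}"
  have "finite ?S" by (simp add: finite_representation)
  then show ?thesis
    using lin_superset[of ?S x s] lin_superset[of ?S y s] lin_superset[of ?S "x + y" s]
    by (simp add: rep distrib_right sum.distrib Un_assoc Un_left_commute Un_upper1 Un_upper2 le_supI2)
qed

lemma lin_scale: "lin s (c *s x) = Const c * lin s x"
proof -
  let ?S = "{b. representation B x b \<noteq> 0} \<union> {b. representation B (c *s x) b \<noteq> 0}"
  have "finite ?S" by (simp add: finite_representation)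
  then show ?thesis
    using lin_superset[of ?S x s] lin_superset[of ?S "c *s x" s]
      representation_scale[OF independent_B, of x c]
    by (auto simp: span_B sum_distrib_left mult.assoc)
qed

lemma lin_0 [simp]: "lin s 0 = 0"
  using lin_add[of s 0 0] by simp

lemma lin_minus: "lin s (- x) = - lin s x"
  using lin_add[of s x "- x"] by (simp add: eq_neg_iff_add_eq_0 add.commute)

lemma lin_sum: "lin s (sum f A) = (\<Sum>a\<in>A. lin s (f a))"
  by (induction A rule: infinite_finite_induct) (auto simp: lin_add)

lemma expand_basis: "x = (\<Sum>b | representation B x b \<noteq> 0. representation B x b *s b)"
  using sum_nonzero_representation_eq[OF independent_B, of x] by (simp add: span_B)

lemma rep_in_B: "representation B x b \<noteq> 0 \<Longrightarrow> b \<in> B"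
  by (rule representation_ne_zero)

lemma vars_lin: "vars (lin s x) \<subseteq> B \<times> {s}"
proof -
  have "vars (Const c * Var (b, s) :: ('g, 'k) pol) \<subseteq> {(b, s)}" for c b
    using vars_mult[of "Const c" "Var (b, s) :: ('g, 'k) pol"] by auto
  then show ?thesis
    unfolding lin_def
    using vars_sum[of "\<lambda>b. Const (representation B x b) * Var (b, s)" "{b. representation B x b \<noteq> 0}"] rep_in_B
    by blast
qed

text \<open>A derivation that agrees with \<open>ad a\<close> on the basis, up to a change of the slot, agrees with it
  on all of \<open>g\<close>.\<close>
lemma der_lin:
  assumes "\<And>b. \<phi> (b, s) = lin t (br a b)" shows "der \<phi> (lin s x) = lin t (br a x)"
proof -
  have "der \<phi> (lin s x) = (\<Sum>b | representation B x b \<noteq> 0. Const (representation B x b) * lin t (br a b))"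
    by (simp add: lin_def der_sum der_Const_mult assms)
  also have "\<dots> = lin t (br a (\<Sum>b | representation B x b \<noteq> 0. representation B x b *s b))"
    by (simp add: br_sum_right br_scale_right lin_sum lin_scale)
  finally show ?thesis by (simp flip: expand_basis)
qed

definition \<Gamma> :: "'g \<times> nat \<Rightarrow> 'g \<times> nat \<Rightarrow> ('g, 'k) pol"
  where "\<Gamma> v w = (if snd v = snd w then lin (snd v) (br (fst v) (fst w)) else 0)"

lemma poisson_pol_eq_der: "poisson_pol p q = der (\<lambda>v. der (\<Gamma> v) q) p"
  unfolding poisson_pol_def der_def \<Gamma>_def sum_distrib_right
  by (intro sum.cong refl) (auto intro!: sum.cong simp: algebra_simps)

lemma ad_act_eq_der: "ad_act x = der (\<lambda>(b, s). lin s (br x b))"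
  by (rule ext) (auto simp: ad_act_def der_def case_prod_unfold)

lemma pp_simps:
  "poisson_pol (p + p') q = poisson_pol p q + poisson_pol p' q"
  "poisson_pol p (q + q') = poisson_pol p q + poisson_pol p q'"
  "poisson_pol (p * p') q = poisson_pol p q * p' + p * poisson_pol p' q"
  "poisson_pol p (q * q') = poisson_pol p q * q' + q * poisson_pol p q'"
  "poisson_pol (Const c) q = 0" "poisson_pol p (Const c) = 0"
  "poisson_pol 0 q = 0" "poisson_pol p 0 = 0"
  "poisson_pol (Var v) (Var w) = \<Gamma> v w"
proof -
  have "der (\<lambda>v. q' * \<phi> v + q * \<psi> v) p = q' * der \<phi> p + q * der \<psi> p" for \<phi> \<psi>
    by (simp add: der_fun_add der_fun_mult)
  then show "poisson_pol p (q * q') = poisson_pol p q * q' + q * poisson_pol p q'"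
    unfolding poisson_pol_eq_der der_mult by (simp add: mult.commute)
  have "der (\<lambda>v. 0) p = 0" by (simp add: der_def)
  then show "poisson_pol p (Const c) = 0" "poisson_pol p 0 = 0"
    by (simp_all add: poisson_pol_eq_der)
qed (simp_all add: poisson_pol_eq_der der_add der_mult der_fun_add)

lemma pp_uminus: "poisson_pol (- p) q = - poisson_pol p q" "poisson_pol p (- q) = - poisson_pol p q"
  using pp_simps(1)[of p "- p" q] pp_simps(2)[of p q "- q"]
  by (simp_all add: pp_simps eq_neg_iff_add_eq_0 add.commute)

lemma pp_diff: "poisson_pol (p - p') q = poisson_pol p q - poisson_pol p' q"
  "poisson_pol p (q - q') = poisson_pol p q - poisson_pol p q'"
  using pp_simps(1)[of p "- p'" q] pp_simps(2)[of p q "- q'"] by (simp_all add: pp_uminus)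

lemma pp_sum: "poisson_pol (sum f A) q = (\<Sum>a\<in>A. poisson_pol (f a) q)"
  "poisson_pol p (sum f A) = (\<Sum>a\<in>A. poisson_pol p (f a))"
  by (induction A rule: infinite_finite_induct; simp add: pp_simps)+

lemma \<Gamma>_anti: "\<Gamma> v w = - \<Gamma> w v"
  using br_anti[of "fst v" "fst w"] by (auto simp: \<Gamma>_def lin_minus)

lemma pp_anti: "poisson_pol p q = - poisson_pol q p"
proof (induction p rule: mpol_induct)
  case (Var x f)
  have "poisson_pol (Var x) q = - poisson_pol q (Var x)"
  proof (induction q rule: mpol_induct)
    case (Var y g)
    then show ?case by (simp add: pp_simps algebra_simps \<Gamma>_anti[of x y])
  qed (auto simp: pp_simps)
  with Var show ?case by (simp add: pp_simps algebra_simps)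
qed (auto simp: pp_simps)

lemma pp_Var_lin: "poisson_pol (Var (a, s)) (lin t y) = (if s = t then lin s (br a y) else 0)"
proof (cases "s = t")
  case True
  then show ?thesis unfolding poisson_pol_eq_der der_Var by (subst der_lin[of _ t s a]) (auto simp: \<Gamma>_def)
next
  case False
  have "der (\<Gamma> (a, s)) (lin t y) = der (\<lambda>_. 0) (lin t y)"
    by (rule der_cong) (use vars_lin[of t y] False in \<open>auto simp: \<Gamma>_def\<close>)
  then show ?thesis using False by (simp add: poisson_pol_eq_der der_def)
qed

lemma pp_lin_Var: "poisson_pol (lin t y) (Var (a, s)) = (if s = t then lin s (br y a) else 0)"
  using pp_anti[of "lin t y"] br_anti[of y a] by (simp add: pp_Var_lin lin_minus)

text \<open>The Jacobi identity: the difference of both sides is a derivation in each argument, so that it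
  only has to be checked on variables.\<close>
lemma pp_jacobi: "poisson_pol p (poisson_pol q r) = poisson_pol (poisson_pol p q) r + poisson_pol q (poisson_pol p r)"
proof (induction p rule: mpol_induct)
  case (Var x f)
  have "poisson_pol (Var x) (poisson_pol q r) =
      poisson_pol (poisson_pol (Var x) q) r + poisson_pol q (poisson_pol (Var x) r)"
  proof (induction q rule: mpol_induct)
    case (Var y g)
    have "poisson_pol (Var x) (poisson_pol (Var y) r) =
        poisson_pol (poisson_pol (Var x) (Var y)) r + poisson_pol (Var y) (poisson_pol (Var x) r)"
    proof (induction r rule: mpol_induct)
      case (Var z h)
      obtain a s where x: "x = (a, s)" by fastforce
      obtain b t where y: "y = (b, t)" by fastforce
      obtain c u where z: "z = (c, u)" by fastforce
      have "poisson_pol (Var x) (poisson_pol (Var y) (Var z)) =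
        poisson_pol (poisson_pol (Var x) (Var y)) (Var z) + poisson_pol (Var y) (poisson_pol (Var x) (Var z))"
        using jacobi'[of a b c] by (simp add: pp_simps \<Gamma>_def x y z pp_Var_lin pp_lin_Var flip: lin_add)
      with Var show ?case by (simp add: pp_simps algebra_simps)
    qed (auto simp: pp_simps)
    with Var show ?case by (simp add: pp_simps algebra_simps)
  qed (auto simp: pp_simps)
  with Var show ?case
    using pp_anti[of q "Var x"] pp_anti[of q f] by (simp add: pp_simps algebra_simps)
qed (auto simp: pp_simps)

lemma ad_act_simps:
  "ad_act x (p + q) = ad_act x p + ad_act x q" "ad_act x (p * q) = ad_act x p * q + p * ad_act x q"
  "ad_act x (Const c) = 0" "ad_act x (Var (b, s)) = lin s (br x b)" "ad_act x 0 = 0"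
  "ad_act x (- p) = - ad_act x p" "ad_act x (p - q) = ad_act x p - ad_act x q"
  "ad_act x (sum f A) = (\<Sum>a\<in>A. ad_act x (f a))" "ad_act x (Const c * p) = Const c * ad_act x p"
  by (simp_all add: ad_act_eq_der der_add der_mult der_minus der_diff der_sum)

lemma ad_act_lin: "ad_act x (lin s y) = lin s (br x y)"
  unfolding ad_act_eq_der by (rule der_lin) simp

lemma ad_act_pp: "ad_act x (poisson_pol p q) = poisson_pol (ad_act x p) q + poisson_pol p (ad_act x q)"
proof (induction p rule: mpol_induct)
  case (Var v f)
  have "ad_act x (poisson_pol (Var v) q) = poisson_pol (ad_act x (Var v)) q + poisson_pol (Var v) (ad_act x q)"
  proof (induction q rule: mpol_induct)
    case (Var w g)
    obtain a s where v: "v = (a, s)" by fastforce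
    obtain b t where w: "w = (b, t)" by fastforce
    have "ad_act x (poisson_pol (Var v) (Var w)) =
        poisson_pol (ad_act x (Var v)) (Var w) + poisson_pol (Var v) (ad_act x (Var w))"
      using jacobi'[of x a b]
      by (simp add: pp_simps \<Gamma>_def v w ad_act_simps ad_act_lin pp_Var_lin pp_lin_Var flip: lin_add)
    with Var show ?case by (simp add: pp_simps ad_act_simps algebra_simps)
  qed (auto simp: pp_simps ad_act_simps)
  with Var show ?case by (simp add: pp_simps ad_act_simps algebra_simps)
qed (auto simp: pp_simps ad_act_simps)

lemma ssub_lin: "ssub S (lin i x) = (\<Sum>r\<in>S i. lin r x)"
proof -
  have "ssub S (lin i x) = (\<Sum>b | representation B x b \<noteq> 0. \<Sum>r\<in>S i. Const (representation B x b) * Var (b, r))"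
    by (simp add: lin_def ssub_simps sum_distrib_left)
  also have "\<dots> = (\<Sum>r\<in>S i. lin r x)"
    unfolding lin_def by (rule sum.swap)
  finally show ?thesis .
qed

text \<open>Only variables have to be considered. Those of different slots commute before and after the
  substitution, because the sets are disjoint; and for variables of one slot the cross terms of the
  diagonal vanish.\<close>
lemma ssub_pp:
  assumes S: "\<And>i. i \<in> I \<Longrightarrow> finite (S i)" "\<And>i j. i \<in> I \<Longrightarrow> j \<in> I \<Longrightarrow> i \<noteq> j \<Longrightarrow> S i \<inter> S j = {}"
    and "vars p \<subseteq> UNIV \<times> I" "vars q \<subseteq> UNIV \<times> I"
  shows "ssub S (poisson_pol p q) = poisson_pol (ssub S p) (ssub S q)"
  using assms(3)
proof (induction p rule: mpol_induct_in)
  case (Var v f)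
  have "ssub S (poisson_pol (Var v) q) = poisson_pol (ssub S (Var v)) (ssub S q)"
    using assms(4)
  proof (induction q rule: mpol_induct_in)
    case (Var w g)
    obtain a i where v: "v = (a, i)" "i \<in> I" using \<open>v \<in> UNIV \<times> I\<close> by auto
    obtain b j where w: "w = (b, j)" "j \<in> I" using \<open>w \<in> UNIV \<times> I\<close> by auto
    have "(\<Sum>r\<in>S i. \<Sum>t\<in>S j. \<Gamma> (a, r) (b, t)) = ssub S (\<Gamma> v w)"
    proof (cases "i = j")
      case True
      have "(\<Sum>t\<in>S j. \<Gamma> (a, r) (b, t)) = lin r (br a b)" if "r \<in> S i" for r
      proof -
        have "(\<Sum>t\<in>S j. \<Gamma> (a, r) (b, t)) = (\<Sum>t\<in>S j. if t = r then lin r (br a b) else 0)"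
          by (intro sum.cong refl) (auto simp: \<Gamma>_def)
        then show ?thesis using that True S(1)[OF w(2)] by simp
      qed
      then show ?thesis by (simp add: \<Gamma>_def v w True ssub_lin)
    next
      case False
      then have "\<Gamma> (a, r) (b, t) = 0" if "r \<in> S i" "t \<in> S j" for r t
        using that S(2)[OF v(2) w(2)] by (auto simp: \<Gamma>_def)
      moreover have "\<Gamma> v w = 0" using False by (simp add: \<Gamma>_def v w)
      ultimately show ?thesis by (simp add: ssub_simps)
    qed
    then have "ssub S (poisson_pol (Var v) (Var w)) = poisson_pol (ssub S (Var v)) (ssub S (Var w))"
      using sum.swap[of "\<lambda>r t. \<Gamma> (a, r) (b, t)" "S j" "S i"] by (simp add: pp_simps ssub_simps pp_sum v w)
    with Var show ?case by (simp add: pp_simps ssub_simps algebra_simps)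
  qed (auto simp: pp_simps ssub_simps)
  with Var show ?case by (simp add: pp_simps ssub_simps algebra_simps)
qed (auto simp: pp_simps ssub_simps)

lemma ad_act_ssub: "ad_act x (ssub S p) = ssub S (ad_act x p)"
proof (induction p rule: mpol_induct)
  case (Var v f)
  obtain a i where v: "v = (a, i)" by fastforce
  show ?case using Var by (simp add: v ad_act_simps ssub_simps ssub_lin)
qed (auto simp: ad_act_simps ssub_simps)

text \<open>The Hamiltonian vector field of the diagonal linear function of \<open>b\<close> is the diagonal adjoint action,
  as long as the diagonal runs over all slots in which the function lives.\<close>
lemma diagonal_hamiltonian:
  assumes "finite R" "vars f \<subseteq> UNIV \<times> S" "S \<subseteq> R \<or> S \<inter> R = {}"
  shows "poisson_pol (\<Sum>r\<in>R. Var (b, r)) f = (if S \<subseteq> R then ad_act b f else 0)"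
  using assms(2)
proof (induction f rule: mpol_induct_in)
  case (Var v f)
  obtain a s where v: "v = (a, s)" "s \<in> S" using Var by auto
  have "poisson_pol (\<Sum>r\<in>R. Var (b, r)) (Var v) = (\<Sum>r\<in>R. if r = s then lin s (br b a) else 0)"
    by (auto simp: pp_sum pp_simps \<Gamma>_def v intro!: sum.cong)
  also have "\<dots> = (if S \<subseteq> R then ad_act b (Var v) else 0)"
    using assms(1,3) v by (auto simp: ad_act_simps)
  finally show ?case using Var by (auto simp: pp_simps ad_act_simps)
qed (auto simp: pp_simps ad_act_simps)

text \<open>The image of a variable under \<open>ssub T\<close> is the diagonal linear function over a set \<open>T j\<close>. Its
  bracket with \<open>f\<close> is \<open>0\<close> if \<open>T j\<close> contains no slot of \<open>f\<close>, and is given by the adjoint action on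
  \<open>f\<close>, hence \<open>0\<close> as well, if \<open>T j\<close> contains all of them.\<close>
lemma invariant_commute:
  assumes f: "vars f \<subseteq> UNIV \<times> S" "\<And>x. ad_act x f = 0"
    and g: "vars g \<subseteq> UNIV \<times> J"
    and T: "\<And>j. j \<in> J \<Longrightarrow> finite (T j) \<and> (S \<subseteq> T j \<or> S \<inter> T j = {})"
  shows "poisson_pol f (ssub T g) = 0"
  using g
proof (induction g rule: mpol_induct_in)
  case (Var v g)
  obtain a j where v: "v = (a, j)" "j \<in> J" using Var by auto
  have "poisson_pol (\<Sum>r\<in>T j. Var (a, r)) f = 0"
    using diagonal_hamiltonian[of "T j" f S a] T[OF v(2)] f by simp
  then have "poisson_pol f (ssub T (Var v)) = 0"
    by (subst pp_anti) (simp add: v ssub_simps)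
  then show ?case using Var by (simp add: pp_simps ssub_simps)
qed (auto simp: pp_simps ssub_simps)

end

section \<open>The group of series without terms of degree \<open>0\<close> and \<open>1\<close>\<close>

lemma of_rat_prod_list: "of_rat (\<Prod>x\<leftarrow>xs. f x) = (\<Prod>x\<leftarrow>xs. of_rat (f x) :: 'k::field_char_0)"
  by (induction xs) (auto simp: of_rat_mult)

context based_lie_algebra
begin

text \<open>With the weight of a component taken as its degree minus one, the bracket is additive on
  weights. On series whose weights are all positive the Baker--Campbell--Hausdorff series
  converges.\<close>
definition low :: "('g, 'k) ser \<Rightarrow> bool" where "low f \<longleftrightarrow> f 0 = 0 \<and> f 1 = 0"

lemma poisson_low:
  assumes "\<And>d. d \<le> a \<Longrightarrow> f d = 0" "\<And>d. d \<le> b \<Longrightarrow> g d = 0" "d \<le> a + b"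
  shows "poisson f g d = 0"
  unfolding poisson_def
proof (rule sum.neutral, intro ballI)
  fix i assume "i \<in> {..d + 1}"
  show "poisson_pol (f i) (g (d + 1 - i)) = 0"
  proof (cases "i \<le> a")
    case False
    then show ?thesis using assms(2)[of "d + 1 - i"] assms(3) by (simp add: pp_simps)
  qed (simp add: assms(1) pp_simps)
qed

lemma low_poisson: "low f \<Longrightarrow> low g \<Longrightarrow> low (poisson f g)"
  using poisson_low[of 1 f 1 g] by (auto simp: low_def le_Suc_eq)

lemma low_le_1: "low f \<Longrightarrow> d \<le> 1 \<Longrightarrow> f d = 0"
  by (auto simp: low_def le_Suc_eq)

lemma nested_low:
  assumes "l \<noteq> []" "\<And>f. f \<in> set l \<Longrightarrow> low f" "d \<le> length l"
  shows "nested_poisson l d = 0"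
  using assms
proof (induction l arbitrary: d rule: nested_poisson.induct)
  case (2 f)
  then show ?case using low_le_1[of f d] by simp
next
  case (3 f g fs)
  have "poisson f (nested_poisson (g # fs)) d = 0"
    by (rule poisson_low[where a = 1 and b = "length (g # fs)"])
      (use 3 low_le_1[of f] in auto)
  then show ?case by simp
qed simp

lemma low_nested: "(\<And>f. f \<in> set l \<Longrightarrow> low f) \<Longrightarrow> low (nested_poisson l)"
  by (induction l rule: nested_poisson.induct) (auto simp: low_poisson, simp add: low_def)

lemma poisson_cong:
  assumes low: "low f" "low f'" "low g" "low g'"
    and "\<And>d. d \<le> n \<Longrightarrow> f d = f' d" "\<And>d. d \<le> n \<Longrightarrow> g d = g' d" "d \<le> n + 1"
  shows "poisson f g d = poisson f' g' d"
  unfolding poisson_def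
proof (intro sum.cong refl)
  fix i assume i: "i \<in> {..d + 1}"
  consider "i \<le> 1" | "d + 1 - i \<le> 1" | "i > 1" "d + 1 - i > 1" by linarith
  then show "poisson_pol (f i) (g (d + 1 - i)) = poisson_pol (f' i) (g' (d + 1 - i))"
  proof cases
    case 3
    then have "i \<le> n" "d + 1 - i \<le> n" using assms(7) by auto
    then show ?thesis using assms(5,6) by simp
  next
    case 1
    then show ?thesis using low_le_1[OF low(1)] low_le_1[OF low(2)] by (simp add: pp_simps)
  next
    case 2
    then show ?thesis using low_le_1[OF low(3)] low_le_1[OF low(4)] by (simp add: pp_simps)
  qed
qed

text \<open>In the second part a degree is gained since every factor of a bracket has degree at least \<open>2\<close>
  and therefore only the components of degree less than \<open>d\<close> of the factors enter its component of
  degree \<open>d\<close>.\<close>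
lemma nested_cong:
  assumes "list_all2 (\<lambda>f f'. low f \<and> low f' \<and> (\<forall>d\<le>n. f d = f' d)) l l'"
  shows "(\<forall>d\<le>n. nested_poisson l d = nested_poisson l' d) \<and>
    (length l \<ge> 2 \<longrightarrow> (\<forall>d\<le>n + 1. nested_poisson l d = nested_poisson l' d))"
  using assms
proof (induction l arbitrary: l' rule: nested_poisson.induct)
  case (2 f)
  then show ?case by (auto simp: list_all2_Cons1)
next
  case (3 f g fs)
  from 3(2) obtain f' g' fs' where l': "l' = f' # g' # fs'"
    and f: "low f" "low f'" "\<forall>d\<le>n. f d = f' d"
    and tl: "list_all2 (\<lambda>f f'. low f \<and> low f' \<and> (\<forall>d\<le>n. f d = f' d)) (g # fs) (g' # fs')"
    by (auto simp: list_all2_Cons1)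
  have "low h" if "h \<in> set (g # fs) \<union> set (g' # fs')" for h
    using that tl by (metis (no_types, lifting) Un_iff list_all2_conv_all_nth in_set_conv_nth)
  then have "low (nested_poisson (g # fs))" "low (nested_poisson (g' # fs'))"
    by (auto intro!: low_nested)
  then have "\<forall>d\<le>n + 1. poisson f (nested_poisson (g # fs)) d = poisson f' (nested_poisson (g' # fs')) d"
    using poisson_cong[of f f' "nested_poisson (g # fs)" "nested_poisson (g' # fs')" n] f 3(1)[OF tl]
    by blast
  then show ?case by (simp add: l')
qed simp

lemma bch_term_alt: "bch_term N f g d = (\<Sum>ps\<in>dynkin_indices N.
    Const (of_rat (dynkin_coeff ps / of_nat N)) * nested_poisson (word f g ps) d)"
proof -
  have "(- 1) ^ (length ps - 1) / (of_nat (length ps) * of_nat N * (\<Prod>(r, s) \<leftarrow> ps. fact r * fact s)) =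
      (of_rat (dynkin_coeff ps / of_nat N) :: 'k)" for ps
  proof -
    have fact: "of_rat (fact n) = (fact n :: 'k)" for n
      by (induction n) (auto simp: of_rat_mult of_rat_add)
    have "of_rat (\<Prod>(r, s) \<leftarrow> ps. fact r * fact s) = (\<Prod>(r, s) \<leftarrow> ps. fact r * fact s :: 'k)"
      unfolding of_rat_prod_list by (simp add: case_prod_unfold of_rat_mult fact)
    then show ?thesis
      by (simp add: dynkin_coeff_def of_rat_divide of_rat_mult of_rat_power of_rat_minus mult_ac)
  qed
  then show ?thesis by (simp add: bch_term_def word_def)
qed

lemma set_word_low: "low f \<Longrightarrow> low g \<Longrightarrow> h \<in> set (word f g ps) \<Longrightarrow> low h"
  using set_word[of f g ps] by auto

lemma word_neq_Nil: "ps \<in> dynkin_indices N \<Longrightarrow> N > 0 \<Longrightarrow> word f g ps \<noteq> []"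
  using length_word[of f g ps] wsize_dynkin[of ps N] by auto

lemma bch_term_0: "bch_term 0 f g d = 0"
  by (simp add: bch_term_alt)

lemma bch_term_low:
  assumes "low f" "low g" "d \<le> N" shows "bch_term N f g d = 0"
proof (cases "N = 0")
  case False
  have "nested_poisson (word f g ps) d = 0" if "ps \<in> dynkin_indices N" for ps
    by (rule nested_low)
      (use assms set_word_low[of f g] word_neq_Nil[OF that] length_word[of f g ps] wsize_dynkin[OF that] False in auto)
  then show ?thesis by (simp add: bch_term_alt)
qed (simp add: bch_term_0)

lemma star_nth:
  assumes "low f" "low g" "d \<le> M" shows "(f \<star> g) d = (\<Sum>N\<le>M. bch_term N f g d)"
  unfolding star_def
proof (rule Sum_any.expand_superset)
  show "{N. bch_term N f g d \<noteq> 0} \<subseteq> {..M}"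
    using bch_term_low[OF assms(1,2)] assms(3) by (auto simp: not_le) (meson le_trans nle_le)
qed simp

lemma low_star: "low f \<Longrightarrow> low g \<Longrightarrow> low (f \<star> g)"
  using star_nth[of f g 0 0] star_nth[of f g 1 1] bch_term_low[of f g 0] bch_term_low[of f g 1 1]
  by (auto simp: low_def bch_term_0)

lemma dynkin_indices_1: "dynkin_indices 1 = {[(1, 0)], [(0, 1)]}"
proof (intro set_eqI iffI)
  fix ps :: "(nat \<times> nat) list"
  assume ps: "ps \<in> dynkin_indices 1"
  then have pos: "r + s > 0" if "(r, s) \<in> set ps" for r s using that by (auto simp: dynkin_indices_alt)
  then have "length ps \<le> 1" using length_le_wsize[of ps] wsize_dynkin[OF ps] by auto
  moreover have "ps \<noteq> []" using wsize_dynkin[OF ps] by auto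
  ultimately obtain r s where "ps = [(r, s)]" by (cases ps) auto
  with wsize_dynkin[OF ps] show "ps \<in> {[(1, 0)], [(0, 1)]}" by (cases r) auto
qed (auto simp: dynkin_indices_alt)

lemma bch_term_1: "bch_term 1 f g d = f d + g d"
  by (simp add: bch_term_alt dynkin_indices_1[simplified] dynkin_coeff_def)

text \<open>The bracket raises degrees, so a change of the factors in degree \<open>n + 1\<close> changes the product
  in that degree by the same amount.\<close>
lemma star_cong_next:
  assumes low: "low f" "low f'" "low g" "low g'"
    and "\<And>d. d \<le> n \<Longrightarrow> f d = f' d" "\<And>d. d \<le> n \<Longrightarrow> g d = g' d" "d \<le> n + 1"
  shows "(f \<star> g) d - f d - g d = (f' \<star> g') d - f' d - g' d"
proof -
  have high: "bch_term N f g d = bch_term N f' g' d" if "N \<ge> 2" for N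
    unfolding bch_term_alt
  proof (intro sum.cong refl arg_cong2[where f = "(*)"])
    fix ps assume ps: "ps \<in> dynkin_indices N"
    have "list_all2 (\<lambda>f f'. low f \<and> low f' \<and> (\<forall>d\<le>n. f d = f' d)) (word f g ps) (word f' g' ps)"
      by (induction ps) (auto intro!: list_all2_appendI simp: assms list_all2_conv_all_nth nth_append)
    from nested_cong[OF this] show "nested_poisson (word f g ps) d = nested_poisson (word f' g' ps) d"
      using that assms(7) wsize_dynkin[OF ps] by (simp add: length_word)
  qed
  have split: "(f \<star> g) d = f d + g d + (\<Sum>N\<in>{2..d + 1}. bch_term N f g d)" if "low f" "low g" for f g
  proof -
    have "(f \<star> g) d = (\<Sum>N\<le>d + 1. bch_term N f g d)"
      by (rule star_nth[OF that]) simp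
    also have "\<dots> = (\<Sum>N\<in>{0, 1} \<union> {2..d + 1}. bch_term N f g d)"
      by (rule sum.cong) auto
    also have "\<dots> = (\<Sum>N\<in>{0, 1}. bch_term N f g d) + (\<Sum>N\<in>{2..d + 1}. bch_term N f g d)"
      by (rule sum.union_disjoint) auto
    finally show ?thesis using bch_term_1[of f g d] by (simp add: bch_term_0)
  qed
  show ?thesis using split[of f g] split[of f' g'] low high by simp
qed

lemma star_cong:
  assumes "low f" "low f'" "low g" "low g'"
    and "\<And>d. d \<le> n \<Longrightarrow> f d = f' d" "\<And>d. d \<le> n \<Longrightarrow> g d = g' d" "d \<le> n"
  shows "(f \<star> g) d = (f' \<star> g') d"
proof -
  have "(f \<star> g) d - f d - g d = (f' \<star> g') d - f' d - g' d"
    by (rule star_cong_next[OF assms(1-4), of n]) (use assms in auto)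
  then show ?thesis using assms(5)[OF assms(7)] assms(6)[OF assms(7)] by simp
qed

text \<open>A bracket of two components of degree at least \<open>3\<close> has degree at least \<open>5\<close>.\<close>
lemma star_low_degrees:
  assumes f: "\<And>d. d \<le> 2 \<Longrightarrow> f d = 0" and g: "\<And>d. d \<le> 2 \<Longrightarrow> g d = 0" and d: "d \<le> 4"
  shows "(f \<star> g) d = f d + g d"
proof -
  have low: "low f" "low g" using f g by (auto simp: low_def)
  have nested: "(\<forall>d\<le>2. nested_poisson l d = 0) \<and> (length l \<ge> 2 \<longrightarrow> (\<forall>d\<le>4. nested_poisson l d = 0))"
    if "set l \<subseteq> {f, g}" for l
    using that
  proof (induction l rule: nested_poisson.induct)
    case (3 h h' fs)
    then have "\<forall>d\<le>4. poisson h (nested_poisson (h' # fs)) d = 0"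
      using poisson_low[of 2 h 2 "nested_poisson (h' # fs)"] f g by auto
    then show ?case by auto
  qed (use f g in auto)
  have "bch_term N f g d = 0" if "N \<ge> 2" for N
    unfolding bch_term_alt
  proof (rule sum.neutral, intro ballI)
    fix ps assume ps: "ps \<in> dynkin_indices N"
    have "nested_poisson (word f g ps) d = 0"
      using nested[OF set_word[of f g ps]] d that wsize_dynkin[OF ps] by (simp add: length_word)
    then show "Const (of_rat (dynkin_coeff ps / of_nat N)) * nested_poisson (word f g ps) d = 0" by simp
  qed
  then have "(\<Sum>N\<le>d + 1. bch_term N f g d) = (\<Sum>N\<in>{0, 1}. bch_term N f g d)"
    by (intro sum.mono_neutral_right) auto
  then show ?thesis using star_nth[OF low, of d "d + 1"] bch_term_1[of f g d] by (simp add: bch_term_0)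
qed

subsection \<open>Closure and naturality\<close>

text \<open>The families \<open>A\<close> whose sequences of elements form a Lie subalgebra, the bracket having degree
  \<open>- 1\<close>.\<close>
definition graded_sub :: "(nat \<Rightarrow> ('g, 'k) pol set) \<Rightarrow> bool"
  where "graded_sub A \<longleftrightarrow> (\<forall>n. 0 \<in> A n) \<and> (\<forall>n p q. p \<in> A n \<longrightarrow> q \<in> A n \<longrightarrow> p + q \<in> A n) \<and>
    (\<forall>n c p. p \<in> A n \<longrightarrow> Const c * p \<in> A n) \<and>
    (\<forall>i j p q. p \<in> A i \<longrightarrow> q \<in> A j \<longrightarrow> poisson_pol p q \<in> A (i + j - 1))"

lemma graded_sub_sum:
  assumes "graded_sub A" "\<And>x. x \<in> X \<Longrightarrow> h x \<in> A n" shows "sum h X \<in> A n"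
  using assms(2) by (induction X rule: infinite_finite_induct) (use assms(1) in \<open>auto simp: graded_sub_def\<close>)

lemma graded_sub_poisson:
  assumes "graded_sub A" "\<And>n. f n \<in> A n" "\<And>n. g n \<in> A n" shows "poisson f g n \<in> A n"
  unfolding poisson_def
proof (rule graded_sub_sum[OF assms(1)])
  fix i assume "i \<in> {..n + 1}"
  then show "poisson_pol (f i) (g (n + 1 - i)) \<in> A n"
    using assms unfolding graded_sub_def by (metis add_diff_cancel_right' atMost_iff le_add_diff_inverse)
qed

lemma graded_sub_nested:
  assumes "graded_sub A" "\<And>f n. f \<in> set l \<Longrightarrow> f n \<in> A n" shows "nested_poisson l n \<in> A n"
  using assms(2)
proof (induction l arbitrary: n rule: nested_poisson.induct)
  case (3 f g fs)
  then show ?case using graded_sub_poisson[OF assms(1), of f "nested_poisson (g # fs)"] by simp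
qed (use assms(1) in \<open>auto simp: graded_sub_def\<close>)

lemma graded_sub_star:
  assumes "graded_sub A" "\<And>n. f n \<in> A n" "\<And>n. g n \<in> A n" "low f" "low g"
  shows "(f \<star> g) n \<in> A n"
  unfolding star_nth[OF assms(4,5) order_refl] bch_term_alt
proof (intro graded_sub_sum[OF assms(1)])
  fix N ps
  have "nested_poisson (word f g ps) n \<in> A n"
    by (rule graded_sub_nested[OF assms(1)]) (use assms(2,3) set_word[of f g ps] in auto)
  then show "Const (of_rat (dynkin_coeff ps / of_nat N)) * nested_poisson (word f g ps) n \<in> A n"
    using assms(1) by (auto simp: graded_sub_def)
qed

text \<open>The product \<open>\<star>\<close> is built from brackets and rational coefficients alone.\<close>
lemma star_natural:
  assumes A: "graded_sub A" and f: "\<And>n. f n \<in> A n" "low f" and g: "\<And>n. g n \<in> A n" "low g"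
    and T: "T 0 = 0" "\<And>p q. T (p + q) = T p + T q" "\<And>c p. T (Const c * p) = Const c * T p"
    and Tpp: "\<And>i j p q. p \<in> A i \<Longrightarrow> q \<in> A j \<Longrightarrow> T (poisson_pol p q) = poisson_pol (T p) (T q)"
  shows "(\<lambda>n. T ((f \<star> g) n)) = (\<lambda>n. T (f n)) \<star> (\<lambda>n. T (g n))"
proof
  fix n
  have Tsum: "T (sum h X) = (\<Sum>x\<in>X. T (h x))" for h :: "'z \<Rightarrow> ('g, 'k) pol" and X
    by (induction X rule: infinite_finite_induct) (auto simp: T)
  have nested: "T (nested_poisson l n) = nested_poisson (map (\<lambda>f n. T (f n)) l) n"
    if "\<And>f n. f \<in> set l \<Longrightarrow> f n \<in> A n" for l n
    using that
  proof (induction l arbitrary: n rule: nested_poisson.induct)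
    case (3 f g fs)
    have "T (poisson f (nested_poisson (g # fs)) n) =
        (\<Sum>i\<le>n + 1. T (poisson_pol (f i) (nested_poisson (g # fs) (n + 1 - i))))"
      unfolding poisson_def by (rule Tsum)
    also have "\<dots> = (\<Sum>i\<le>n + 1. poisson_pol (T (f i)) (T (nested_poisson (g # fs) (n + 1 - i))))"
      by (intro sum.cong refl Tpp[OF _ graded_sub_nested[OF A]]) (use 3 in auto)
    finally show ?case using 3 by (simp add: poisson_def)
  qed (auto simp: T)
  have low': "low (\<lambda>n. T (f n))" "low (\<lambda>n. T (g n))" using f g T(1) by (auto simp: low_def)
  have "T (nested_poisson (word f g ps) n) = nested_poisson (word (\<lambda>n. T (f n)) (\<lambda>n. T (g n)) ps) n" for ps
    by (subst nested) (use f g set_word[of f g ps] in \<open>auto simp: map_word\<close>)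
  then show "T ((f \<star> g) n) = ((\<lambda>n. T (f n)) \<star> (\<lambda>n. T (g n))) n"
    unfolding star_nth[OF f(2) g(2) order_refl] star_nth[OF low' order_refl] bch_term_alt
    by (simp add: Tsum T(3))
qed

subsection \<open>Faithful representation\<close>

definition \<kappa>p :: "rat \<Rightarrow> (('g, 'k) pol, 'k) aend"
  where "\<kappa>p q = Aend (\<lambda>(l, c). (Const (of_rat q) * l, of_rat q * c))"

lemma app_\<kappa>p: "app (\<kappa>p q) (l, c) = (Const (of_rat q) * l, of_rat q * c)"
  unfolding \<kappa>p_def by (subst app_Aend) (auto simp: distrib_left)

sublocale P: rat_scalars \<kappa>p
  by unfold_locales (auto intro!: aend_eqI simp: app_\<kappa>p of_rat_add of_rat_mult distrib_right mult.assoc)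

text \<open>The Hamiltonian vector field of \<open>p\<close>, extended to pairs \<open>(l, c)\<close> standing for \<open>l + c E\<close> with \<open>E\<close> the
  derivation that multiplies \<open>p\<close> by its weight \<open>n\<close>; this makes the representation faithful.\<close>
definition hamil :: "nat \<Rightarrow> ('g, 'k) pol \<Rightarrow> (('g, 'k) pol, 'k) aend"
  where "hamil n p = Aend (\<lambda>(l, c). (poisson_pol p l - Const (of_nat n * c) * p, 0))"

lemma app_hamil: "app (hamil n p) (l, c) = (poisson_pol p l - Const (of_nat n * c) * p, 0)"
  unfolding hamil_def by (subst app_Aend) (auto simp: pp_simps algebra_simps)

text \<open>The index is the weight, which is the degree minus one.\<close>
definition hat :: "('g, 'k) ser \<Rightarrow> (('g, 'k) pol, 'k) aend fps"
  where "hat f = Abs_fps (\<lambda>n. hamil n (f (n + 1)))"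

lemma hamil_simps: "hamil n 0 = 0" "hamil n (p + q) = hamil n p + hamil n q"
  "hamil n (- p) = - hamil n p" "hamil n (Const (of_rat r) * p) = \<kappa>p r * hamil n p"
  by (auto intro!: aend_eqI simp: app_hamil app_\<kappa>p pp_simps pp_uminus zero_prod_def algebra_simps)

lemma hamil_sum: "hamil n (sum h X) = (\<Sum>x\<in>X. hamil n (h x))"
  by (induction X rule: infinite_finite_induct) (auto simp: hamil_simps)

lemma hamil_commutator:
  "hamil i p * hamil j q - hamil j q * hamil i p = hamil (i + j) (poisson_pol p q)"
proof (rule aend_eqI)
  fix x :: "('g, 'k) pol \<times> 'k"
  obtain l c where x: "x = (l, c)" by fastforce
  show "app (hamil i p * hamil j q - hamil j q * hamil i p) x = app (hamil (i + j) (poisson_pol p q)) x"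
    using pp_jacobi[of p q l] pp_anti[of q p]
    by (simp add: x app_hamil pp_diff pp_simps algebra_simps)
qed

lemma hat_0 [simp]: "low f \<Longrightarrow> hat f $ 0 = 0"
  by (simp add: hat_def low_def hamil_simps)

lemma hat_poisson:
  assumes "low f" "low g" shows "hat (poisson f g) = hat f * hat g - hat g * hat f"
proof (rule fps_ext)
  fix n
  have "poisson f g (n + 1) = (\<Sum>i\<le>Suc n. poisson_pol (f (Suc i)) (g (Suc n - i)))"
    unfolding poisson_def using assms(1) by (simp add: sum.atMost_Suc_shift low_def pp_simps del: sum.atMost_Suc)
  also have "\<dots> = (\<Sum>i\<le>n. poisson_pol (f (i + 1)) (g (n - i + 1)))"
    using assms(2) by (auto simp: low_def pp_simps Suc_diff_le intro!: sum.cong)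
  finally have "hat (poisson f g) $ n = (\<Sum>i\<le>n. hamil n (poisson_pol (f (i + 1)) (g (n - i + 1))))"
    by (simp add: hat_def hamil_sum)
  also have "\<dots> = (\<Sum>i\<le>n. hat f $ i * hat g $ (n - i) - hat g $ (n - i) * hat f $ i)"
    by (intro sum.cong refl) (simp add: hat_def hamil_commutator)
  also have "\<dots> = (hat f * hat g) $ n - (hat g * hat f) $ n"
  proof -
    have "(\<Sum>i\<le>n. hat g $ (n - i) * hat f $ i) = (\<Sum>i\<le>n. hat g $ i * hat f $ (n - i))"
      by (rule sum.reindex_bij_witness[of _ "\<lambda>j. n - j" "\<lambda>j. n - j"]) auto
    then show ?thesis by (simp add: sum_subtractf fps_mult_nth atLeast0AtMost)
  qed
  finally show "hat (poisson f g) $ n = (hat f * hat g - hat g * hat f) $ n" by simp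
qed

lemma Const_mult_cancel: "Const c * p = 0 \<Longrightarrow> c \<noteq> 0 \<Longrightarrow> p = (0 :: ('v, 'k) mpol)"
proof -
  assume a: "Const c * p = 0" "c \<noteq> 0"
  have "p = Const (1 / c) * (Const c * p)"
    using a(2) by (simp add: mult.assoc[symmetric] flip: Const_simps(4))
  then show "p = 0" using a(1) by simp
qed

text \<open>The pair \<open>(0, 1)\<close> stands for \<open>E\<close>, and \<open>[p, E]\<close> is \<open>p\<close> multiplied by minus its weight, which is
  positive.\<close>
lemma hat_inj:
  assumes "low f" "low g" "hat f = hat g" shows "f = g"
proof
  fix d
  show "f d = g d"
  proof (cases "d \<le> 1")
    case True
    then show ?thesis using low_le_1[OF assms(1)] low_le_1[OF assms(2)] by simp
  next
    case False
    define n where "n = d - 1"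
    then have d: "d = n + 1" and n: "n > 0" using False by auto
    have "app (hat f $ n) (0, 1) = app (hat g $ n) (0, 1)" using assms by simp
    then have "Const (of_nat n) * (f d - g d) = 0"
      by (simp add: hat_def app_hamil pp_simps d algebra_simps)
    then show ?thesis using Const_mult_cancel[of "of_nat n" "f d - g d"] n by simp
  qed
qed

lemma nestc_hat: "(\<And>f. f \<in> set l \<Longrightarrow> low f) \<Longrightarrow> nestc (map hat l) = hat (nested_poisson l)"
proof (induction l rule: nested_poisson.induct)
  case 1
  then show ?case by (auto simp: hat_def hamil_simps intro!: fps_ext)
next
  case (3 f g fs)
  then show ?case
    using hat_poisson[of f "nested_poisson (g # fs)"] low_nested[of "g # fs"] by simp
qed simp

text \<open>Under \<open>hat\<close> the nested Poisson brackets in Dynkin's formula turn into nested commutators,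
  which \<open>dynkin_assoc\<close> replaces by words.\<close>
lemma hat_bch_term:
  assumes low: "low f" "low g"
  shows "hat (bch_term N f g) $ n =
    (\<Sum>ps\<in>dynkin_indices N. \<kappa>p (dynkin_coeff ps) * prod_list (word (hat f) (hat g) ps) $ n)"
proof (cases "N = 0")
  case True
  have "dynkin_coeff ps = 0" if "ps \<in> dynkin_indices 0" for ps
  proof -
    have "ps = []" using that length_le_wsize[of ps] by (auto simp: dynkin_indices_alt)
    then show ?thesis by (simp add: dynkin_coeff_def)
  qed
  then show ?thesis by (simp add: True hat_def bch_term_0 hamil_simps)
next
  case False
  interpret Q: rat_scalars "\<lambda>q. fps_const (\<kappa>p q)"
    by unfold_locales simp_all
  define W where "W = (\<Sum>ps\<in>dynkin_indices N. fps_const (\<kappa>p (dynkin_coeff ps)) * prod_list (word (hat f) (hat g) ps))"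
  have "of_nat N * W = (\<Sum>ps\<in>dynkin_indices N. fps_const (\<kappa>p (dynkin_coeff ps)) * hat (nested_poisson (word f g ps)))"
  proof -
    have "nestc (word (hat f) (hat g) ps) = hat (nested_poisson (word f g ps))" for ps
      using nestc_hat[of "word f g ps"] set_word_low[OF low] by (simp add: map_word)
    then show ?thesis unfolding W_def using Q.dynkin_assoc[of N "hat f" "hat g"] False by simp
  qed
  moreover have "fps_const (\<kappa>p (1 / of_nat N)) * (of_nat N * W) = W"
  proof -
    have "fps_const (\<kappa>p (1 / of_nat N)) * of_nat N = 1"
      using Q.\<kappa>_mult[of "1 / of_nat N" "of_nat N"] False unfolding Q.\<kappa>_of_nat by simp
    then show ?thesis by (simp add: mult.assoc[symmetric])
  qed
  ultimately have "W = (\<Sum>ps\<in>dynkin_indices N. fps_const (\<kappa>p (dynkin_coeff ps / of_nat N)) * hat (nested_poisson (word f g ps)))"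
    by (simp add: sum_distrib_left mult.assoc[symmetric] flip: P.\<kappa>_mult)
  then have "W $ n = hat (bch_term N f g) $ n"
    by (simp add: fps_sum_nth hat_def bch_term_alt hamil_sum hamil_simps)
  then show ?thesis by (simp add: W_def fps_sum_nth)
qed

definition \<Phi> :: "('g, 'k) ser \<Rightarrow> (('g, 'k) pol, 'k) aend fps"
  where "\<Phi> f = P.ex (hat f)"

text \<open>By \<open>hat_bch_term\<close>, \<open>hat (f \<star> g)\<close> is the logarithm of \<open>exp (hat f) exp (hat g)\<close>.\<close>
lemma \<Phi>_star:
  assumes "low f" "low g" shows "\<Phi> (f \<star> g) = \<Phi> f * \<Phi> g"
proof -
  have "hat (f \<star> g) = P.lg (P.ex (hat f) * P.ex (hat g))"
  proof (rule fps_ext)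
    fix n
    have "hat (f \<star> g) $ n = (\<Sum>N\<le>n + 1. hat (bch_term N f g) $ n)"
      using star_nth[OF assms, of "n + 1" "n + 1"] by (simp add: hat_def hamil_sum hamil_simps)
    also have "hat (bch_term (n + 1) f g) $ n = 0"
      using bch_term_low[OF assms, of "n + 1" "n + 1"] by (simp add: hat_def hamil_simps)
    then have "(\<Sum>N\<le>n + 1. hat (bch_term N f g) $ n) = (\<Sum>N\<le>n. hat (bch_term N f g) $ n)"
      by simp
    also have "\<dots> = P.lg (P.ex (hat f) * P.ex (hat g)) $ n"
      by (simp add: P.lg_exp_exp assms hat_bch_term)
    finally show "hat (f \<star> g) $ n = P.lg (P.ex (hat f) * P.ex (hat g)) $ n" .
  qed
  then show ?thesis by (simp add: \<Phi>_def P.ex_lg)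
qed

lemma \<Phi>_inj: "low f \<Longrightarrow> low g \<Longrightarrow> \<Phi> f = \<Phi> g \<Longrightarrow> f = g"
  unfolding \<Phi>_def using P.ex_inj hat_inj hat_0 by blast

lemma low_neg [simp]: "low (neg f) \<longleftrightarrow> low f"
  by (simp add: low_def neg_def)

lemma hat_neg: "hat (neg f) = - hat f"
  by (rule fps_ext) (simp add: hat_def neg_def hamil_simps)

lemma \<Phi>_neg: "low f \<Longrightarrow> \<Phi> f * \<Phi> (neg f) = 1" "low f \<Longrightarrow> \<Phi> (neg f) * \<Phi> f = 1"
proof -
  show *: "\<Phi> f * \<Phi> (neg f) = 1" if "low f" for f
    using that by (simp add: \<Phi>_def hat_neg P.ex_minus)
  have "neg (neg f) = f" by (simp add: neg_def)
  then show "low f \<Longrightarrow> \<Phi> (neg f) * \<Phi> f = 1" using *[of "neg f"] by simp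
qed

lemma \<Phi>_0: "\<Phi> (\<lambda>n. 0) = 1"
proof -
  have "hat (\<lambda>n. 0) = 0" by (rule fps_ext) (simp add: hat_def hamil_simps)
  then show ?thesis by (simp add: \<Phi>_def)
qed

lemma \<Phi>_commute:
  assumes "low f" "low g" "\<And>i j. poisson_pol (f i) (g j) = 0" shows "\<Phi> f * \<Phi> g = \<Phi> g * \<Phi> f"
proof -
  have "poisson f g = (\<lambda>n. 0)" by (rule ext) (simp add: poisson_def assms(3))
  then have "hat f * hat g - hat g * hat f = 0"
    using hat_poisson[OF assms(1,2)] by (simp add: hat_def hamil_simps fps_eq_iff)
  then show ?thesis unfolding \<Phi>_def using P.ex_commute[of "hat f" "hat g"] assms by simp
qed

end

section \<open>The cobar complex of the symmetric coalgebra\<close>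

subsection \<open>Polynomials as functions of several vectors\<close>

lemma sum_fun_apply: "(sum h A) x = (\<Sum>a\<in>A. h a x)"
  by (induction A rule: infinite_finite_induct) auto

text \<open>A polynomial in the variables \<open>(b, i)\<close> is regarded as a function of one vector of coordinates
  \<open>v i\<close> for each slot \<open>i\<close>; identities between polynomials are checked on values by \<open>pv_eqI\<close>.\<close>
definition pv :: "(nat \<Rightarrow> 'g \<Rightarrow> 'k) \<Rightarrow> ('g, 'k::field_char_0) pol \<Rightarrow> 'k"
  where "pv v = pev (\<lambda>(b, i). v i b)"

definition pd :: "(nat \<Rightarrow> 'g \<Rightarrow> 'k) \<Rightarrow> (nat \<Rightarrow> 'g \<Rightarrow> 'k) \<Rightarrow> ('g, 'k::field_char_0) pol \<Rightarrow> 'k"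
  where "pd v w = dd (\<lambda>(b, i). v i b) (\<lambda>(b, i). w i b)"

lemma rhom_pv: "rhom (pv v)"
  unfolding pv_def by (rule rhom_pev)

lemmas pv_hom = rhom_simps[OF rhom_pv]

lemma pv_Const: "pv v (Const c) = c" and pv_Var: "pv v (Var (b, i)) = v i b"
  by (simp_all add: pv_def pev_simps)

lemma pv_eqI: "(\<And>v. pv v p = pv v q) \<Longrightarrow> p = q"
proof (rule mpol_eqI)
  fix v :: "'a \<times> nat \<Rightarrow> 'b"
  assume "\<And>v. pv v p = pv v q"
  then have "pv (\<lambda>i b. v (b, i)) p = pv (\<lambda>i b. v (b, i)) q" .
  then show "pev v p = pev v q" by (simp add: pv_def case_prod_unfold)
qed

lemma pv_ssub: "pv v (ssub S p) = pv (\<lambda>i. \<Sum>r\<in>S i. v r) p"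
  unfolding pv_def ssub_def pev_subst_pol
  by (rule arg_cong[of _ _ "\<lambda>v. pev v p"]) (auto simp: pev_simps sum_fun_apply)

lemma pv_cong: "vars p \<subseteq> A \<times> I \<Longrightarrow> (\<And>i. i \<in> I \<Longrightarrow> v i = v' i) \<Longrightarrow> pv v p = pv v' p"
  unfolding pv_def by (rule pev_cong) auto

lemma pd_cong: "vars p \<subseteq> A \<times> I \<Longrightarrow> (\<And>i. i \<in> I \<Longrightarrow> v i = v' i) \<Longrightarrow> (\<And>i. i \<in> I \<Longrightarrow> w i = w' i) \<Longrightarrow>
    pd v w p = pd v' w' p"
  unfolding pd_def by (rule dd_cong) auto

lemma pv_line: "\<exists>q. (\<forall>s. pv (\<lambda>i b. v i b + s * w i b) p = poly q s) \<and> coeff q 1 = pd v w p"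
  by (rule exI[of _ "line (\<lambda>(b, i). v i b) (\<lambda>(b, i). w i b) p"])
    (simp add: poly_line pd_def dd_def pv_def case_prod_unfold)

text \<open>A derivative can be read off from any polynomial that describes the values on the line, and
  thus inherits all properties of the values.\<close>
lemma pd_eq_coeff:
  assumes "\<And>s. pv (\<lambda>i b. v i b + s * w i b) p = poly q s" shows "pd v w p = coeff q 1"
proof -
  obtain q' where q': "\<forall>s. pv (\<lambda>i b. v i b + s * w i b) p = poly q' s" "coeff q' 1 = pd v w p"
    using pv_line[of v w p] by blast
  have "q' = q" by (rule poly_eq_all) (use q'(1) assms in metis)
  with q'(2) show ?thesis by simp
qed

lemma pd_add_right: "pd v (\<lambda>i b. w i b + w' i b) p = pd v w p + pd v w' p"
  unfolding pd_def using dd_add_right[of _ "\<lambda>(b, i). w i b" "\<lambda>(b, i). w' i b" p]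
  by (simp add: case_prod_unfold)

lemma pd_scale_right: "pd v (\<lambda>i b. t * w i b) p = t * pd v w p"
  unfolding pd_def using dd_scale_right[of _ t "\<lambda>(b, i). w i b" p]
  by (simp add: case_prod_unfold)

lemma pd_0_right [simp]: "pd v (\<lambda>i b. 0) p = 0" "pd v (\<lambda>i. 0) p = 0"
  using pd_scale_right[of v 0 "\<lambda>i b. 0" p] by (simp_all add: zero_fun_def)

lemma pd_sum_right: "finite A \<Longrightarrow> pd v (\<lambda>i. \<Sum>a\<in>A. w a i) p = (\<Sum>a\<in>A. pd v (w a) p)"
proof (induction A rule: finite_induct)
  case (insert x A)
  then show ?case using pd_add_right[of v "w x" "\<lambda>i. \<Sum>a\<in>A. w a i" p] by (simp add: plus_fun_def)
qed simp

lemma pd_sum_left: "pd v w (p + q) = pd v w p + pd v w q" "pd v w 0 = 0"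
  "pd v w (Const c * p) = c * pd v w p"
  by (simp_all add: pd_def dd_simps pev_simps)

lemma pd_ssub: "pd v w (ssub S p) = pd (\<lambda>i. \<Sum>r\<in>S i. v r) (\<lambda>i. \<Sum>r\<in>S i. w r) p"
proof -
  obtain q where q: "\<forall>s. pv (\<lambda>i b. v i b + s * w i b) (ssub S p) = poly q s" "coeff q 1 = pd v w (ssub S p)"
    using pv_line[of v w "ssub S p"] by blast
  have "pd (\<lambda>i. \<Sum>r\<in>S i. v r) (\<lambda>i. \<Sum>r\<in>S i. w r) p = coeff q 1"
  proof (rule pd_eq_coeff)
    fix s
    have "(\<lambda>i b. (\<Sum>r\<in>S i. v r) b + s * (\<Sum>r\<in>S i. w r) b) = (\<lambda>i. \<Sum>r\<in>S i. (\<lambda>b. v r b + s * w r b))"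
      by (intro ext) (simp add: sum_fun_apply sum.distrib sum_distrib_left)
    then show "pv (\<lambda>i b. (\<Sum>r\<in>S i. v r) b + s * (\<Sum>r\<in>S i. w r) b) p = poly q s"
      using q(1) by (simp add: pv_ssub)
  qed
  with q(2) show ?thesis by simp
qed

definition only :: "nat \<Rightarrow> 'x::zero \<Rightarrow> nat \<Rightarrow> 'x" where "only m x = (\<lambda>i. if i = m then x else 0)"

definition linslot :: "nat \<Rightarrow> ('g, 'k::field_char_0) pol \<Rightarrow> bool"
  where "linslot a p \<longleftrightarrow> (\<forall>v x y t. pv (v(a := (\<lambda>b. x b + t * y b))) p = pv (v(a := x)) p + t * pv (v(a := y)) p)"

lemma linslot_pd:
  assumes "linslot a p" "w a = 0"
  shows "pd (v(a := (\<lambda>b. x b + t * y b))) w p = pd (v(a := x)) w p + t * pd (v(a := y)) w p"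
proof -
  obtain q1 where q1: "\<forall>s. pv (\<lambda>i b. (v(a := x)) i b + s * w i b) p = poly q1 s" "coeff q1 1 = pd (v(a := x)) w p"
    using pv_line by blast
  obtain q2 where q2: "\<forall>s. pv (\<lambda>i b. (v(a := y)) i b + s * w i b) p = poly q2 s" "coeff q2 1 = pd (v(a := y)) w p"
    using pv_line by blast
  have "pd (v(a := (\<lambda>b. x b + t * y b))) w p = coeff (q1 + smult t q2) 1"
  proof (rule pd_eq_coeff)
    fix s
    let ?u = "\<lambda>i b. v i b + s * w i b"
    have upd: "(\<lambda>i b. (v(a := z)) i b + s * w i b) = ?u(a := z)" for z
      using assms(2) by (auto simp: fun_eq_iff)
    have "pv (?u(a := (\<lambda>b. x b + t * y b))) p = pv (?u(a := x)) p + t * pv (?u(a := y)) p"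
      using assms(1) unfolding linslot_def by blast
    then show "pv (\<lambda>i b. (v(a := (\<lambda>b. x b + t * y b))) i b + s * w i b) p = poly (q1 + smult t q2) s"
      using q1(1)[rule_format, of s] q2(1)[rule_format, of s] by (simp only: upd poly_add poly_smult)
  qed
  then show ?thesis using q1(2) q2(2) by simp
qed

lemma linslot_euler:
  assumes "linslot a p" shows "pd v (only a (v a)) p = pv v p"
proof -
  have "pd v (only a (v a)) p = coeff [:pv v p, pv v p:] 1"
  proof (rule pd_eq_coeff)
    fix s
    have "pv (v(a := (\<lambda>b. v a b + s * v a b))) p = pv (v(a := v a)) p + s * pv (v(a := v a)) p"
      using assms unfolding linslot_def by blast
    moreover have "(\<lambda>i b. v i b + s * only a (v a) i b) = v(a := (\<lambda>b. v a b + s * v a b))"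
      by (auto simp: only_def fun_eq_iff)
    ultimately show "pv (\<lambda>i b. v i b + s * only a (v a) i b) p = poly [:pv v p, pv v p:] s" by simp
  qed
  then show ?thesis by simp
qed

definition homog :: "nat \<Rightarrow> ('g, 'k::field_char_0) pol \<Rightarrow> bool"
  where "homog n p \<longleftrightarrow> (\<forall>t v. pv (\<lambda>i b. t * v i b) p = t ^ n * pv v p)"

lemma homog_euler:
  assumes "homog n p" shows "pd v v p = of_nat n * pv v p"
proof -
  have c: "coeff ([:1, 1:] ^ m) 0 = (1::'b)" "coeff ([:1, 1:] ^ m) 1 = (of_nat m :: 'b)" for m
    by (induction m) (auto simp: coeff_mult numeral_2_eq_2)
  have "pd v v p = coeff (smult (pv v p) ([:1, 1:] ^ n)) 1"
  proof (rule pd_eq_coeff)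
    fix s
    have "pv (\<lambda>i b. (1 + s) * v i b) p = (1 + s) ^ n * pv v p"
      using assms unfolding homog_def by blast
    then show "pv (\<lambda>i b. v i b + s * v i b) p = poly (smult (pv v p) ([:1, 1:] ^ n)) s"
      by (simp add: algebra_simps)
  qed
  then show ?thesis using c(2)[of n] by (simp add: mult.commute)
qed

lemma homog_pd:
  assumes "homog n p" shows "pd (\<lambda>i b. t * v i b) (\<lambda>i b. t * w i b) p = t ^ n * pd v w p"
proof -
  obtain q where q: "\<forall>s. pv (\<lambda>i b. v i b + s * w i b) p = poly q s" "coeff q 1 = pd v w p"
    using pv_line by blast
  have "pd (\<lambda>i b. t * v i b) (\<lambda>i b. t * w i b) p = coeff (smult (t ^ n) q) 1"
  proof (rule pd_eq_coeff)
    fix s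
    have "pv (\<lambda>i b. t * (v i b + s * w i b)) p = t ^ n * pv (\<lambda>i b. v i b + s * w i b) p"
      using assms[unfolded homog_def, rule_format, of t "\<lambda>i b. v i b + s * w i b"] .
    then show "pv (\<lambda>i b. t * v i b + s * (t * w i b)) p = poly (smult (t ^ n) q) s"
      using q(1) by (simp add: algebra_simps)
  qed
  then show ?thesis using q(2) by simp
qed

subsection \<open>The differential\<close>

text \<open>The coface \<open>j\<close> applies the coproduct to slot \<open>j\<close>. For \<open>j = 0\<close> it leaves the first slot of the
  result empty, and if \<open>j\<close> exceeds the number of slots, the last one. Slot \<open>0\<close> is not touched by the
  cofaces: it holds a parameter.\<close>
definition cofS :: "nat \<Rightarrow> nat \<Rightarrow> nat set"
  where "cofS j i = (if i = 0 then {0} else if i < j then {i} else if i = j then {i, i + 1} else {i + 1})"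

definition cof :: "nat \<Rightarrow> (nat \<Rightarrow> 'x::ab_group_add) \<Rightarrow> nat \<Rightarrow> 'x"
  where "cof j v i = (if i = 0 then v 0 else if i < j then v i else if i = j then v i + v (i + 1) else v (i + 1))"

lemma cof_eq_sum: "(\<Sum>r\<in>cofS j i. v r) = cof j v i"
  by (simp add: cofS_def cof_def)

text \<open>The differential of the cobar complex on polynomials in \<open>K\<close> slots.\<close>
definition bd :: "nat \<Rightarrow> ('g, 'k::field_char_0) pol \<Rightarrow> ('g, 'k) pol"
  where "bd K p = (\<Sum>j\<le>K + 1. (- 1) ^ j * ssub (cofS j) p)"

lemma pv_bd: "pv v (bd K p) = (\<Sum>j\<le>K + 1. (- 1) ^ j * pv (cof j v) p)"
  by (simp add: bd_def pv_hom pv_ssub cof_eq_sum)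

lemma pd_bd:
  fixes p :: "('g, 'k::field_char_0) pol"
  shows "pd v w (bd K p) = (\<Sum>j\<le>K + 1. (- 1) ^ j * pd (cof j v) (cof j w) p)"
proof -
  have sgn: "(- 1) ^ j * q = Const ((- 1) ^ j) * q" for j and q :: "('g, 'k) pol"
    by (cases "even j") auto
  have "pd v w (sum h A) = (\<Sum>a\<in>A. pd v w (h a))" for h :: "nat \<Rightarrow> ('g, 'k) pol" and A
    by (induction A rule: infinite_finite_induct) (auto simp: pd_sum_left)
  then show ?thesis by (simp add: bd_def sgn pd_sum_left pd_ssub cof_eq_sum del: sum.atMost_Suc)
qed

lemma cof_cof: "j < i \<Longrightarrow> cof j (cof i v) = cof (i - 1) (cof j v)"
  by (rule ext) (auto simp: cof_def add_ac)

lemma bd_bd: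
  fixes p :: "('g, 'k::field_char_0) pol"
  shows "bd (K + 1) (bd K p) = 0"
proof (rule pv_eqI)
  fix v :: "nat \<Rightarrow> 'g \<Rightarrow> 'k"
  define f where "f i j = (- 1) ^ (i + j) * pv (cof j (cof i v)) p" for i j
  have "pv v (bd (K + 1) (bd K p)) = (\<Sum>i\<le>K + 2. \<Sum>j\<le>K + 1. f i j)"
    unfolding pv_bd f_def by (simp add: sum_distrib_left power_add mult.assoc numeral_2_eq_2 del: sum.atMost_Suc)
  also have "\<dots> = (\<Sum>(i, j)\<in>{..K + 2} \<times> {..K + 1}. f i j)"
    by (simp only: sum.cartesian_product)
  also have "{..K + 2} \<times> {..K + 1} = {(i, j). j < i \<and> i \<le> K + 2} \<union> {(i, j). i \<le> j \<and> j \<le> K + 1}"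
    by auto
  also have "(\<Sum>(i, j)\<in>{(i, j). j < i \<and> i \<le> K + 2} \<union> {(i, j). i \<le> j \<and> j \<le> K + 1}. f i j) =
      (\<Sum>(i, j)\<in>{(i, j). j < i \<and> i \<le> K + 2}. f i j) + (\<Sum>(i, j)\<in>{(i, j). i \<le> j \<and> j \<le> K + 1}. f i j)"
  proof (rule sum.union_disjoint)
    show "finite {(i, j). j < i \<and> i \<le> K + 2}"
      by (rule finite_subset[of _ "{..K + 2} \<times> {..K + 2}"]) auto
    show "finite {(i, j). i \<le> j \<and> j \<le> K + 1}"
      by (rule finite_subset[of _ "{..K + 2} \<times> {..K + 2}"]) auto
  qed auto
  also have "(\<Sum>(i, j)\<in>{(i, j). j < i \<and> i \<le> K + 2}. f i j) = (\<Sum>(i, j)\<in>{(i, j). i \<le> j \<and> j \<le> K + 1}. - f i j)"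
    by (rule sum.reindex_bij_witness[of _ "\<lambda>(i, j). (j + 1, i)" "\<lambda>(i, j). (j, i - 1)"])
      (auto simp: f_def cof_cof add.commute Suc_diff_le minus_one_power_iff split: if_splits)
  finally show "pv v (bd (K + 1) (bd K p)) = pv v 0"
    by (simp add: case_prod_unfold sum_negf pv_hom)
qed

lemma bd_simps: "bd K (p + q) = bd K p + bd K q" "bd K (p - q) = bd K p - bd K q" "bd K 0 = 0"
  "bd K (Const c * p) = Const c * bd K p" "bd K (- p) = - bd K p"
  by (simp_all add: bd_def ssub_simps distrib_left right_diff_distrib sum.distrib sum_subtractf
      sum_distrib_left mult_ac sum_negf)

subsection \<open>Making a cocycle linear in one more slot\<close>

definition insert_zero :: "nat \<Rightarrow> (nat \<Rightarrow> 'x::zero) \<Rightarrow> nat \<Rightarrow> 'x"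
  where "insert_zero m v i = (if i < m then v i else if i = m then 0 else v (i - 1))"

text \<open>The part of \<open>c\<close> that is linear in slot \<open>m\<close>, as a function of the parameter in slot \<open>0\<close> and of the
  other slots.\<close>
definition linpart :: "nat \<Rightarrow> ('g, 'k::field_char_0) pol \<Rightarrow> (nat \<Rightarrow> 'g \<Rightarrow> 'k) \<Rightarrow> 'k"
  where "linpart m c v = pd (insert_zero m v) (only m (v 0)) c"

lemma cof_upd0: "cof j (v(0 := x)) = (cof j v)(0 := x)"
  by (auto simp: cof_def fun_eq_iff)

lemma linpart_add:
  "linpart m c (v(0 := x + y)) = linpart m c (v(0 := x)) + linpart m c (v(0 := y))" if "m > 0" "vars c \<subseteq> A \<times> {1..K}"
proof -
  have "linpart m c (v(0 := z)) = pd (insert_zero m v) (only m z) c" for z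
    unfolding linpart_def by (rule pd_cong[OF that(2)]) (use that(1) in \<open>auto simp: insert_zero_def only_def\<close>)
  moreover have "only m (x + y) = (\<lambda>i b. only m x i b + only m y i b)"
    by (auto simp: only_def fun_eq_iff)
  ultimately show ?thesis by (simp add: pd_add_right)
qed

text \<open>Taking the part of the cocycle equation that is linear in one slot, and summing over the slots with
  alternating signs, expresses the derivative of a cocycle in a slot by its linear parts.\<close>
lemma cocycle_derivative:
  fixes c :: "('g, 'k::field_char_0) pol" and v :: "nat \<Rightarrow> 'g \<Rightarrow> 'k"
  assumes c: "vars c \<subseteq> A \<times> {1..K}" "bd K c = 0" and m: "m \<le> K"
  shows "(- 1) ^ m * pd v (only m (v 0)) c =
    (\<Sum>i = 1..<m. (- 1) ^ (m + i) * (\<Sum>j\<le>K. (- 1) ^ j * linpart i c (cof j v))) +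
    (if m = 0 then 0 else \<Sum>j = m..K. (- 1) ^ j * linpart m c (cof j v))"
  using m
proof (induction m)
  case 0
  have "pd v (only 0 (v 0)) c = pd v (\<lambda>_. 0) c"
    by (rule pd_cong[OF c(1)]) (auto simp: only_def)
  then show ?case by simp
next
  case (Suc m)
  have low: "pd (cof j (insert_zero (Suc m) v)) (cof j (only (Suc m) (v 0))) c = linpart m c (cof j v)" if "j < m" for j
    unfolding linpart_def
    by (rule pd_cong[OF c(1)]) (use that in \<open>auto simp: cof_def insert_zero_def only_def\<close>)
  have eq1: "pd (cof m (insert_zero (Suc m) v)) (cof m (only (Suc m) (v 0))) c = pd v (only m (v 0)) c"
    by (rule pd_cong[OF c(1)]) (auto simp: cof_def insert_zero_def only_def)
  have eq2: "pd (cof (Suc m) (insert_zero (Suc m) v)) (cof (Suc m) (only (Suc m) (v 0))) c = pd v (only (Suc m) (v 0)) c"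
    by (rule pd_cong[OF c(1)]) (auto simp: cof_def insert_zero_def only_def)
  have high: "pd (cof (Suc j) (insert_zero (Suc m) v)) (cof (Suc j) (only (Suc m) (v 0))) c = linpart (Suc m) c (cof j v)"
    if "j > m" for j
    unfolding linpart_def
    by (rule pd_cong[OF c(1)]) (use that in \<open>auto simp: cof_def insert_zero_def only_def\<close>)
  define h where "h j = (- 1) ^ j * pd (cof j (insert_zero (Suc m) v)) (cof j (only (Suc m) (v 0))) c" for j
  have "{..K + 1} = {..<m} \<union> {m, Suc m} \<union> {Suc (Suc m)..Suc K}"
    using Suc.prems by auto
  then have "(\<Sum>j\<le>K + 1. h j) = (\<Sum>j\<in>{..<m} \<union> {m, Suc m} \<union> {Suc (Suc m)..Suc K}. h j)" by simp
  also have "\<dots> = (\<Sum>j<m. h j) + (h m + h (Suc m)) + (\<Sum>j\<in>{Suc (Suc m)..Suc K}. h j)"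
    by (subst sum.union_disjoint, simp, simp, force, subst sum.union_disjoint) auto
  also have "(\<Sum>j\<in>{Suc (Suc m)..Suc K}. h j) = (\<Sum>j = Suc m..K. h (Suc j))"
    by (rule sum.shift_bounds_cl_Suc_ivl)
  finally have "(\<Sum>j<m. h j) + (h m + h (Suc m)) + (\<Sum>j = Suc m..K. h (Suc j)) = 0"
    using pd_bd[of "insert_zero (Suc m) v" "only (Suc m) (v 0)" K c] c(2) by (simp add: h_def pd_sum_left)
  moreover have "(\<Sum>j<m. h j) = (\<Sum>j<m. (- 1) ^ j * linpart m c (cof j v))"
    by (intro sum.cong refl) (simp add: h_def low)
  moreover have "(\<Sum>j = Suc m..K. h (Suc j)) = - (\<Sum>j = Suc m..K. (- 1) ^ j * linpart (Suc m) c (cof j v))"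
    by (simp add: h_def high sum_negf)
  ultimately have *: "(- 1) ^ Suc m * pd v (only (Suc m) (v 0)) c =
      (\<Sum>j = Suc m..K. (- 1) ^ j * linpart (Suc m) c (cof j v)) -
      (\<Sum>j<m. (- 1) ^ j * linpart m c (cof j v)) - (- 1) ^ m * pd v (only m (v 0)) c"
    by (simp add: h_def eq1 eq2 algebra_simps)
  show ?case
  proof (cases "m = 0")
    case True
    then show ?thesis using * Suc by simp
  next
    case False
    have "(\<Sum>j\<le>K. (- 1) ^ j * linpart m c (cof j v)) =
      (\<Sum>j<m. (- 1) ^ j * linpart m c (cof j v)) + (\<Sum>j = m..K. (- 1) ^ j * linpart m c (cof j v))"
      using Suc.prems by (subst sum.union_disjoint[symmetric]) (auto intro!: sum.cong)
    then show ?thesis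
      using * Suc.IH Suc.prems False
      by (simp add: sum_negf algebra_simps)
  qed
qed

text \<open>The linear part in slot \<open>m\<close> is taken by differentiation in the direction of the parameter in
  slot \<open>0\<close>, followed by a substitution that empties slot \<open>m\<close> and moves the parameter to slot \<open>i\<close>.\<close>
definition extr :: "nat \<Rightarrow> ('g, 'k::field_char_0) pol \<Rightarrow> ('g, 'k) pol"
  where "extr m c = der (\<lambda>(b, s). if s = m then Var (b, 0) else 0) c"

lemma extr_0: "extr m 0 = 0"
  by (simp add: extr_def)

lemma pv_extr: "pv v (extr m c) = pd v (only m (v 0)) c"
  unfolding pv_def pd_def extr_def pev_der
  by (rule arg_cong[of _ _ "\<lambda>w. dd _ w c"]) (auto simp: fun_eq_iff only_def pev_simps)

definition slotS :: "nat \<Rightarrow> nat \<Rightarrow> nat \<Rightarrow> nat set"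
  where "slotS m i s = (if s = 0 then {i} else if s < m then {s} else if s = m then {} else {s - 1})"

lemma pv_slotS:
  assumes "m > 0" "vars c \<subseteq> A \<times> {1..K}"
  shows "pv v (ssub (slotS m i) (extr m c)) = linpart m c (v(0 := v i))"
  unfolding pv_ssub pv_extr linpart_def
  by (rule pd_cong[OF assms(2)]) (use assms(1) in \<open>auto simp: slotS_def insert_zero_def only_def\<close>)

text \<open>The homotopy: the linear part of \<open>c\<close> in slot \<open>m\<close> is a function of one slot less and of a
  parameter, and the parameter is multiplied into each slot from \<open>m\<close> to \<open>k - 1\<close>.\<close>
definition theta :: "nat \<Rightarrow> ('g, 'k::field_char_0) pol \<Rightarrow> ('g, 'k) pol"
  where "theta k c = (\<Sum>m = 1..<k. \<Sum>i = m..<k. (- 1) ^ m * ssub (slotS m i) (extr m c))"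

lemma pv_theta:
  assumes "vars c \<subseteq> A \<times> {1..K}"
  shows "pv v (theta k c) = (\<Sum>m = 1..<k. \<Sum>i = m..<k. (- 1) ^ m * linpart m c (v(0 := v i)))"
  unfolding theta_def pv_hom by (intro sum.cong refl) (simp add: pv_slotS[OF _ assms])

definition omit_slot :: "nat \<Rightarrow> (nat \<Rightarrow> 'x) \<Rightarrow> nat \<Rightarrow> 'x"
  where "omit_slot a v i = (if i = 0 then v 0 else if i < a then v i else v (i + 1))"

lemma linpart_linear:
  assumes "linslot (a + 1) c" "0 < m" "m \<le> a"
  shows "linpart m c (u(a := (\<lambda>b. x b + t * y b))) = linpart m c (u(a := x)) + t * linpart m c (u(a := y))"
proof -
  have "linpart m c (u(a := z)) = pd ((insert_zero m u)(a + 1 := z)) (only m (u 0)) c" for z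
  proof -
    have "insert_zero m (u(a := z)) = (insert_zero m u)(a + 1 := z)"
      using assms(2,3) by (auto simp: insert_zero_def fun_eq_iff)
    then show ?thesis using assms(2,3) by (simp add: linpart_def)
  qed
  then show ?thesis using linslot_pd[OF assms(1)] assms(2,3) by (simp add: only_def)
qed

text \<open>Where \<open>c\<close> is linear, the coface that adds the vectors \<open>a\<close> and \<open>a + 1\<close> is the sum of the two
  functions that omit one of them, so that the alternating sum telescopes.\<close>
lemma linpart_telescope:
  assumes c: "vars c \<subseteq> A \<times> {1..K}" and lin: "\<And>a. k < a \<Longrightarrow> a \<le> K \<Longrightarrow> linslot a c"
    and m: "0 < m" "m \<le> k" and a: "k \<le> a" "a \<le> K"
  shows "(\<Sum>j = a..K. (- 1) ^ j * linpart m c (cof j v)) = (- 1) ^ a * linpart m c (omit_slot a v)"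
  using a(2,1)
proof (induction a rule: inc_induct)
  case base
  have "linpart m c (cof K v) = linpart m c (omit_slot K v)"
    unfolding linpart_def
    by (rule pd_cong[OF c]) (use m base in \<open>auto simp: insert_zero_def only_def cof_def omit_slot_def\<close>)
  then show ?case by simp
next
  case (step a)
  have e: "cof a v = (omit_slot a v)(a := (\<lambda>b. v a b + 1 * v (a + 1) b))"
    using m step by (auto simp: cof_def omit_slot_def fun_eq_iff)
  have "linpart m c (cof a v) = linpart m c ((omit_slot a v)(a := v a)) + 1 * linpart m c ((omit_slot a v)(a := v (a + 1)))"
    unfolding e by (rule linpart_linear) (use lin[of "a + 1"] m step in auto)
  also have "(omit_slot a v)(a := v a) = omit_slot (Suc a) v"
    using m step by (auto simp: omit_slot_def fun_eq_iff less_Suc_eq)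
  also have "(omit_slot a v)(a := v (a + 1)) = omit_slot a v"
    using m step by (auto simp: omit_slot_def fun_eq_iff)
  finally have "linpart m c (cof a v) = linpart m c (omit_slot (Suc a) v) + linpart m c (omit_slot a v)" by simp
  moreover have "(\<Sum>j = a..K. (- 1) ^ j * linpart m c (cof j v)) =
      (- 1) ^ a * linpart m c (cof a v) + (\<Sum>j = Suc a..K. (- 1) ^ j * linpart m c (cof j v))"
    using step.hyps by (simp add: sum.atLeast_Suc_atMost)
  ultimately show ?case using step by (simp add: algebra_simps)
qed

text \<open>The vector \<open>v\<close> is the sum of its parts in the single slots.\<close>
lemma slot_euler:
  assumes "vars c \<subseteq> A \<times> {1..K}"
  shows "pd v v c = (\<Sum>a = 1..K. pd v (only a (v a)) c)"
proof -
  have "pd v v c = pd v (\<lambda>i. \<Sum>a = 1..K. only a (v a) i) c"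
    by (rule pd_cong[OF assms]) (auto simp: only_def)
  then show ?thesis by (simp add: pd_sum_right)
qed

text \<open>By Euler's identity the sum of the derivatives of \<open>c\<close> in its first \<open>k\<close> slots is \<open>n - (K - k)\<close>
  times \<open>c\<close>, the degree in the last \<open>K - k\<close> slots being one each. These derivatives are expressed by
  linear parts through \<open>cocycle_derivative\<close>. All the terms but those on the right are accounted for
  by the coboundary of \<open>theta k c\<close>; the right-hand side is linear in \<open>v k\<close>, which occurs only as the
  parameter.\<close>
lemma cocycle_remainder:
  fixes c :: "('g, 'k::field_char_0) pol"
  assumes c: "vars c \<subseteq> A \<times> {1..K}" "bd K c = 0" "homog n c"
    and k: "1 \<le> k" "k \<le> K" "K \<le> n" and lin: "\<And>a. k < a \<Longrightarrow> a \<le> K \<Longrightarrow> linslot a c"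
  shows "of_nat (n - (K - k)) * pv v c - pv v (bd (K - 1) (theta k c)) =
    (\<Sum>m = 1..k. (- 1) ^ (m + k) * linpart m c (omit_slot k (v(0 := v k))))"
proof -
  define G where "G m j x = (- 1) ^ j * linpart m c (cof j (v(0 := x)))" for m j x
  define P where "P m a = (\<Sum>j<a. G m j (v a))" for m a
  define Q where "Q m a = (\<Sum>j = a..K. G m j (v a))" for m a
  \<comment> \<open>The coboundary of a linear part with parameter \<open>v a\<close> is cut into the cofaces before and from
    \<open>a\<close> on, since \<open>bd (theta k c)\<close> produces \<open>P m (i + 1)\<close> and \<open>Q m i\<close> from the term with the
    parameter in slot \<open>i\<close>.\<close>
  have full: "(\<Sum>j\<le>K. G m j (v a)) = P m a + Q m a" if "a \<le> K" for m a
    unfolding P_def Q_def using that by (subst sum.union_disjoint[symmetric]) (auto intro!: sum.cong)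
  have der: "pd v (only m (v m)) c = (\<Sum>i = 1..<m. (- 1) ^ i * (P i m + Q i m)) + (- 1) ^ m * Q m m"
    if m: "m \<in> {1..k}" for m
  proof -
    let ?v = "v(0 := v m)"
    have "pd v (only m (v m)) c = pd ?v (only m (?v 0)) c"
      by (rule pd_cong[OF c(1)]) auto
    also have "\<dots> = (- 1) ^ m * ((- 1) ^ m * pd ?v (only m (?v 0)) c)"
      by (simp add: minus_one_power_iff)
    also have "\<dots> = (- 1) ^ m * ((\<Sum>i = 1..<m. (- 1) ^ (m + i) * (\<Sum>j\<le>K. G i j (v m))) + Q m m)"
      using m k cocycle_derivative[OF c(1,2), of m ?v] by (simp add: G_def Q_def)
    also have "\<dots> = (\<Sum>i = 1..<m. (- 1) ^ i * (P i m + Q i m)) + (- 1) ^ m * Q m m"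
      using m k by (simp add: full distrib_left sum_distrib_left power_add minus_one_power_iff)
    finally show ?thesis .
  qed
  have "of_nat n * pv v c = (\<Sum>a = 1..K. pd v (only a (v a)) c)"
    using homog_euler[OF c(3), of v] slot_euler[OF c(1), of v] by simp
  also have "\<dots> = (\<Sum>a = 1..k. pd v (only a (v a)) c) + (\<Sum>a = k + 1..K. pd v (only a (v a)) c)"
    using k by (subst sum.union_disjoint[symmetric]) (auto intro!: sum.cong)
  also have "(\<Sum>a = k + 1..K. pd v (only a (v a)) c) = (\<Sum>a = k + 1..K. pv v c)"
    by (intro sum.cong refl linslot_euler lin) auto
  finally have "of_nat (n - (K - k)) * pv v c = (\<Sum>a = 1..k. pd v (only a (v a)) c)"
    using k by (simp add: of_nat_diff algebra_simps)
  also have "\<dots> = (\<Sum>m = 1..k. \<Sum>i = 1..<m. (- 1) ^ i * (P i m + Q i m)) + (\<Sum>m = 1..k. (- 1) ^ m * Q m m)"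
    by (simp add: der sum.distrib)
  also have "(\<Sum>m = 1..k. \<Sum>i = 1..<m. (- 1) ^ i * (P i m + Q i m)) =
      (\<Sum>i = 1..k. \<Sum>m = i + 1..k. (- 1) ^ i * (P i m + Q i m))"
  proof -
    have "(\<Sum>m = 1..k. \<Sum>i = 1..<m. (- 1) ^ i * (P i m + Q i m)) =
        (\<Sum>(m, i)\<in>(SIGMA m:{1..k}. {1..<m}). (- 1) ^ i * (P i m + Q i m))"
      by (rule sum.Sigma) auto
    also have "\<dots> = (\<Sum>(i, m)\<in>(SIGMA i:{1..k}. {i + 1..k}). (- 1) ^ i * (P i m + Q i m))"
      by (rule sum.reindex_bij_witness[of _ "\<lambda>(i, m). (m, i)" "\<lambda>(m, i). (i, m)"]) auto
    also have "\<dots> = (\<Sum>i = 1..k. \<Sum>m = i + 1..k. (- 1) ^ i * (P i m + Q i m))"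
      by (rule sum.Sigma[symmetric]) auto
    finally show ?thesis .
  qed
  finally have NC: "of_nat (n - (K - k)) * pv v c =
      (\<Sum>m = 1..k. (- 1) ^ m * (Q m m + (\<Sum>a = m + 1..k. P m a + Q m a)))"
    by (simp add: sum_distrib_left distrib_left sum.distrib)
  have bd: "pv v (bd (K - 1) (theta k c)) = (\<Sum>m = 1..<k. (- 1) ^ m * (\<Sum>i = m..<k. P m (i + 1) + Q m i))"
  proof -
    have H: "(\<Sum>j\<le>K. (- 1) ^ j * linpart m c ((cof j v)(0 := cof j v i))) = P m (i + 1) + Q m i"
      if "0 < m" "m \<le> i" "i < k" for m i
    proof -
      have "(- 1) ^ j * linpart m c ((cof j v)(0 := cof j v i)) =
          (if j < i + 1 then G m j (v (i + 1)) else 0) + (if i \<le> j then G m j (v i) else 0)" for j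
        using that linpart_add[OF that(1) c(1), of "cof j v" "v i" "v (i + 1)"]
        by (simp add: cof_def[of j v i] G_def cof_upd0 distrib_left)
      moreover have "(\<Sum>j\<le>K. if j < i + 1 then G m j (v (i + 1)) else 0) = P m (i + 1)"
        unfolding P_def using that k by (intro sum.mono_neutral_cong_right) auto
      moreover have "(\<Sum>j\<le>K. if i \<le> j then G m j (v i) else 0) = Q m i"
        unfolding Q_def by (intro sum.mono_neutral_cong_right) auto
      ultimately show ?thesis by (simp only: sum.distrib)
    qed
    have "pv v (bd (K - 1) (theta k c)) = (\<Sum>j\<le>K. (- 1) ^ j * pv (cof j v) (theta k c))"
      using k by (simp add: pv_bd)
    also have "\<dots> = (\<Sum>j\<le>K. \<Sum>m = 1..<k. \<Sum>i = m..<k. (- 1) ^ m * ((- 1) ^ j * linpart m c ((cof j v)(0 := cof j v i))))"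
      unfolding pv_theta[OF c(1)] by (simp only: sum_distrib_left mult.left_commute)
    also have "\<dots> = (\<Sum>m = 1..<k. \<Sum>i = m..<k. \<Sum>j\<le>K. (- 1) ^ m * ((- 1) ^ j * linpart m c ((cof j v)(0 := cof j v i))))"
      unfolding sum.swap[of _ _ "{..K}"] ..
    also have "\<dots> = (\<Sum>m = 1..<k. (- 1) ^ m * (\<Sum>i = m..<k. P m (i + 1) + Q m i))"
      unfolding sum_distrib_left[symmetric]
      by (intro sum.cong refl arg_cong2[where f = "(*)"]) (use H in auto)
    finally show ?thesis .
  qed
  have "Q m m + (\<Sum>a = m + 1..k. P m a + Q m a) - (\<Sum>i = m..<k. P m (i + 1) + Q m i) = Q m k"
    if "m \<in> {1..k}" for m
  proof -
    have "(\<Sum>i = m..<k. P m (i + 1)) = (\<Sum>a = m + 1..k. P m a)"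
      by (rule sum.reindex_bij_witness[of _ "\<lambda>a. a - 1" "\<lambda>i. i + 1"]) auto
    moreover have "(\<Sum>i = m..<k. Q m i) + Q m k = Q m m + (\<Sum>a = m + 1..k. Q m a)"
      using that by (simp add: sum.atLeast_Suc_atMost[of m k "Q m"] flip: sum.last_plus)
        (metis atLeastLessThanSuc_atLeastAtMost sum.atLeastLessThan_Suc sum.atLeast_Suc_atMost)
    ultimately show ?thesis by (simp add: sum.distrib algebra_simps)
  qed
  then have "(\<Sum>m = 1..k. (- 1) ^ m * Q m k) = (\<Sum>m = 1..k. (- 1) ^ m * (Q m m + (\<Sum>a = m + 1..k. P m a + Q m a)))
      - (\<Sum>m = 1..k. (- 1) ^ m * (\<Sum>i = m..<k. P m (i + 1) + Q m i))"
    unfolding sum_subtractf[symmetric] right_diff_distrib[symmetric] by (intro sum.cong refl) auto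
  also have "(\<Sum>m = 1..k. (- 1) ^ m * (\<Sum>i = m..<k. P m (i + 1) + Q m i)) = pv v (bd (K - 1) (theta k c))"
    unfolding bd by (intro sum.mono_neutral_right) auto
  finally have "of_nat (n - (K - k)) * pv v c - pv v (bd (K - 1) (theta k c)) = (\<Sum>m = 1..k. (- 1) ^ m * Q m k)"
    by (simp add: NC)
  also have "\<dots> = (\<Sum>m = 1..k. (- 1) ^ (m + k) * linpart m c (omit_slot k (v(0 := v k))))"
  proof (intro sum.cong refl)
    fix m assume "m \<in> {1..k}"
    then have "Q m k = (- 1) ^ k * linpart m c (omit_slot k (v(0 := v k)))"
      unfolding Q_def G_def using linpart_telescope[where v = "v(0 := v k)" and m = m and a = k and k = k, OF c(1) lin] k by simp
    then show "(- 1) ^ m * Q m k = (- 1) ^ (m + k) * linpart m c (omit_slot k (v(0 := v k)))"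
      by (simp add: power_add)
  qed
  finally show ?thesis .
qed

lemma cocycle_step:
  fixes c :: "('g, 'k::field_char_0) pol"
  assumes c: "vars c \<subseteq> A \<times> {1..K}" "bd K c = 0" "homog n c"
    and k: "1 \<le> k" "k \<le> K" "K \<le> n" and lin: "\<And>a. k < a \<Longrightarrow> a \<le> K \<Longrightarrow> linslot a c"
    and a: "k \<le> a" "a \<le> K"
  shows "linslot a (Const (of_nat (n - (K - k))) * c - bd (K - 1) (theta k c))"
proof -
  have eq: "pv v (Const (of_nat (n - (K - k))) * c - bd (K - 1) (theta k c)) =
      (\<Sum>m = 1..k. (- 1) ^ (m + k) * linpart m c (omit_slot k (v(0 := v k))))" for v
    using cocycle_remainder[OF c k lin, of v] by (simp add: pv_hom pv_Const)
  have "linpart m c (omit_slot k ((v(a := (\<lambda>b. x b + t * y b)))(0 := (v(a := (\<lambda>b. x b + t * y b))) k))) =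
      linpart m c (omit_slot k ((v(a := x))(0 := (v(a := x)) k))) + t * linpart m c (omit_slot k ((v(a := y))(0 := (v(a := y)) k)))"
    if m: "m \<in> {1..k}" for v x y t m
  proof (cases "a = k")
    case True
    have "omit_slot k ((v(a := z))(0 := (v(a := z)) k)) = (omit_slot k v)(0 := z)" for z
      using True k by (auto simp: omit_slot_def fun_eq_iff)
    moreover have "linpart m c ((omit_slot k v)(0 := z)) = pd (insert_zero m (omit_slot k v)) (only m z) c" for z
      unfolding linpart_def by (rule pd_cong[OF c(1)]) (use m in \<open>auto simp: insert_zero_def only_def\<close>)
    moreover have "only m (\<lambda>b. x b + t * y b) = (\<lambda>i b. only m x i b + t * only m y i b)"
      by (auto simp: only_def fun_eq_iff)
    ultimately show ?thesis
      using pd_add_right[of _ "only m x" "\<lambda>i b. t * only m y i b"] by (simp add: pd_scale_right)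
  next
    case False
    then have "omit_slot k ((v(a := z))(0 := (v(a := z)) k)) = (omit_slot k (v(0 := v k)))(a - 1 := z)" for z
      using a k by (auto simp: omit_slot_def fun_eq_iff)
    moreover have "linslot (a - 1 + 1) c" using lin[of a] a False by simp
    moreover have "0 < m" "m \<le> a - 1" using m a False by auto
    ultimately show ?thesis
      using linpart_linear[of "a - 1" c m] m a False by simp
  qed
  then show ?thesis
    unfolding linslot_def eq by (simp add: distrib_left sum.distrib sum_distrib_left mult.left_commute)
qed

subsection \<open>Exactness above the diagonal\<close>

lemma homog_bd: "homog n p \<Longrightarrow> homog n (bd K p)"
proof -
  assume h: "homog n p"
  have "cof j (\<lambda>i b. t * v i b) = (\<lambda>i b. t * cof j v i b)" for j t and v :: "nat \<Rightarrow> 'a \<Rightarrow> 'b"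
    by (auto simp: cof_def fun_eq_iff distrib_left)
  then show ?thesis
    using h unfolding homog_def pv_bd by (simp add: sum_distrib_left mult.left_commute del: sum.atMost_Suc)
qed

lemma homogD: "homog n p \<Longrightarrow> pv (\<lambda>i b. t * v i b) p = t ^ n * pv v p"
  by (simp add: homog_def)

lemma homog_simps: "homog n p \<Longrightarrow> homog n q \<Longrightarrow> homog n (p + q)" "homog n p \<Longrightarrow> homog n q \<Longrightarrow> homog n (p - q)"
  "homog n p \<Longrightarrow> homog n (Const c * p)" "homog n 0"
  unfolding homog_def[of n "p + q"] homog_def[of n "p - q"] homog_def[of n "Const c * p"] homog_def[of n 0] pv_hom pv_Const
  by (simp_all only: homogD distrib_left right_diff_distrib mult.left_commute mult_zero_right simp_thms)

lemma vars_sum_subset: "(\<And>x. x \<in> A \<Longrightarrow> vars (f x) \<subseteq> W) \<Longrightarrow> vars (sum f A) \<subseteq> W"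
  by (rule order_trans[OF vars_sum UN_least])

lemma vars_uminus [simp]: "vars (- p) = vars p"
  by (auto simp: vars_def in_keys_iff)

lemma vars_diff: "vars (p - q) \<subseteq> vars p \<union> vars q"
  using vars_add[of p "- q"] by simp

lemma vars_Const_mult: "vars (Const c * p) \<subseteq> vars p"
  using vars_mult[of "Const c" p] by simp

lemma vars_sign_mult: "vars ((- 1) ^ j * p) = vars p"
  by (cases "even j") auto

lemma vars_bd: "vars p \<subseteq> A \<times> {1..K} \<Longrightarrow> vars (bd K p) \<subseteq> A \<times> {1..K + 1}"
proof -
  assume p: "vars p \<subseteq> A \<times> {1..K}"
  have "vars ((- 1) ^ j * ssub (cofS j) p) \<subseteq> A \<times> {1..K + 1}" for j
    using vars_ssub[OF p, of "cofS j"] by (force simp: vars_sign_mult cofS_def split: if_splits)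
  then show ?thesis
    unfolding bd_def by (intro vars_sum_subset)
qed

lemma vars_pdv: "vars (pdv x p) \<subseteq> vars p"
proof
  fix y assume "y \<in> vars (pdv x p)"
  then obtain m where m: "m \<in> Poly_Mapping.keys (pdv x p)" "y \<in> Poly_Mapping.keys m" by (auto simp: vars_def)
  then have "m + Poly_Mapping.single x 1 \<in> Poly_Mapping.keys p"
    unfolding in_keys_iff[of m] lookup_pdv in_keys_iff[of "m + Poly_Mapping.single x 1"] by auto
  moreover have "y \<in> Poly_Mapping.keys (m + Poly_Mapping.single x 1)"
    using m(2) by (auto simp: in_keys_iff lookup_add)
  ultimately show "y \<in> vars p" by (auto simp: vars_def)
qed

lemma vars_der: "vars (der \<phi> p) \<subseteq> vars p \<union> (\<Union>x\<in>vars p. vars (\<phi> x))"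
proof -
  have "vars (\<phi> x * pdv x p) \<subseteq> vars p \<union> vars (\<phi> x)" for x
    using vars_mult[of "\<phi> x" "pdv x p"] vars_pdv[of x p] by blast
  then show ?thesis
    unfolding der_def by (intro vars_sum_subset) fast
qed

lemma vars_theta:
  assumes "vars c \<subseteq> A \<times> {1..K}" "k \<le> K" shows "vars (theta k c) \<subseteq> A \<times> {1..K - 1}"
proof -
  have "vars ((- 1) ^ m * ssub (slotS m i) (extr m c)) \<subseteq> A \<times> {1..K - 1}"
    if "m \<in> {1..<k}" "i \<in> {m..<k}" for m i
  proof -
    have "vars (extr m c) \<subseteq> A \<times> {0..K}"
      unfolding extr_def using vars_der[of "\<lambda>(b, s). if s = m then Var (b, 0) else 0" c] assms(1)
      by (fastforce split: if_splits)
    from vars_ssub[OF this, of "slotS m i"] show ?thesis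
      using that assms(2) by (force simp: vars_sign_mult slotS_def split: if_splits)
  qed
  then show ?thesis
    unfolding theta_def by (intro vars_sum_subset)
qed

context based_lie_algebra
begin

text \<open>The invariants in degree \<open>n\<close> of the \<open>k\<close>-th tensor power of the maximal ideal; that the degree
  in each slot is positive is expressed by the vanishing at zero vectors.\<close>
definition cochain :: "nat \<Rightarrow> nat \<Rightarrow> ('g, 'k) pol set"
  where "cochain k n = {p. vars p \<subseteq> B \<times> {1..k} \<and> homog n p \<and>
    (\<forall>s\<in>{1..k}. \<forall>v. v s = 0 \<longrightarrow> pv v p = 0) \<and> (\<forall>x. ad_act x p = 0)}"

lemma cochain_add: "p \<in> cochain k n \<Longrightarrow> q \<in> cochain k n \<Longrightarrow> p + q \<in> cochain k n"
  using vars_add[of p q] by (auto simp: cochain_def homog_simps pv_hom ad_act_simps)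

lemma cochain_diff: "p \<in> cochain k n \<Longrightarrow> q \<in> cochain k n \<Longrightarrow> p - q \<in> cochain k n"
  using vars_diff[of p q] by (auto simp: cochain_def homog_simps pv_hom ad_act_simps)

lemma cochain_Const_mult: "p \<in> cochain k n \<Longrightarrow> Const c * p \<in> cochain k n"
  using vars_Const_mult[of c p] by (auto simp: cochain_def homog_simps pv_hom ad_act_simps)

lemma cochain_0: "0 \<in> cochain k n"
  by (auto simp: cochain_def homog_simps pv_hom ad_act_simps)

lemma ad_act_sign: "ad_act x ((- 1) ^ j * p) = (- 1) ^ j * ad_act x p"
  by (cases "even j") (auto simp: ad_act_simps)

text \<open>If the vector in slot \<open>s\<close> is zero, the cofaces \<open>s - 1\<close> and \<open>s\<close> agree and the others vanish.\<close>
lemma cochain_bd: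
  assumes "p \<in> cochain k n" shows "bd k p \<in> cochain (k + 1) n"
proof -
  have p: "vars p \<subseteq> B \<times> {1..k}" "homog n p" "\<And>s v. s \<in> {1..k} \<Longrightarrow> v s = 0 \<Longrightarrow> pv v p = 0" "\<And>x. ad_act x p = 0"
    using assms by (auto simp: cochain_def)
  have "pv v (bd k p) = 0" if s: "s \<in> {1..k + 1}" "v s = 0" for s v
  proof -
    have eq: "cof (s - 1) v i = cof s v i" if "i \<in> {1..k}" for i
      using s that by (auto simp: cof_def)
    have eq': "pv (cof (s - 1) v) p = pv (cof s v) p"
      by (rule pv_cong[OF p(1)]) (rule eq)
    have zero: "pv (cof j v) p = 0" if "j \<le> k + 1" "j \<noteq> s" "j \<noteq> s - 1" for j
    proof (cases "j < s")
      case True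
      then show ?thesis using s that by (intro p(3)[of "s - 1"]) (auto simp: cof_def)
    next
      case False
      then show ?thesis using s that by (intro p(3)[of s]) (auto simp: cof_def)
    qed
    have "pv v (bd k p) = (\<Sum>j\<in>{s - 1, s}. (- 1) ^ j * pv (cof j v) p)"
      unfolding pv_bd by (rule sum.mono_neutral_right) (use s zero in auto)
    also have "\<dots> = 0" using s eq' by (cases s) auto
    finally show ?thesis .
  qed
  moreover have "ad_act x (bd k p) = 0" for x
    by (simp only: bd_def ad_act_simps(8) ad_act_sign ad_act_ssub p(4) ssub_simps mult_zero_right sum.neutral_const)
  ultimately show ?thesis
    using vars_bd[OF p(1)] homog_bd[OF p(2)] by (auto simp: cochain_def)
qed

lemma ad_act_extr: "ad_act x (extr m p) = extr m (ad_act x p)"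
proof -
  have lin: "extr m (lin s y) = (if s = m then lin 0 y else 0)" for s y
    by (simp add: extr_def lin_def der_sum der_Const_mult)
  show ?thesis
  proof (induction p rule: mpol_induct)
    case (Var v f)
    obtain a s where v: "v = (a, s)" by fastforce
    have "extr m (Var v) = (if s = m then Var (a, 0) else 0)" by (simp add: extr_def v)
    then show ?case
      using Var lin[of s "br x a"] by (auto simp: v ad_act_simps extr_def der_mult der_add algebra_simps)
  qed (simp_all add: ad_act_simps extr_def der_add)
qed

lemma cochain_theta:
  assumes "c \<in> cochain K n" "k \<le> K" shows "theta k c \<in> cochain (K - 1) n"
proof -
  have c: "vars c \<subseteq> B \<times> {1..K}" "homog n c" "\<And>s v. s \<in> {1..K} \<Longrightarrow> v s = 0 \<Longrightarrow> pv v c = 0" "\<And>x. ad_act x c = 0"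
    using assms by (auto simp: cochain_def)
  have "homog n (theta k c)"
    unfolding homog_def
  proof (intro allI)
    fix t :: 'k and v :: "nat \<Rightarrow> 'g \<Rightarrow> 'k"
    have "linpart m c ((\<lambda>i b. t * v i b)(0 := (\<lambda>b. t * v i b))) = t ^ n * linpart m c (v(0 := v i))" for m i
    proof -
      have "insert_zero m ((\<lambda>i b. t * v i b)(0 := (\<lambda>b. t * v i b))) = (\<lambda>j b. t * insert_zero m (v(0 := v i)) j b)"
        by (auto simp: insert_zero_def fun_eq_iff)
      moreover have "only m (\<lambda>b. t * v i b) = (\<lambda>j b. t * only m (v i) j b)"
        by (auto simp: only_def fun_eq_iff)
      ultimately show ?thesis using homog_pd[OF c(2)] by (simp add: linpart_def)
    qed
    then show "pv (\<lambda>i b. t * v i b) (theta k c) = t ^ n * pv v (theta k c)"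
      unfolding pv_theta[OF c(1)] by (simp add: sum_distrib_left mult.left_commute)
  qed
  moreover have "pv v (theta k c) = 0" if s: "s \<in> {1..K - 1}" "v s = 0" for s v
  proof -
    have "linpart m c (v(0 := v i)) = 0" if m: "m \<in> {1..<k}" for m i
    proof -
      define s' where "s' = (if s < m then s else s + 1)"
      have s': "s' \<in> {1..K}" "s' \<noteq> m" "insert_zero m (v(0 := v i)) s' = 0"
        using s by (auto simp: s'_def insert_zero_def)
      have "pd (insert_zero m (v(0 := v i))) (only m (v i)) c = coeff 0 1"
        by (rule pd_eq_coeff) (use s' in \<open>auto intro!: c(3)[OF s'(1)] simp: only_def fun_eq_iff\<close>)
      then show ?thesis by (simp add: linpart_def)
    qed
    then show ?thesis by (simp add: pv_theta[OF c(1)])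
  qed
  moreover have "ad_act x (theta k c) = 0" for x
  proof -
    show ?thesis
      by (simp only: theta_def ad_act_simps(8) ad_act_sign ad_act_ssub ad_act_extr c(4) ssub_simps extr_0
          mult_zero_right sum.neutral_const)
  qed
  ultimately show ?thesis using vars_theta[OF c(1) assms(2)] by (auto simp: cochain_def)
qed

text \<open>Induction on the number \<open>j\<close> of slots at the end in which the cocycle has been made linear; the
  divisor \<open>n - j\<close> of the correction is not zero because the degree \<open>n\<close> exceeds the number of slots.
  A cocycle that is linear in all \<open>K\<close> slots vanishes, as Euler's identity gives it the degrees \<open>K\<close>
  and \<open>n\<close>.\<close>
theorem cocycle_exact:
  assumes c: "c \<in> cochain K n" "bd K c = 0" and n: "K < n" and K: "1 \<le> K"
  shows "\<exists>e\<in>cochain (K - 1) n. bd (K - 1) e = c"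
proof -
  have "\<exists>e\<in>cochain (K - 1) n. \<forall>a\<in>{K - j + 1..K}. linslot a (c - bd (K - 1) e)" if "j \<le> K" for j
    using that
  proof (induction j)
    case 0
    then show ?case by (intro bexI[of _ 0]) (auto simp: cochain_0)
  next
    case (Suc j)
    then obtain e where e: "e \<in> cochain (K - 1) n" "\<And>a. a \<in> {K - j + 1..K} \<Longrightarrow> linslot a (c - bd (K - 1) e)"
      by auto
    define k where "k = K - j"
    define c' where "c' = c - bd (K - 1) e"
    define N where "N = n - (K - k)"
    have k: "1 \<le> k" "k \<le> K" and N: "N > 0" using Suc.prems n by (auto simp: k_def N_def)
    have c': "c' \<in> cochain K n"
      unfolding c'_def using cochain_diff[OF c(1)] cochain_bd[OF e(1)] K by simp
    have closed: "bd K c' = 0"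
      unfolding c'_def bd_simps c(2) using bd_bd[of "K - 1" e] K by simp
    have lin: "linslot a (Const (of_nat N) * c' - bd (K - 1) (theta k c'))" if "k \<le> a" "a \<le> K" for a
      unfolding N_def
      by (rule cocycle_step[OF _ closed _ k])
        (use c' n e(2) that in \<open>auto simp: cochain_def k_def c'_def\<close>)
    define e' where "e' = e + Const (1 / of_nat N) * theta k c'"
    have "e' \<in> cochain (K - 1) n"
      unfolding e'_def by (intro cochain_add e cochain_Const_mult cochain_theta c' k)
    moreover have "linslot a (c - bd (K - 1) e')" if "a \<in> {K - Suc j + 1..K}" for a
    proof -
      have "c - bd (K - 1) e' = Const (1 / of_nat N) * (Const (of_nat N) * c' - bd (K - 1) (theta k c'))"
      proof -
        have "Const (1 / of_nat N) * (Const (of_nat N) * c') = c'"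
          using N by (simp add: mult.assoc[symmetric] flip: Const_simps(4))
        then show ?thesis by (simp add: e'_def c'_def bd_simps right_diff_distrib)
      qed
      moreover have "linslot a (Const (of_nat N) * c' - bd (K - 1) (theta k c'))"
        using lin[of a] that Suc.prems by (auto simp: k_def)
      then have "linslot a (Const (1 / of_nat N) * (Const (of_nat N) * c' - bd (K - 1) (theta k c')))"
        unfolding linslot_def pv_hom(4) pv_Const by (auto simp only: distrib_left mult.left_commute)
      ultimately show ?thesis by simp
    qed
    ultimately show ?case by blast
  qed
  from this[of K] obtain e where e: "e \<in> cochain (K - 1) n" "\<And>a. a \<in> {1..K} \<Longrightarrow> linslot a (c - bd (K - 1) e)"
    by auto
  define c' where "c' = c - bd (K - 1) e"
  have c': "c' \<in> cochain K n"
    unfolding c'_def using cochain_diff[OF c(1)] cochain_bd[OF e(1)] K by simp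
  have "pv v c' = pv v 0" for v
  proof -
    have "of_nat n * pv v c' = (\<Sum>a = 1..K. pd v (only a (v a)) c')"
      using homog_euler[of n c' v] slot_euler[of c' B K v] c' by (simp add: cochain_def)
    also have "\<dots> = (\<Sum>a = 1..K. pv v c')"
      by (intro sum.cong refl linslot_euler) (use e(2) in \<open>auto simp: c'_def\<close>)
    finally have "(of_nat n - of_nat K) * pv v c' = 0" by (simp add: algebra_simps)
    then show ?thesis using n by (simp add: pv_hom)
  qed
  then have "c' = 0" by (rule pv_eqI)
  then show ?thesis using e(1) by (auto simp: c'_def intro!: bexI[of _ e])
qed

end

subsection \<open>Multidegrees\<close>

lemma vars_der_subset: "vars p \<subseteq> W \<Longrightarrow> (\<And>x. x \<in> vars p \<Longrightarrow> vars (\<phi> x) \<subseteq> W) \<Longrightarrow> vars (der \<phi> p) \<subseteq> W"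
  by (rule order_trans[OF vars_der]) (intro Un_least UN_least)

lemma pev_expand: "pev v p = (\<Sum>m\<in>Poly_Mapping.keys p. Poly_Mapping.lookup p m * mon v m)"
  by (simp add: pev_def mev_def)

definition restr :: "('v \<Rightarrow>\<^sub>0 nat) set \<Rightarrow> ('v, 'k::comm_ring_1) mpol \<Rightarrow> ('v, 'k) mpol"
  where "restr M p = (\<Sum>m\<in>Poly_Mapping.keys p \<inter> M. Poly_Mapping.single m (Poly_Mapping.lookup p m))"

lemma pev_restr: "pev v (restr M p) = (\<Sum>m\<in>Poly_Mapping.keys p \<inter> M. Poly_Mapping.lookup p m * mon v m)"
  unfolding restr_def pev_simps by (intro sum.cong refl) (simp add: pev_def mev_single[OF rhom_id])

lemma lookup_restr: "m \<in> M \<Longrightarrow> Poly_Mapping.lookup (restr M p) m = Poly_Mapping.lookup p m"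
proof -
  assume m: "m \<in> M"
  have "Poly_Mapping.lookup (restr M p) m =
      (\<Sum>m'\<in>Poly_Mapping.keys p \<inter> M. if m' = m then Poly_Mapping.lookup p m else 0)"
    unfolding restr_def lookup_sum by (intro sum.cong refl) (auto simp: lookup_single)
  then show ?thesis using m by (simp add: in_keys_iff)
qed

lemma mon_scale: "mon (\<lambda>x. t * v x) m = t ^ mdeg m * mon v (m :: 'v \<Rightarrow>\<^sub>0 nat)"
  by (simp add: mon_def mdeg_def power_mult_distrib prod.distrib power_sum)

text \<open>The values at \<open>t v\<close> form a polynomial in \<open>t\<close> whose coefficients are the values at \<open>v\<close> of the
  components of the various degrees. If it is a multiple of \<open>t ^ n\<close>, all components but the one of
  degree \<open>n\<close> have value \<open>0\<close> everywhere.\<close>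
lemma homog_iff: "homog n p \<longleftrightarrow> (\<forall>m\<in>Poly_Mapping.keys p. mdeg m = n)"
proof
  assume "\<forall>m\<in>Poly_Mapping.keys p. mdeg m = n"
  then have "pev (\<lambda>x. t * v x) p = t ^ n * pev v p" for t v
    by (simp add: pev_expand mon_scale sum_distrib_left mult.left_commute)
  then show "homog n p"
    unfolding homog_def pv_def by (simp add: case_prod_unfold)
next
  assume h: "homog n p"
  have h': "pev (\<lambda>x. t * v x) p = t ^ n * pev v p" for t v
    using h[unfolded homog_def, rule_format, of t "\<lambda>i b. v (b, i)"] by (simp add: pv_def case_prod_unfold)
  show "\<forall>m\<in>Poly_Mapping.keys p. mdeg m = n"
  proof (rule ballI, rule ccontr)
    fix m assume m: "m \<in> Poly_Mapping.keys p" "mdeg m \<noteq> n"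
    have "pev v (restr {m'. mdeg m' = mdeg m} p) = 0" for v
    proof -
      have "(\<Sum>m'\<in>Poly_Mapping.keys p. monom (Poly_Mapping.lookup p m' * mon v m') (mdeg m')) = monom (pev v p) n"
        by (rule poly_eq_all) (use h'[of _ v] in
          \<open>simp add: poly_sum poly_monom pev_expand[of "\<lambda>x. _ * v x"] mon_scale mult_ac\<close>)
      then have "coeff (\<Sum>m'\<in>Poly_Mapping.keys p. monom (Poly_Mapping.lookup p m' * mon v m') (mdeg m')) (mdeg m) = 0"
        using m(2) by simp
      then have "(\<Sum>m'\<in>Poly_Mapping.keys p. if mdeg m' = mdeg m then Poly_Mapping.lookup p m' * mon v m' else 0) = 0"
        by (simp add: coeff_sum)
      then show ?thesis
        by (simp add: pev_restr sum.inter_restrict)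
    qed
    then have "restr {m'. mdeg m' = mdeg m} p = 0" by (rule pev_zero_imp_zero)
    then show False using lookup_restr[of m "{m'. mdeg m' = mdeg m}" p] m by (simp add: in_keys_iff)
  qed
qed

lemma slot_deg_pos_iff: "slot_deg s m \<ge> 1 \<longleftrightarrow> (\<exists>x\<in>Poly_Mapping.keys m. snd x = s)"
proof -
  have "slot_deg s m = 0 \<longleftrightarrow> \<not> (\<exists>x\<in>Poly_Mapping.keys m. snd x = s)"
    unfolding slot_deg_def by (subst sum_eq_0_iff) (simp, metis (mono_tags, lifting) in_keys_iff mem_Collect_eq)
  moreover have "slot_deg s m \<ge> 1 \<longleftrightarrow> slot_deg s m \<noteq> 0" by linarith
  ultimately show ?thesis by (simp only: not_not)
qed

text \<open>Setting the vector in slot \<open>s\<close> to zero retains exactly the monomials that do not involve slot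
  \<open>s\<close>.\<close>
lemma slot_positive_iff:
  "(\<forall>m\<in>Poly_Mapping.keys p. slot_deg s m \<ge> 1) \<longleftrightarrow> (\<forall>v. v s = 0 \<longrightarrow> pv v p = 0)"
proof
  assume pos: "\<forall>m\<in>Poly_Mapping.keys p. slot_deg s m \<ge> 1"
  show "\<forall>v. v s = 0 \<longrightarrow> pv v p = 0"
  proof (intro allI impI)
    fix v :: "nat \<Rightarrow> 'a \<Rightarrow> 'b" assume v: "v s = 0"
    have "mon (\<lambda>(b, i). v i b) m = 0" if "m \<in> Poly_Mapping.keys p" for m
    proof -
      have "\<exists>x\<in>Poly_Mapping.keys m. snd x = s"
        using pos that slot_deg_pos_iff by blast
      then obtain b where "(b, s) \<in> Poly_Mapping.keys m" by auto
      then have "\<exists>x\<in>Poly_Mapping.keys m. (case x of (b, i) \<Rightarrow> v i b) ^ Poly_Mapping.lookup m x = 0"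
        by (rule bexI[rotated]) (use v \<open>(b, s) \<in> Poly_Mapping.keys m\<close> in \<open>simp add: in_keys_iff\<close>)
      then show ?thesis
        unfolding mon_def by (intro prod_zero) simp_all
    qed
    then show "pv v p = 0" by (simp add: pv_def pev_expand)
  qed
next
  assume z: "\<forall>v. v s = 0 \<longrightarrow> pv v p = 0"
  show "\<forall>m\<in>Poly_Mapping.keys p. slot_deg s m \<ge> 1"
  proof (rule ballI, rule ccontr)
    fix m assume m: "m \<in> Poly_Mapping.keys p" "\<not> slot_deg s m \<ge> 1"
    define M :: "('a \<times> nat \<Rightarrow>\<^sub>0 nat) set" where "M = {m. \<forall>x\<in>Poly_Mapping.keys m. snd x \<noteq> s}"
    have "pev w (restr M p) = 0" for w
    proof -
      define w' where "w' = (\<lambda>x. if snd x = s then 0 else w x)"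
      have "mon w' m = 0" if "m \<notin> M" for m
        using that unfolding M_def mon_def w'_def by (intro prod_zero) (auto simp: in_keys_iff)
      moreover have "mon w' m = mon w m" if "m \<in> M" for m
        using that unfolding M_def mon_def w'_def by (intro prod.cong) auto
      moreover have "pv (\<lambda>i b. w' (b, i)) p = 0"
        by (rule z[rule_format]) (simp add: w'_def zero_fun_def)
      then have "pev w' p = 0" by (simp add: pv_def)
      moreover have "pev w' p = (\<Sum>m\<in>Poly_Mapping.keys p \<inter> M. Poly_Mapping.lookup p m * mon w' m)"
        unfolding pev_expand by (rule sum.mono_neutral_right) (use calculation(1) in auto)
      ultimately show ?thesis by (simp add: pev_restr)
    qed
    then have "restr M p = 0" by (rule pev_zero_imp_zero)
    moreover have "m \<in> M" using m(2) slot_deg_pos_iff by (auto simp: M_def)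
    ultimately show False using lookup_restr[of m "M" p] m by (simp add: in_keys_iff)
  qed
qed

lemma mdeg_eq_sum_slot_deg:
  assumes "Poly_Mapping.keys m \<subseteq> A \<times> {1..k}"
  shows "mdeg m = (\<Sum>s = 1..k. slot_deg s m)"
proof -
  have "(\<Sum>s = 1..k. slot_deg s m) = (\<Sum>s\<in>{1..k}. \<Sum>x\<in>{x \<in> Poly_Mapping.keys m. snd x = s}. Poly_Mapping.lookup m x)"
    by (simp add: slot_deg_def)
  also have "\<dots> = mdeg m"
    unfolding mdeg_def by (rule sum.group) (use assms in auto)
  finally show ?thesis by simp
qed

lemma linslot_if_slot_deg_1:
  assumes "\<forall>m\<in>Poly_Mapping.keys p. slot_deg a m = 1" shows "linslot a p"
proof -
  have "mon (\<lambda>(b, i). (v(a := (\<lambda>b. x b + t * y b))) i b) m =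
      mon (\<lambda>(b, i). (v(a := x)) i b) m + t * mon (\<lambda>(b, i). (v(a := y)) i b) m"
    if m: "slot_deg a m = 1" for m and v and x y :: "'a \<Rightarrow> 'b" and t
  proof -
    obtain z where z: "z \<in> Poly_Mapping.keys m" "snd z = a"
      using slot_deg_pos_iff[of a m] m by auto
    obtain b where b: "z = (b, a)" using z(2) by (cases z) auto
    define X where "X = {x \<in> Poly_Mapping.keys m. snd x = a}"
    have fin: "finite X" "z \<in> X" using z by (auto simp: X_def)
    have sum: "(\<Sum>x\<in>X. Poly_Mapping.lookup m x) = 1" using m by (simp add: slot_deg_def X_def)
    have "Poly_Mapping.lookup m z + (\<Sum>x\<in>X - {z}. Poly_Mapping.lookup m x) = 1"
      using sum fin by (simp add: sum.remove)
    moreover have "Poly_Mapping.lookup m z > 0" using z(1) by (simp add: in_keys_iff)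
    ultimately have lz: "Poly_Mapping.lookup m z = 1" and "(\<Sum>x\<in>X - {z}. Poly_Mapping.lookup m x) = 0" by auto
    then have 0: "\<forall>x\<in>X - {z}. Poly_Mapping.lookup m x = 0"
      using fin by (subst (asm) sum_eq_0_iff) auto
    have X: "X = {z}"
    proof -
      have "x = z" if "x \<in> X" for x
      proof -
        have "Poly_Mapping.lookup m x \<noteq> 0" using that by (simp add: X_def in_keys_iff)
        then show ?thesis using 0 that by (metis DiffI singletonD)
      qed
      then show ?thesis using fin by blast
    qed
    have split: "mon \<theta> m = \<theta> z * (\<Prod>x\<in>Poly_Mapping.keys m - {z}. \<theta> x ^ Poly_Mapping.lookup m x)" for \<theta> :: "'a \<times> nat \<Rightarrow> 'b"
      unfolding mon_def using z(1) lz by (simp add: prod.remove)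
    have rest: "(\<Prod>x\<in>Poly_Mapping.keys m - {z}. (case x of (b, i) \<Rightarrow> (v(a := w)) i b) ^ Poly_Mapping.lookup m x) =
      (\<Prod>x\<in>Poly_Mapping.keys m - {z}. (case x of (b, i) \<Rightarrow> v i b) ^ Poly_Mapping.lookup m x)" for w
    proof (intro prod.cong refl)
      fix x assume "x \<in> Poly_Mapping.keys m - {z}"
      then have "snd x \<noteq> a" using X by (auto simp: X_def)
      then show "(case x of (b, i) \<Rightarrow> (v(a := w)) i b) ^ Poly_Mapping.lookup m x =
          (case x of (b, i) \<Rightarrow> v i b) ^ Poly_Mapping.lookup m x"
        by (cases x) auto
    qed
    show ?thesis unfolding split rest by (simp add: b algebra_simps)
  qed
  then show ?thesis
    unfolding linslot_def pv_def pev_expand using assms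
    by (simp add: sum.distrib[symmetric] sum_distrib_left distrib_left mult.left_commute)
qed

lemma homog_mult: "homog i p \<Longrightarrow> homog j q \<Longrightarrow> homog (i + j) (p * q)"
  unfolding homog_def pv_hom(4) by (simp add: power_add mult_ac)

lemma homog_sum: "(\<And>x. x \<in> X \<Longrightarrow> homog n (f x)) \<Longrightarrow> homog n (sum f X)"
  by (induction X rule: infinite_finite_induct) (auto simp: homog_simps)

lemma homog_der:
  assumes "homog i p" "\<And>x. x \<in> vars p \<Longrightarrow> homog j (\<phi> x)" shows "homog (i + j - 1) (der \<phi> p)"
  unfolding der_def
proof (rule homog_sum)
  fix x assume x: "x \<in> vars p"
  then obtain m where m: "m \<in> Poly_Mapping.keys p" "x \<in> Poly_Mapping.keys m" by (auto simp: vars_def)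
  then have i: "i \<ge> 1"
    using assms(1) unfolding homog_iff mdeg_def
    by (metis One_nat_def Suc_leI finite_keys in_keys_iff not_gr_zero sum_eq_0_iff)
  have "homog (i - 1) (pdv x p)"
    unfolding homog_iff
  proof
    fix m assume "m \<in> Poly_Mapping.keys (pdv x p)"
    then have "m + Poly_Mapping.single x 1 \<in> Poly_Mapping.keys p"
      unfolding in_keys_iff[of m] lookup_pdv in_keys_iff[of "m + Poly_Mapping.single x 1"] by auto
    then have "mdeg m + 1 = i" using assms(1) unfolding homog_iff by (metis mdeg_simps(2,3))
    then show "mdeg m = i - 1" by simp
  qed
  from homog_mult[OF assms(2)[OF x] this] i show "homog (i + j - 1) (\<phi> x * pdv x p)"
    by (simp add: add.commute)
qed

context based_lie_algebra
begin

lemma Sym_iff: "p \<in> Sym k n \<longleftrightarrow> vars p \<subseteq> B \<times> {1..k} \<and> homog n p"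
  by (auto simp: Sym_def homog_iff in_vars_iff)

lemma max_tensor_invariants_iff: "f \<in> max_tensor k \<inter> invariants \<longleftrightarrow> (\<forall>n. f n \<in> cochain k n)"
proof -
  have "(\<forall>m\<in>Poly_Mapping.keys p. \<forall>s\<in>{1..k}. slot_deg s m \<ge> 1) \<longleftrightarrow> (\<forall>s\<in>{1..k}. \<forall>v. v s = 0 \<longrightarrow> pv v p = 0)" for p
    using slot_positive_iff[of p] by blast
  then show ?thesis
    by (auto simp: max_tensor_def formal_fun_def invariants_def cochain_def Sym_iff)
qed

lemma cochain_low:
  assumes "p \<in> cochain k n" "n < k" shows "p = 0"
proof -
  have False if m: "m \<in> Poly_Mapping.keys p" for m
  proof -
    have "\<forall>m\<in>Poly_Mapping.keys p. slot_deg s m \<ge> 1" if "s \<in> {1..k}" for s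
      using assms(1) that unfolding slot_positive_iff by (auto simp: cochain_def)
    then have "(\<Sum>s = 1..k. slot_deg s m) \<ge> (\<Sum>s = 1..k. 1)"
      using m by (intro sum_mono) auto
    moreover have "mdeg m = (\<Sum>s = 1..k. slot_deg s m)"
      by (rule mdeg_eq_sum_slot_deg[where A = B]) (use assms(1) m in \<open>auto simp: cochain_def in_vars_iff\<close>)
    moreover have "mdeg m = n" using assms(1) m by (auto simp: cochain_def homog_iff)
    ultimately show False using assms(2) by simp
  qed
  then show ?thesis by (metis all_not_in_conv keys_eq_empty)
qed

lemma cochain_diagonal_slot_deg:
  assumes "p \<in> cochain k k" "m \<in> Poly_Mapping.keys p" "s \<in> {1..k}" shows "slot_deg s m = 1"
proof -
  have pos: "slot_deg s m \<ge> 1" if "s \<in> {1..k}" for s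
    using assms(1,2) that slot_positive_iff[of p s] by (auto simp: cochain_def)
  have "mdeg m = (\<Sum>s = 1..k. slot_deg s m)"
    by (rule mdeg_eq_sum_slot_deg[where A = B]) (use assms in \<open>auto simp: cochain_def in_vars_iff\<close>)
  moreover have "mdeg m = k" using assms by (auto simp: cochain_def homog_iff)
  moreover have "(\<Sum>s\<in>{1..k}. slot_deg s m) = slot_deg s m + (\<Sum>s\<in>{1..k} - {s}. slot_deg s m)"
    using assms(3) by (simp add: sum.remove)
  moreover have "(\<Sum>s\<in>{1..k} - {s}. slot_deg s m) \<ge> (\<Sum>s\<in>{1..k} - {s}. 1)"
    by (intro sum_mono pos) auto
  ultimately show ?thesis using pos[OF assms(3)] assms(3) by simp
qed

text \<open>In contrast to \<open>cochain\<close> a slot may have degree zero, as is the case after an insertion that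
  leaves it empty.\<close>
definition inv_sym :: "nat \<Rightarrow> nat \<Rightarrow> ('g, 'k) pol set"
  where "inv_sym k n = {p. vars p \<subseteq> B \<times> {1..k} \<and> homog n p \<and> (\<forall>x. ad_act x p = 0)}"

lemma graded_sub_inv_sym: "graded_sub (inv_sym k)"
  unfolding graded_sub_def
proof (intro conjI allI impI)
  fix i j p q assume p: "p \<in> inv_sym k i" and q: "q \<in> inv_sym k j"
  have \<Gamma>: "homog 1 (\<Gamma> v w)" "vars (\<Gamma> v w) \<subseteq> B \<times> {snd v}" for v w
  proof -
    have "homog 1 (lin s x)" for s x
    proof -
      have "homog 1 (Var v :: ('g, 'k) pol)" for v by (simp add: homog_iff Var_def)
      then show ?thesis unfolding lin_def by (intro homog_sum homog_simps)
    qed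
    then show "homog 1 (\<Gamma> v w)" by (simp add: \<Gamma>_def homog_simps)
    show "vars (\<Gamma> v w) \<subseteq> B \<times> {snd v}" using vars_lin by (simp add: \<Gamma>_def)
  qed
  have "homog (i + j - 1) (poisson_pol p q)"
    unfolding poisson_pol_eq_der
    by (rule homog_der) (use p q homog_der[of j q 1, OF _ \<Gamma>(1)] in \<open>auto simp: inv_sym_def\<close>)
  moreover have "vars (poisson_pol p q) \<subseteq> B \<times> {1..k}"
  proof -
    have W: "vars p \<subseteq> B \<times> {1..k}" "vars q \<subseteq> B \<times> {1..k}" using p q by (auto simp: inv_sym_def)
    have "B \<times> {snd x} \<subseteq> B \<times> {1..k}" if "x \<in> vars p" for x
      using W(1) that by auto
    then have "vars (der (\<Gamma> x) q) \<subseteq> B \<times> {1..k}" if "x \<in> vars p" for x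
      using that by (intro vars_der_subset W order_trans[OF \<Gamma>(2)])
    then show ?thesis
      unfolding poisson_pol_eq_der by (rule vars_der_subset[OF W(1)])
  qed
  ultimately show "poisson_pol p q \<in> inv_sym k (i + j - 1)"
    using p q by (simp add: inv_sym_def ad_act_pp pp_simps)
next
  fix n p q assume "p \<in> inv_sym k n" "q \<in> inv_sym k n"
  then show "p + q \<in> inv_sym k n"
    using vars_add[of p q] by (auto simp: inv_sym_def homog_simps ad_act_simps)
next
  fix n c p assume "p \<in> inv_sym k n"
  then show "Const c * p \<in> inv_sym k n"
    using vars_Const_mult[of c p] by (auto simp: inv_sym_def homog_simps ad_act_simps)
qed (auto simp: inv_sym_def homog_simps ad_act_simps)

subsection \<open>The diagonal degree of the third cohomology\<close>

lemma cochain_ssub: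
  assumes p: "p \<in> cochain k n" and S: "\<And>i. i \<in> {1..k} \<Longrightarrow> S i \<subseteq> {1..l}"
    and cover: "\<And>s. s \<in> {1..l} \<Longrightarrow> \<exists>i\<in>{1..k}. S i = {s}"
  shows "ssub S p \<in> cochain l n"
proof -
  have "vars (ssub S p) \<subseteq> B \<times> {1..l}"
  proof (rule order_trans[OF vars_ssub])
    show "vars p \<subseteq> B \<times> {1..k}" using p by (simp add: cochain_def)
    show "B \<times> (\<Union>i\<in>{1..k}. S i) \<subseteq> B \<times> {1..l}" using S by (intro Sigma_mono UN_least) auto
  qed
  moreover have "homog n (ssub S p)"
  proof -
    have "(\<lambda>i. \<Sum>r\<in>S i. (\<lambda>b. t * v r b)) = (\<lambda>i b. t * (\<Sum>r\<in>S i. v r) b)" for t and v :: "nat \<Rightarrow> 'g \<Rightarrow> 'k"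
      by (auto simp: fun_eq_iff sum_fun_apply sum_distrib_left)
    then show ?thesis using p by (simp add: homog_def pv_ssub cochain_def)
  qed
  moreover have "pv v (ssub S p) = 0" if "s \<in> {1..l}" "v s = 0" for s v
  proof -
    obtain i where "i \<in> {1..k}" "S i = {s}" using cover[OF \<open>s \<in> {1..l}\<close>] by blast
    then show ?thesis using p that by (auto simp: cochain_def pv_ssub)
  qed
  moreover have "ad_act x (ssub S p) = 0" for x
    using p by (simp add: ad_act_ssub cochain_def ssub_simps)
  ultimately show ?thesis by (auto simp: cochain_def)
qed

lemma cochain_3_3_trilinear:
  assumes c: "c \<in> cochain 3 3"
  obtains F where "\<And>v. pv v c = F (v 1) (v 2) (v 3)"
    "\<And>x x' y z. F (x + x') y z = F x y z + F x' y z"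
    "\<And>x y y' z. F x (y + y') z = F x y z + F x y' z"
    "\<And>x y z z'. F x y (z + z') = F x y z + F x y z'"
proof -
  define F where "F x y z = pv ((\<lambda>_. 0)(1 := x, 2 := y, 3 := z)) c" for x y z
  have vars: "vars c \<subseteq> B \<times> {1..3}" using c by (simp add: cochain_def)
  have pvF: "pv v c = F (v 1) (v 2) (v 3)" for v
    unfolding F_def by (rule pv_cong[OF vars]) (auto simp: numeral_3_eq_3 numeral_2_eq_2 le_Suc_eq)
  have lin: "linslot a c" if "a \<in> {1..3}" for a
    by (rule linslot_if_slot_deg_1) (use cochain_diagonal_slot_deg[OF c _ that] in blast)
  have *: "pv (v(a := x + x')) c = pv (v(a := x)) c + pv (v(a := x')) c" if "a \<in> {1..3}" for v a x x'
    using lin[OF that, unfolded linslot_def, rule_format, of v x 1 x'] by (simp add: plus_fun_def)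
  show ?thesis
  proof (rule that)
    show "pv v c = F (v 1) (v 2) (v 3)" for v by (rule pvF)
    show "F (x + x') y z = F x y z + F x' y z" for x x' y z
      using *[of 1 "(\<lambda>_. 0)(1 := x, 2 := y, 3 := z)" x x'] by (simp add: F_def fun_upd_twist)
    show "F x (y + y') z = F x y z + F x y' z" for x y y' z
      using *[of 2 "(\<lambda>_. 0)(1 := x, 2 := y, 3 := z)" y y'] by (simp add: F_def fun_upd_twist)
    show "F x y (z + z') = F x y z + F x y z'" for x y z z'
      using *[of 3 "(\<lambda>_. 0)(1 := x, 2 := y, 3 := z)" z z'] by (simp add: F_def)
  qed
qed

text \<open>For a trilinear form \<open>c\<close> the coboundaries of \<open>c(x, x, y)\<close> and \<open>c(x, y, y)\<close> are, up to sign, the sums of \<open>c\<close>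
  and its composition with an adjacent transposition; these span the kernel of antisymmetrization.\<close>
lemma alt_zero_exact:
  assumes c: "c \<in> cochain 3 3" and alt: "Alt q c = 0" and q: "q \<noteq> 0"
  shows "\<exists>e\<in>cochain 2 3. bd 2 e = c"
proof -
  obtain F where pvF: "\<And>v. pv v c = F (v 1) (v 2) (v 3)"
    and add: "\<And>x x' y z. F (x + x') y z = F x y z + F x' y z"
    "\<And>x y y' z. F x (y + y') z = F x y z + F x y' z"
    "\<And>x y z z'. F x y (z + z') = F x y z + F x y z'"
    using cochain_3_3_trilinear[OF c] by blast
  have perms: "(\<Sum>\<tau> | \<tau> permutes {1, 2, 3 :: nat}. h \<tau>) =
     h id + h (transpose 2 3) + h (transpose 1 2) + h (transpose 1 2 \<circ> transpose 2 3)
     + h (transpose 1 3) + h (transpose 1 3 \<circ> transpose 2 3)" for h :: "(nat \<Rightarrow> nat) \<Rightarrow> 'k"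
  proof -
    have "(\<Sum>\<tau> | \<tau> permutes {3 :: nat}. h \<tau>) = h id" for h :: "(nat \<Rightarrow> nat) \<Rightarrow> 'k"
      using sum_over_permutations_insert[of "{}" 3 h] by simp
    then have "(\<Sum>\<tau> | \<tau> permutes {2, 3 :: nat}. h \<tau>) = h id + h (transpose 2 3)" for h :: "(nat \<Rightarrow> nat) \<Rightarrow> 'k"
      using sum_over_permutations_insert[of "{3}" 2 h] by (simp add: o_def id_def)
    then show ?thesis
      using sum_over_permutations_insert[of "{2, 3}" 1 h] by (simp add: add_ac o_def id_def)
  qed
  have alt': "F x y z - F x z y - F y x z + F y z x - F z y x + F z x y = 0" for x y z
  proof -
    define v :: "nat \<Rightarrow> 'g \<Rightarrow> 'k" where "v = (\<lambda>_. 0)(1 := x, 2 := y, 3 := z)"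
    have "0 = pv v (Alt q c)" using alt by (simp add: pv_hom)
    also have "\<dots> = of_rat q * (\<Sum>\<tau> | \<tau> permutes {1, 2, 3}. of_int (sign \<tau>) * F (v (\<tau> 1)) (v (\<tau> 2)) (v (\<tau> 3)))"
      by (simp add: Alt_def pv_hom pv_Const ins_pol_eq_ssub pv_ssub pvF numeral_2_eq_2)
    finally have "(\<Sum>\<tau> | \<tau> permutes {1, 2, 3}. of_int (sign \<tau>) * F (v (\<tau> 1)) (v (\<tau> 2)) (v (\<tau> 3))) = 0"
      using q by simp
    then show ?thesis
      unfolding perms by (simp add: sign_compose permutation_swap_id sign_swap_id v_def transpose_def algebra_simps)
  qed
  define sl where "sl a b d = (\<lambda>i::nat. if i = 1 then {a} else if i = 2 then {b} else {d :: nat})" for a b d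
  have pvsl: "pv v (ssub (sl a b d) c) = F (v a) (v b) (v d)" for a b d v
    by (simp add: pv_ssub pvF sl_def)
  have in2: "ssub (sl a b d) c \<in> cochain 2 3"
    if "{a, b, d} = {1, 2}" for a b d
  proof (rule cochain_ssub[OF c])
    show "\<exists>i\<in>{1..3}. sl a b d i = {s}" if "s \<in> {1..2}" for s
    proof -
      have "s \<in> {1, 2}" using \<open>s \<in> {1..2}\<close> by auto
      then have "s \<in> {a, b, d}" by (simp only: \<open>{a, b, d} = {1, 2}\<close>)
      then have "sl a b d 1 = {s} \<or> sl a b d 2 = {s} \<or> sl a b d 3 = {s}" by (auto simp: sl_def)
      then show ?thesis
      proof (elim disjE)
        assume "sl a b d 1 = {s}" then show ?thesis by (intro bexI[of _ 1]) auto
      next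
        assume "sl a b d 2 = {s}" then show ?thesis by (intro bexI[of _ 2]) auto
      next
        assume "sl a b d 3 = {s}" then show ?thesis by (intro bexI[of _ 3]) auto
      qed
    qed
    show "sl a b d i \<subseteq> {1..2}" for i
    proof -
      have "sl a b d i \<subseteq> {a, b, d}" by (simp add: sl_def)
      also have "{a, b, d} \<subseteq> {1..2}" unfolding that by simp
      finally show ?thesis .
    qed
  qed
  \<comment> \<open>The coefficients solve the linear system that makes \<open>bd 2 e\<close> equal to \<open>c\<close> minus one sixth of
    the signed sum over its permutations.\<close>
  define e where "e = Const (1 / 6) * (Const (- 3) * ssub (sl 1 1 2) c + Const 2 * ssub (sl 1 2 2) c
     + Const (- 2) * ssub (sl 2 1 2) c + ssub (sl 1 2 1) c + Const (- 1) * ssub (sl 2 1 1) c)"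
  have "e \<in> cochain 2 3"
    unfolding e_def by (intro cochain_Const_mult cochain_add in2) auto
  moreover have "bd 2 e = c"
  proof (rule pv_eqI)
    fix v
    have e: "pv v e = (1 / 6) * (- 3 * F (v 1) (v 1) (v 2) + 2 * F (v 1) (v 2) (v 2) - 2 * F (v 2) (v 1) (v 2)
        + F (v 1) (v 2) (v 1) - F (v 2) (v 1) (v 1))" for v
      by (simp add: e_def pv_hom pv_Const pvsl del: Const_simps)
    have "pv v (bd 2 e) = pv (cof 0 v) e - pv (cof 1 v) e + pv (cof 2 v) e - pv (cof 3 v) e"
      by (simp add: pv_bd numeral_2_eq_2 numeral_3_eq_3)
    also have "\<dots> = F (v 1) (v 2) (v 3) - (1 / 6) * (F (v 1) (v 2) (v 3) - F (v 1) (v 3) (v 2)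
        - F (v 2) (v 1) (v 3) + F (v 2) (v 3) (v 1) - F (v 3) (v 2) (v 1) + F (v 3) (v 1) (v 2))"
    proof -
      have "cof 0 v 1 = v 2" "cof 0 v 2 = v 3" "cof 1 v 1 = v 1 + v 2" "cof 1 v 2 = v 3"
        "cof 2 v 1 = v 1" "cof 2 v 2 = v 2 + v 3" "cof 3 v 1 = v 1" "cof 3 v 2 = v 2"
        by (simp_all add: cof_def numeral_2_eq_2 numeral_3_eq_3)
      then show ?thesis unfolding e by (simp add: add field_simps)
    qed
    also have "\<dots> = F (v 1) (v 2) (v 3)"
      using alt'[of "v 1" "v 2" "v 3"] by simp
    finally show "pv v (bd 2 e) = pv v c" by (simp add: pvF)
  qed
  ultimately show ?thesis by blast
qed

end

section \<open>Insertion of invariant series\<close>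

text \<open>Insertion by \<open>P\<close> followed by insertion by \<open>Q\<close> is insertion by \<open>comp_slots Q P\<close>.\<close>
definition comp_slots :: "nat set list \<Rightarrow> nat set list \<Rightarrow> nat set list"
  where "comp_slots Q P = map (\<lambda>S. \<Union>j\<in>S. Q ! (j - 1)) P"

definition slots :: "nat \<Rightarrow> nat set list \<Rightarrow> bool"
  where "slots l P \<longleftrightarrow> (\<forall>S\<in>set P. S \<subseteq> {1..l}) \<and> sorted_wrt (\<lambda>S T. S \<inter> T = {}) P"

lemma slots_nth:
  assumes "slots l P" "length P = k" "i \<in> {1..k}" shows "P ! (i - 1) \<subseteq> {1..l}" "finite (P ! (i - 1))" "P ! (i - 1) \<in> set P"
proof -
  show *: "P ! (i - 1) \<in> set P" using assms by (intro nth_mem) auto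
  with assms(1) show "P ! (i - 1) \<subseteq> {1..l}" by (auto simp: slots_def)
  then show "finite (P ! (i - 1))" by (rule finite_subset) simp
qed

lemma slots_disjoint:
  assumes "slots l P" "length P = k" "i \<in> {1..k}" "j \<in> {1..k}" "i \<noteq> j" shows "P ! (i - 1) \<inter> P ! (j - 1) = {}"
proof -
  have "P ! a \<inter> P ! b = {}" if "a < b" "b < length P" for a b
    using assms(1) that by (auto simp: slots_def sorted_wrt_iff_nth_less)
  from this[of "i - 1" "j - 1"] this[of "j - 1" "i - 1"] assms(2-5) show ?thesis
    by (cases "i < j") (auto simp: Int_commute)
qed

lemma homog_ssub: "homog n p \<Longrightarrow> homog n (ssub S p)"
proof -
  assume h: "homog n p"
  have "(\<lambda>i. \<Sum>r\<in>S i. (\<lambda>b. t * v r b)) = (\<lambda>i b. t * (\<Sum>r\<in>S i. v r) b)" for t and v :: "nat \<Rightarrow> 'a \<Rightarrow> 'b"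
    by (auto simp: fun_eq_iff sum_fun_apply sum_distrib_left)
  then show ?thesis using h by (simp add: homog_def pv_ssub)
qed

text \<open>The leading coefficient of a small factor of a product does not depend on its position.\<close>
lemma insert_small:
  fixes u s w :: "'r::ring_1 fps"
  assumes u: "u $ 0 = 1" and w: "w $ 0 = 1" and s: "s $ 0 = 1" "\<And>i. 0 < i \<Longrightarrow> i < N \<Longrightarrow> s $ i = 0" and N: "N > 0"
  shows "(u * s * w) $ N = (u * w) $ N + s $ N"
proof -
  define h where "h = s - 1"
  have h: "h $ i = 0" if "i < N" for i using s that by (cases "i = 0") (auto simp: h_def)
  have uh: "(u * h) $ i = (if i = N then h $ N else 0)" if "i \<le> N" for i
  proof -
    have "(u * h) $ i = (\<Sum>j = 0..i. if j = 0 then h $ i else 0)"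
      unfolding fps_mult_nth by (intro sum.cong refl) (use u h that in auto)
    then show ?thesis using h that by auto
  qed
  have "(u * h * w) $ N = (\<Sum>j = 0..N. if j = N then h $ N else 0)"
    unfolding fps_mult_nth[of "u * h"] by (intro sum.cong refl) (use uh w in auto)
  then have "(u * h * w) $ N = s $ N" using N by (simp add: h_def)
  moreover have "u * s * w = u * w + u * h * w" by (simp add: h_def algebra_simps)
  ultimately show ?thesis by simp
qed

context based_lie_algebra
begin

definition inv_series :: "nat \<Rightarrow> ('g, 'k) ser set"
  where "inv_series k = {f. (\<forall>n. f n \<in> inv_sym k n) \<and> low f}"

definition cochains :: "nat \<Rightarrow> ('g, 'k) ser set"
  where "cochains k = {f. \<forall>n. f n \<in> cochain k n}"

lemma cochains_inv_series:
  assumes "f \<in> cochains k" "k \<ge> 2" shows "f \<in> inv_series k"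
proof -
  have "f 0 = 0" "f 1 = 0" using assms cochain_low[of "f 0" k 0] cochain_low[of "f 1" k 1] by (auto simp: cochains_def)
  then show ?thesis using assms by (auto simp: inv_series_def cochains_def cochain_def inv_sym_def low_def)
qed

lemma inv_series_low: "f \<in> inv_series k \<Longrightarrow> low f"
  by (simp add: inv_series_def)

lemma ins_inv_series:
  assumes "f \<in> inv_series k" "length P = k" "slots l P" shows "ins P f \<in> inv_series l"
proof -
  have "ins_pol P p \<in> inv_sym l n" if p: "p \<in> inv_sym k n" for p n
  proof -
    have "vars (ins_pol P p) \<subseteq> B \<times> {1..l}"
      unfolding ins_pol_eq_ssub
    proof (rule order_trans[OF vars_ssub])
      show "vars p \<subseteq> B \<times> {1..k}" using p by (simp add: inv_sym_def)
      show "B \<times> (\<Union>i\<in>{1..k}. P ! (i - 1)) \<subseteq> B \<times> {1..l}"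
        using slots_nth(1)[OF assms(3,2)] by (intro Sigma_mono UN_least) auto
    qed
    then show ?thesis using p by (auto simp: inv_sym_def ins_pol_eq_ssub homog_ssub ad_act_ssub ssub_simps)
  qed
  then show ?thesis
    using assms by (auto simp: inv_series_def ins_def low_def ins_pol_eq_ssub ssub_simps)
qed

lemma star_inv_series: "f \<in> inv_series k \<Longrightarrow> g \<in> inv_series k \<Longrightarrow> f \<star> g \<in> inv_series k"
  using graded_sub_star[OF graded_sub_inv_sym, of f k g] low_star by (auto simp: inv_series_def)

lemma neg_inv_series: "f \<in> inv_series k \<Longrightarrow> neg f \<in> inv_series k"
  using homog_simps(3)[of _ _ "-1"]
  by (auto simp: inv_series_def) (auto simp: neg_def inv_sym_def ad_act_simps)

lemma ins_neg: "ins P (neg f) = neg (ins P f)"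
  by (simp add: ins_def neg_def ins_pol_eq_ssub ssub_simps)

text \<open>Insertion into disjoint sets of slots is a morphism of Poisson algebras by \<open>ssub_pp\<close>.\<close>
lemma ins_star:
  assumes "f \<in> inv_series k" "g \<in> inv_series k" "length P = k" "slots l P"
  shows "ins P (f \<star> g) = ins P f \<star> ins P g"
  unfolding ins_def
proof (rule star_natural[OF graded_sub_inv_sym[of k]])
  fix i j p q assume "p \<in> inv_sym k i" "q \<in> inv_sym k j"
  then show "ins_pol P (poisson_pol p q) = poisson_pol (ins_pol P p) (ins_pol P q)"
    unfolding ins_pol_eq_ssub
    by (intro ssub_pp[where I = "{1..k}"])
      (use slots_nth[OF assms(4,3)] slots_disjoint[OF assms(4,3)] in \<open>auto simp: inv_sym_def\<close>)
qed (use assms in \<open>auto simp: inv_series_def ins_pol_eq_ssub ssub_simps\<close>)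

lemma ins_ins:
  assumes "f \<in> inv_series k" "length P = k" "slots l P" "length Q = l" "slots l' Q"
  shows "ins Q (ins P f) = ins (comp_slots Q P) f"
proof
  fix n
  have vars: "vars (f n) \<subseteq> UNIV \<times> {1..k}" using assms(1) by (auto simp: inv_series_def inv_sym_def)
  have "ssub (\<lambda>i. Q ! (i - 1)) (ssub (\<lambda>i. P ! (i - 1)) (f n)) = ssub (\<lambda>i. \<Union>j\<in>P ! (i - 1). Q ! (j - 1)) (f n)"
  proof (rule ssub_ssub[OF vars])
    show "finite (Q ! (j - 1))" if "i \<in> {1..k}" "j \<in> P ! (i - 1)" for i j
      by (rule slots_nth(2)[OF assms(5,4)]) (use slots_nth(1)[OF assms(3,2) that(1)] that(2) in blast)
    show "Q ! (j - 1) \<inter> Q ! (j' - 1) = {}"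
      if "i \<in> {1..k}" "j \<in> P ! (i - 1)" "j' \<in> P ! (i - 1)" "j \<noteq> j'" for i j j'
      by (rule slots_disjoint[OF assms(5,4)]) (use slots_nth(1)[OF assms(3,2) that(1)] that in blast)+
  qed (rule slots_nth(2)[OF assms(3,2)])
  also have "\<dots> = ssub (\<lambda>i. comp_slots Q P ! (i - 1)) (f n)"
    by (rule ssub_cong[OF vars]) (use assms(2) in \<open>auto simp: comp_slots_def\<close>)
  finally show "ins Q (ins P f) n = ins (comp_slots Q P) f n"
    by (simp add: ins_def ins_pol_eq_ssub)
qed

lemma ins_empty_slot:
  assumes "f \<in> cochains k" "length P = k" "{} \<in> set P" shows "ins P f = (\<lambda>n. 0)"
proof
  fix n
  obtain i where i: "i < k" "P ! i = {}" using assms(2,3) by (auto simp: in_set_conv_nth)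
  have "pv v (ins_pol P (f n)) = pv v 0" for v
  proof -
    have kill: "pv w (f n) = 0" if "w (Suc i) = 0" for w
    proof -
      have "Suc i \<in> {1..k}" using i(1) by simp
      with assms(1) that show ?thesis unfolding cochains_def cochain_def by blast
    qed
    show ?thesis unfolding ins_pol_eq_ssub pv_ssub pv_hom by (rule kill) (simp add: i)
  qed
  then show "ins P f n = 0" unfolding ins_def by (rule pv_eqI)
qed

lemma ins_id:
  assumes "f \<in> inv_series k" "\<And>i. i \<in> {1..k} \<Longrightarrow> P ! (i - 1) = {i}" shows "ins P f = f"
proof
  fix n
  have "vars (f n) \<subseteq> UNIV \<times> {1..k}" using assms(1) by (auto simp: inv_series_def inv_sym_def)
  then have "pv v (ins_pol P (f n)) = pv v (f n)" for v
    unfolding ins_pol_eq_ssub pv_ssub by (rule pv_cong) (simp only: assms(2), simp)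
  then show "ins P f n = f n" unfolding ins_def by (rule pv_eqI)
qed

text \<open>An invariant series Poisson commutes with everything that sees its slots only through their sum.\<close>
lemma \<Phi>_ins_commute:
  assumes f: "f \<in> inv_series k" "length P = k" "slots m P"
    and g: "g \<in> inv_series l" "length Q = l" "slots m Q"
    and PQ: "\<forall>T\<in>set Q. \<Union>(set P) \<subseteq> T \<or> \<Union>(set P) \<inter> T = {}"
  shows "\<Phi> (ins P f) * \<Phi> (ins Q g) = \<Phi> (ins Q g) * \<Phi> (ins P f)"
proof (rule \<Phi>_commute)
  show "low (ins P f)" "low (ins Q g)"
    using ins_inv_series[OF f] ins_inv_series[OF g] by (auto simp: inv_series_low)
  fix i j
  have "vars (ins_pol P (f i)) \<subseteq> UNIV \<times> \<Union>(set P)"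
    unfolding ins_pol_eq_ssub
  proof (rule order_trans[OF vars_ssub])
    show "vars (f i) \<subseteq> UNIV \<times> {1..k}" using f(1) by (auto simp: inv_series_def inv_sym_def)
    show "UNIV \<times> (\<Union>i\<in>{1..k}. P ! (i - 1)) \<subseteq> UNIV \<times> \<Union>(set P)"
      using slots_nth(3)[OF f(3,2)] by (intro Sigma_mono UN_least) auto
  qed
  then show "poisson_pol (ins P f i) (ins Q g j) = 0"
    unfolding ins_def ins_pol_eq_ssub[of Q]
  proof (rule invariant_commute)
    show "ad_act x (ins_pol P (f i)) = 0" for x
      using f(1) by (simp add: ins_pol_eq_ssub ad_act_ssub inv_series_def inv_sym_def ssub_simps)
    show "vars (g j) \<subseteq> UNIV \<times> {1..l}" using g(1) by (auto simp: inv_series_def inv_sym_def)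
    show "finite (Q ! (j - 1)) \<and> (\<Union>(set P) \<subseteq> Q ! (j - 1) \<or> \<Union>(set P) \<inter> Q ! (j - 1) = {})" if "j \<in> {1..l}" for j
      using slots_nth(2,3)[OF g(3,2) that] PQ by blast
  qed
qed

subsection \<open>Vanishing on the coordinate subspaces\<close>

text \<open>The insertion that evaluates slot \<open>s\<close> at zero and closes the gap.\<close>
definition drop_slot :: "nat \<Rightarrow> nat \<Rightarrow> nat set list"
  where "drop_slot k s = map (\<lambda>i. if i < s then {i} else if i = s then {} else {i - 1}) [1..<k + 1]"

text \<open>Positive degree in every slot can be tested by morphisms for \<open>\<star>\<close>; in this form it passes from
  the factors to the solutions of equations in the group.\<close>
lemma cochains_if_drop_slot:
  assumes f: "f \<in> inv_series k" and z: "\<And>s. s \<in> {1..k} \<Longrightarrow> ins (drop_slot k s) f = (\<lambda>n. 0)"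
  shows "f \<in> cochains k"
proof -
  have "pv v (f n) = 0" if s: "s \<in> {1..k}" "v s = 0" for s v n
  proof -
    define v' where "v' = (\<lambda>i. if i < s then v i else v (i + 1))"
    have "vars (f n) \<subseteq> UNIV \<times> {1..k}" using f by (auto simp: inv_series_def inv_sym_def)
    then have "pv v (f n) = pv v' (ins_pol (drop_slot k s) (f n))"
      unfolding ins_pol_eq_ssub pv_ssub
      by (rule pv_cong) (use s in \<open>auto simp: drop_slot_def v'_def nth_append simp del: upt_Suc\<close>)
    also have "\<dots> = 0" using z[OF s(1)] by (auto simp: ins_def fun_eq_iff pv_hom)
    finally show ?thesis .
  qed
  then show ?thesis using f by (auto simp: cochains_def inv_series_def inv_sym_def cochain_def)
qed

lemma drop_slot_3: "drop_slot 3 1 = [{}, {1}, {2}]" "drop_slot 3 2 = [{1}, {}, {2}]" "drop_slot 3 3 = [{1}, {2}, {}]"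
  and drop_slot_4: "drop_slot 4 1 = [{}, {1}, {2}, {3}]" "drop_slot 4 2 = [{1}, {}, {2}, {3}]"
    "drop_slot 4 3 = [{1}, {2}, {}, {3}]" "drop_slot 4 4 = [{1}, {2}, {3}, {}]"
  by (simp_all add: drop_slot_def upt_rec)

subsection \<open>Changing a series in one degree\<close>

text \<open>The two series agree up to degree \<open>N\<close>, differ by \<open>e\<close> in the next degree, and are unrelated in
  higher degrees.\<close>
definition upd :: "nat \<Rightarrow> ('g, 'k) ser \<Rightarrow> ('g, 'k) ser \<Rightarrow> ('g, 'k) pol \<Rightarrow> bool"
  where "upd N f f' e \<longleftrightarrow> low f \<and> low f' \<and> (\<forall>d\<le>N. f' d = f d) \<and> f' (N + 1) = f (N + 1) + e"

lemma upd_star: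
  assumes "upd N f f' e" "upd N g g' e'" shows "upd N (f \<star> g) (f' \<star> g') (e + e')"
proof -
  have l: "low f" "low f'" "low g" "low g'" using assms by (auto simp: upd_def)
  have "(f' \<star> g') d = (f \<star> g) d" if "d \<le> N" for d
    by (rule star_cong[where n = N]) (use assms l that in \<open>auto simp: upd_def\<close>)
  moreover have "(f' \<star> g') (N + 1) - f' (N + 1) - g' (N + 1) = (f \<star> g) (N + 1) - f (N + 1) - g (N + 1)"
    by (rule star_cong_next[where n = N]) (use assms l in \<open>auto simp: upd_def\<close>)
  ultimately show ?thesis
    using l assms by (auto simp: upd_def low_star algebra_simps)
qed

lemma low_ins: "low f \<Longrightarrow> low (ins P f)"
  by (auto simp: low_def ins_def ins_pol_eq_ssub ssub_simps)

lemma upd_ins: "upd N f f' e \<Longrightarrow> upd N (ins P f) (ins P f') (ins_pol P e)"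
  by (auto simp: upd_def low_ins) (auto simp: ins_def ins_pol_eq_ssub ssub_simps)

lemma upd_neg: "upd N f f' e \<Longrightarrow> upd N (neg f) (neg f') (- e)"
  by (auto simp: upd_def neg_def low_def)

lemma upd_refl: "low f \<Longrightarrow> upd N f f 0"
  by (auto simp: upd_def)

text \<open>Powers of \<open>hat \<psi>\<close> from the second on start above index \<open>N\<close>.\<close>
lemma \<Phi>_small:
  assumes \<psi>: "low \<psi>" "\<And>d. d \<le> N \<Longrightarrow> \<psi> d = 0"
  shows "\<Phi> \<psi> $ 0 = 1" "\<And>i. 0 < i \<Longrightarrow> i < N \<Longrightarrow> \<Phi> \<psi> $ i = 0" "0 < N \<Longrightarrow> \<Phi> \<psi> $ N = hamil N (\<psi> (N + 1))"
proof -
  have h: "hat \<psi> $ i = 0" if "i < N" for i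
    using \<psi>(2)[of "i + 1"] that by (simp add: hat_def hamil_simps)
  have "\<Phi> \<psi> $ i = hat \<psi> $ i" if i: "0 < i" "i \<le> N" for i
  proof -
    have "(hat \<psi> ^ n) $ i = 0" if "n \<ge> 2" for n
    proof -
      define m where "m = n - 1"
      then have n: "n = Suc m" "m \<ge> 1" using \<open>n \<ge> 2\<close> by auto
      have "(hat \<psi> ^ m) $ j = 0" if "j < 1" for j
        using startsby_zero_power_prefix[OF hat_0[OF \<psi>(1)], of m] n that by auto
      then have "(hat \<psi> * hat \<psi> ^ m) $ i = 0"
        by (intro fps_mult_low[where m = N and n = 1]) (use h i in auto)
      then show ?thesis by (simp add: n)
    qed
    then have "\<Phi> \<psi> $ i = (\<Sum>n\<le>i. if n = 1 then hat \<psi> $ i else 0)"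
      unfolding \<Phi>_def P.ex_def P.fev_def fps_nth_Abs_fps
    proof (intro sum.cong refl)
      fix n
      show "\<kappa>p (fps_exp 1 $ n) * (hat \<psi> ^ n) $ i = (if n = 1 then hat \<psi> $ i else 0)"
        if "\<And>n. 2 \<le> n \<Longrightarrow> (hat \<psi> ^ n) $ i = 0"
        using that i by (cases "n = 0"; cases "n = 1") auto
    qed
    then show ?thesis using i by simp
  qed
  then show "\<And>i. 0 < i \<Longrightarrow> i < N \<Longrightarrow> \<Phi> \<psi> $ i = 0" "0 < N \<Longrightarrow> \<Phi> \<psi> $ N = hamil N (\<psi> (N + 1))"
    using h by (auto simp: hat_def)
  show "\<Phi> \<psi> $ 0 = 1" by (simp add: \<Phi>_def)
qed

lemma hamil_inj: "hamil N p = 0 \<Longrightarrow> 0 < N \<Longrightarrow> p = 0"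
proof -
  assume a: "hamil N p = 0" "0 < N"
  then have "app (hamil N p) (0, 1) = 0" by simp
  then have "Const (of_nat N) * p = 0" by (simp add: app_hamil pp_simps zero_prod_def)
  then show "p = 0" using a(2) by (intro Const_mult_cancel[of "of_nat N" p]) auto
qed

end

section \<open>The pentagon equation\<close>

text \<open>The two ways around the associahedron with five leaves: six pentagons, each commuting up to a
  factor \<open>s\<close>, and three squares. Both ways lead from \<open>X\<close> to \<open>k l j\<close>. Since the factors \<open>s\<close> are
  trivial below index \<open>N\<close>, each contributes its coefficient additively, with a sign that depends on
  the way on which its pentagon lies.\<close>
lemma associahedron:
  fixes a :: "'r::ring_1 fps"
  assumes pent: "a * b * c = s0 * g * h" "a * q * r = s1 * l * j" "h * d * e = s2 * i * j"
    "b * d * m = s3 * k * q" "g * i * f = s4 * k * l" "c * e * f = s5 * m * r"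
    and squares: "j * f = f * j" "c * d = d * c" "a * k = k * a"
    and one: "a $ 0 = 1" "b $ 0 = 1" "d $ 0 = 1" "f $ 0 = 1" "g $ 0 = 1" "h $ 0 = 1" "i $ 0 = 1" "j $ 0 = 1"
      "k $ 0 = 1" "l $ 0 = 1" "m $ 0 = 1" "q $ 0 = 1" "r $ 0 = 1"
    and small: "\<And>s. s \<in> {s0, s1, s2, s3, s4, s5} \<Longrightarrow> s $ 0 = 1 \<and> (\<forall>i. 0 < i \<and> i < N \<longrightarrow> s $ i = 0)"
    and N: "N > 0"
  shows "s0 $ N - s1 $ N + s2 $ N - s3 $ N + s4 $ N - s5 $ N = 0"
proof -
  have ins: "(u * s * w) $ N = (u * w) $ N + s $ N" if "s \<in> {s0, s1, s2, s3, s4, s5}" "u $ 0 = 1" "w $ 0 = 1" for u s w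
    by (rule insert_small) (use that small[OF that(1)] N in auto)
  have ins': "(s * w) $ N = w $ N + s $ N" if "s \<in> {s0, s1, s2, s3, s4, s5}" "w $ 0 = 1" for s w
    using ins[of s 1 w] that by simp
  have low: "s $ 0 = 1" if "s \<in> {s0, s1, s2, s3, s4, s5}" for s using small[OF that] by simp
  define X where "X = a * b * c * d * e * f"
  have "X = s0 * g * h * d * e * f" unfolding X_def pent(1) ..
  also have "\<dots> = s0 * (g * (h * d * e) * f)" by (simp add: mult.assoc)
  also have "\<dots> = s0 * (g * s2 * (i * (j * f)))" unfolding pent(3) by (simp add: mult.assoc)
  finally have "X $ N = (g * s2 * (i * (j * f))) $ N + s0 $ N"
    using one low by (simp add: ins')
  also have "(g * s2 * (i * (j * f))) $ N = (g * (i * (j * f))) $ N + s2 $ N"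
    by (rule ins) (use one in auto)
  also have "g * (i * (j * f)) = (g * i * f) * j" unfolding squares(1) by (simp add: mult.assoc)
  also have "\<dots> = s4 * (k * l * j)" unfolding pent(5) by (simp add: mult.assoc)
  also have "(s4 * (k * l * j)) $ N = (k * l * j) $ N + s4 $ N"
    by (rule ins') (use one in auto)
  finally have X1: "X $ N = (k * l * j) $ N + s4 $ N + s2 $ N + s0 $ N" .
  have "X = a * b * (c * d) * e * f" unfolding X_def by (simp add: mult.assoc)
  also have "\<dots> = a * b * d * (c * e * f)" unfolding squares(2) by (simp add: mult.assoc)
  also have "\<dots> = a * b * d * s5 * (m * r)" unfolding pent(6) by (simp add: mult.assoc)
  finally have "X $ N = (a * b * d * (m * r)) $ N + s5 $ N"
    using one by (simp add: ins)
  also have "a * b * d * (m * r) = a * (b * d * m) * r" by (simp add: mult.assoc)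
  also have "\<dots> = a * s3 * (k * q * r)" unfolding pent(4) by (simp add: mult.assoc)
  also have "(a * s3 * (k * q * r)) $ N = (a * (k * q * r)) $ N + s3 $ N"
    by (rule ins) (use one in auto)
  also have "a * (k * q * r) = (a * k) * (q * r)" by (simp add: mult.assoc)
  also have "\<dots> = k * (a * q * r)" unfolding squares(3) by (simp add: mult.assoc)
  also have "\<dots> = k * s1 * (l * j)" unfolding pent(2) by (simp add: mult.assoc)
  also have "(k * s1 * (l * j)) $ N = (k * (l * j)) $ N + s1 $ N"
    by (rule ins) (use one in auto)
  finally have "X $ N = (k * l * j) $ N + s1 $ N + s3 $ N + s5 $ N" by (simp add: mult.assoc)
  with X1 show ?thesis by (simp add: algebra_simps)
qed

text \<open>Here \<open>m\<close>, \<open>r\<close>, \<open>c\<close>, \<open>e\<close>, \<open>f\<close> stand for insertions of \<open>\<phi>\<close>, and \<open>s\<close> and \<open>S\<close> for insertions of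
  \<open>\<sigma>\<close> and \<open>- \<sigma>\<close>, with the slots as an index. Commuting factors past each other lets inverse pairs
  meet; both sides become the corresponding side of the equation for \<open>\<phi>\<close> between the common factors
  \<open>s34 * s2_34 * s1_234\<close> and \<open>S123_4 * S12_3 * S12\<close>.\<close>
lemma twist_pentagon_monoid:
  fixes c :: "'r::monoid_mult"
  assumes pent: "m * r = c * e * f"
    and inv: "S12_34 * s12_34 = 1" "S23_4 * s23_4 = 1" "S1_23 * s1_23 = 1" "S23 * s23 = 1"
    and c12: "S12 * s34 = s34 * S12" "S12 * s12_34 = s12_34 * S12" "S12 * r = r * S12"
      "S12 * S123_4 = S123_4 * S12" "S12 * S12_3 = S12_3 * S12"
    and c34: "S12_34 * s34 = s34 * S12_34" "m * s34 = s34 * m" "s1_234 * s34 = s34 * s1_234" "s2_34 * s34 = s34 * s2_34"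
    and c23: "S23 * s23_4 = s23_4 * S23" "S23 * s1_234 = s1_234 * S23" "S23 * e = e * S23"
      "S23 * S123_4 = S123_4 * S23" "S23 * S1_23 = S1_23 * S23"
    and cs: "c * s1_234 = s1_234 * c" "S123_4 * f = f * S123_4"
  shows "(s2_34 * s1_234 * m * S12_34 * S12) * (s34 * s12_34 * r * S123_4 * S12_3) =
    (s34 * s2_34 * c * S23_4 * S23) * (s23_4 * s1_234 * e * S123_4 * S1_23) * (s23 * s1_23 * f * S12_3 * S12)"
proof -
  have lc: "x * (y * z) = y * (x * z)" if "x * y = y * x" for x y z :: 'r
    using that by (metis mult.assoc)
  have L1: "S12 * (s34 * s12_34 * r * S123_4 * S12_3) = s34 * s12_34 * r * S123_4 * S12_3 * S12"
    by (simp only: mult.assoc lc[OF c12(1)] lc[OF c12(2)] lc[OF c12(3)] lc[OF c12(4)] c12(5))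
  have L2: "s2_34 * s1_234 * m * S12_34 * s34 = s34 * s2_34 * s1_234 * m * S12_34"
    by (simp only: mult.assoc c34(1) lc[OF c34(2)] lc[OF c34(3)] lc[OF c34(4)])
  have "(s2_34 * s1_234 * m * S12_34 * S12) * (s34 * s12_34 * r * S123_4 * S12_3) =
      s2_34 * s1_234 * m * S12_34 * (S12 * (s34 * s12_34 * r * S123_4 * S12_3))" by (simp add: mult.assoc)
  also have "\<dots> = (s2_34 * s1_234 * m * S12_34 * s34) * (s12_34 * (r * (S123_4 * (S12_3 * S12))))"
    unfolding L1 by (simp add: mult.assoc)
  also have "\<dots> = s34 * s2_34 * s1_234 * m * (S12_34 * s12_34) * (r * (S123_4 * (S12_3 * S12)))"
    unfolding L2 by (simp add: mult.assoc)
  also have "\<dots> = s34 * s2_34 * s1_234 * (m * r) * (S123_4 * (S12_3 * S12))"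
    unfolding inv(1) by (simp add: mult.assoc)
  finally have L: "(s2_34 * s1_234 * m * S12_34 * S12) * (s34 * s12_34 * r * S123_4 * S12_3) =
      s34 * s2_34 * s1_234 * (c * e * f) * (S123_4 * (S12_3 * S12))" unfolding pent .
  have R1: "S23 * (s23_4 * s1_234 * e * S123_4 * S1_23) = s23_4 * s1_234 * e * S123_4 * S1_23 * S23"
    by (simp only: mult.assoc lc[OF c23(1)] lc[OF c23(2)] lc[OF c23(3)] lc[OF c23(4)] c23(5))
  have "(s34 * s2_34 * c * S23_4 * S23) * (s23_4 * s1_234 * e * S123_4 * S1_23) * (s23 * s1_23 * f * S12_3 * S12) =
      s34 * s2_34 * c * S23_4 * (S23 * (s23_4 * s1_234 * e * S123_4 * S1_23)) * (s23 * s1_23 * f * S12_3 * S12)"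
    by (simp add: mult.assoc)
  also have "\<dots> = s34 * s2_34 * c * (S23_4 * s23_4) * s1_234 * e * S123_4 * S1_23 * (S23 * s23) * s1_23 * f * S12_3 * S12"
    unfolding R1 by (simp add: mult.assoc)
  also have "\<dots> = s34 * s2_34 * c * s1_234 * e * S123_4 * (S1_23 * s1_23) * f * S12_3 * S12"
    unfolding inv(2,4) by (simp add: mult.assoc)
  also have "\<dots> = s34 * s2_34 * (c * s1_234) * e * (S123_4 * f) * S12_3 * S12"
    unfolding inv(3) by (simp add: mult.assoc)
  also have "\<dots> = s34 * s2_34 * s1_234 * (c * e * f) * (S123_4 * (S12_3 * S12))"
    unfolding cs by (simp add: mult.assoc)
  finally show ?thesis unfolding L by simp
qed

section \<open>Existence and uniqueness of lifts\<close>

text \<open>The slot number \<open>1\<close> occurs in lists of sets of slots and has to stay a numeral like the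
  others.\<close>
declare One_nat_def [simp del]

lemma interval_lists: "{1..2 :: nat} = {1, 2}" "{1..3 :: nat} = {1, 2, 3}" "{1..4 :: nat} = {1, 2, 3, 4}"
  by auto

lemma coface_eq_ins_pol:
  assumes "vars p \<subseteq> A \<times> {1..k}" "\<forall>i\<in>{1..k}. P ! (i - 1) = cofS j i"
  shows "ssub (cofS j) p = ins_pol P p"
  unfolding ins_pol_eq_ssub by (rule ssub_cong[of p "{1..k}"]) (use assms in auto)

lemma bd_2:
  assumes "vars p \<subseteq> A \<times> {1..2}"
  shows "bd 2 p = ins_pol [{2}, {3}] p - ins_pol [{1, 2}, {3}] p + ins_pol [{1}, {2, 3}] p - ins_pol [{1}, {2}] p"
proof -
  have "bd 2 p = ssub (cofS 0) p - ssub (cofS 1) p + ssub (cofS 2) p - ssub (cofS 3) p"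
    by (simp add: bd_def eval_nat_numeral One_nat_def)
  also have "ssub (cofS 0) p = ins_pol [{2}, {3}] p"
    by (rule coface_eq_ins_pol[OF assms], unfold interval_lists) (simp add: cofS_def)
  also have "ssub (cofS 1) p = ins_pol [{1, 2}, {3}] p"
    by (rule coface_eq_ins_pol[OF assms], unfold interval_lists) (simp add: cofS_def)
  also have "ssub (cofS 2) p = ins_pol [{1}, {2, 3}] p"
    by (rule coface_eq_ins_pol[OF assms], unfold interval_lists) (simp add: cofS_def)
  also have "ssub (cofS 3) p = ins_pol [{1}, {2}] p"
    by (rule coface_eq_ins_pol[OF assms], unfold interval_lists) (simp add: cofS_def)
  finally show ?thesis .
qed

lemma bd_3:
  assumes "vars p \<subseteq> A \<times> {1..3}"
  shows "bd 3 p = ins_pol [{2}, {3}, {4}] p - ins_pol [{1, 2}, {3}, {4}] p + ins_pol [{1}, {2, 3}, {4}] p - ins_pol [{1}, {2}, {3, 4}] p + ins_pol [{1}, {2}, {3}] p"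
proof -
  have "bd 3 p = ssub (cofS 0) p - ssub (cofS 1) p + ssub (cofS 2) p - ssub (cofS 3) p + ssub (cofS 4) p"
    by (simp add: bd_def eval_nat_numeral One_nat_def)
  also have "ssub (cofS 0) p = ins_pol [{2}, {3}, {4}] p"
    by (rule coface_eq_ins_pol[OF assms], unfold interval_lists) (simp add: cofS_def)
  also have "ssub (cofS 1) p = ins_pol [{1, 2}, {3}, {4}] p"
    by (rule coface_eq_ins_pol[OF assms], unfold interval_lists) (simp add: cofS_def)
  also have "ssub (cofS 2) p = ins_pol [{1}, {2, 3}, {4}] p"
    by (rule coface_eq_ins_pol[OF assms], unfold interval_lists) (simp add: cofS_def)
  also have "ssub (cofS 3) p = ins_pol [{1}, {2}, {3, 4}] p"
    by (rule coface_eq_ins_pol[OF assms], unfold interval_lists) (simp add: cofS_def)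
  also have "ssub (cofS 4) p = ins_pol [{1}, {2}, {3}] p"
    by (rule coface_eq_ins_pol[OF assms], unfold interval_lists) (simp add: cofS_def)
  finally show ?thesis .
qed

lemma bd_4:
  assumes "vars p \<subseteq> A \<times> {1..4}"
  shows "bd 4 p = ins_pol [{2}, {3}, {4}, {5}] p - ins_pol [{1, 2}, {3}, {4}, {5}] p + ins_pol [{1}, {2, 3}, {4}, {5}] p - ins_pol [{1}, {2}, {3, 4}, {5}] p + ins_pol [{1}, {2}, {3}, {4, 5}] p - ins_pol [{1}, {2}, {3}, {4}] p"
proof -
  have "bd 4 p = ssub (cofS 0) p - ssub (cofS 1) p + ssub (cofS 2) p - ssub (cofS 3) p + ssub (cofS 4) p - ssub (cofS 5) p"
    by (simp add: bd_def eval_nat_numeral One_nat_def)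
  also have "ssub (cofS 0) p = ins_pol [{2}, {3}, {4}, {5}] p"
    by (rule coface_eq_ins_pol[OF assms], unfold interval_lists) (simp add: cofS_def)
  also have "ssub (cofS 1) p = ins_pol [{1, 2}, {3}, {4}, {5}] p"
    by (rule coface_eq_ins_pol[OF assms], unfold interval_lists) (simp add: cofS_def)
  also have "ssub (cofS 2) p = ins_pol [{1}, {2, 3}, {4}, {5}] p"
    by (rule coface_eq_ins_pol[OF assms], unfold interval_lists) (simp add: cofS_def)
  also have "ssub (cofS 3) p = ins_pol [{1}, {2}, {3, 4}, {5}] p"
    by (rule coface_eq_ins_pol[OF assms], unfold interval_lists) (simp add: cofS_def)
  also have "ssub (cofS 4) p = ins_pol [{1}, {2}, {3}, {4, 5}] p"
    by (rule coface_eq_ins_pol[OF assms], unfold interval_lists) (simp add: cofS_def)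
  also have "ssub (cofS 5) p = ins_pol [{1}, {2}, {3}, {4}] p"
    by (rule coface_eq_ins_pol[OF assms], unfold interval_lists) (simp add: cofS_def)
  finally show ?thesis .
qed

context based_lie_algebra
begin

lemma inv_series_vars: "f \<in> inv_series k \<Longrightarrow> vars (f n) \<subseteq> B \<times> {1..k}"
  by (auto simp: inv_series_def inv_sym_def)

lemma cochain_vars: "p \<in> cochain k n \<Longrightarrow> vars p \<subseteq> B \<times> {1..k}"
  by (auto simp: cochain_def)

lemma zero_star: assumes "low f" shows "(\<lambda>n. 0) \<star> f = f"
proof -
  have "low (\<lambda>n. 0)" by (simp add: low_def)
  then show ?thesis using assms by (intro \<Phi>_inj low_star) (simp_all add: \<Phi>_star \<Phi>_0)
qed

definition lhs5 :: "('g, 'k) ser \<Rightarrow> ('g, 'k) ser"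
  where "lhs5 \<phi> = ins [{1}, {2}, {3, 4}] \<phi> \<star> ins [{1, 2}, {3}, {4}] \<phi>"

definition rhs5 :: "('g, 'k) ser \<Rightarrow> ('g, 'k) ser"
  where "rhs5 \<phi> = ins [{2}, {3}, {4}] \<phi> \<star> ins [{1}, {2, 3}, {4}] \<phi> \<star> ins [{1}, {2}, {3}] \<phi>"

lemma pentagon_iff: "pentagon \<phi> \<longleftrightarrow> lhs5 \<phi> = rhs5 \<phi>"
  by (simp add: pentagon_def lhs5_def rhs5_def)

lemma slots_5: "slots 4 [{1}, {2}, {3, 4}]" "slots 4 [{1, 2}, {3}, {4}]" "slots 4 [{2}, {3}, {4}]"
  "slots 4 [{1}, {2, 3}, {4}]" "slots 4 [{1}, {2}, {3}]"
  by (simp_all add: slots_def)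

lemma sides_inv_series:
  assumes "\<phi> \<in> inv_series 3" shows "lhs5 \<phi> \<in> inv_series 4" "rhs5 \<phi> \<in> inv_series 4"
  unfolding lhs5_def rhs5_def by (intro star_inv_series ins_inv_series[OF assms] slots_5; simp)+

lemma \<Phi>_ins_sides:
  assumes \<phi>: "\<phi> \<in> inv_series 3" and Q: "length Q = 4" "slots l Q"
  shows "\<Phi> (ins Q (lhs5 \<phi>)) = \<Phi> (ins (comp_slots Q [{1}, {2}, {3, 4}]) \<phi>) * \<Phi> (ins (comp_slots Q [{1, 2}, {3}, {4}]) \<phi>)"
    "\<Phi> (ins Q (rhs5 \<phi>)) = \<Phi> (ins (comp_slots Q [{2}, {3}, {4}]) \<phi>) * \<Phi> (ins (comp_slots Q [{1}, {2, 3}, {4}]) \<phi>) *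
       \<Phi> (ins (comp_slots Q [{1}, {2}, {3}]) \<phi>)"
proof -
  have i: "ins P \<phi> \<in> inv_series 4" "ins Q (ins P \<phi>) = ins (comp_slots Q P) \<phi>" "low (ins (comp_slots Q P) \<phi>)"
    if "length P = 3" "slots 4 P" for P
    using ins_inv_series[OF \<phi> that] ins_ins[OF \<phi> that Q] low_ins inv_series_low[OF \<phi>] by auto
  note s = star_inv_series ins_star[OF _ _ Q] low_star \<Phi>_star i slots_5
  show "\<Phi> (ins Q (lhs5 \<phi>)) = \<Phi> (ins (comp_slots Q [{1}, {2}, {3, 4}]) \<phi>) * \<Phi> (ins (comp_slots Q [{1, 2}, {3}, {4}]) \<phi>)"
    unfolding lhs5_def by (simp add: s)
  show "\<Phi> (ins Q (rhs5 \<phi>)) = \<Phi> (ins (comp_slots Q [{2}, {3}, {4}]) \<phi>) * \<Phi> (ins (comp_slots Q [{1}, {2, 3}, {4}]) \<phi>) *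
       \<Phi> (ins (comp_slots Q [{1}, {2}, {3}]) \<phi>)"
    unfolding rhs5_def by (simp add: s)
qed

text \<open>The five insertions of the pentagon equation are the five cofaces, and their signs are given
  by the side on which they stand.\<close>
lemma upd_sides:
  assumes "upd N \<phi> \<phi>' x" "vars x \<subseteq> B \<times> {1..3}"
  shows "\<exists>a b. upd N (rhs5 \<phi>) (rhs5 \<phi>') a \<and> upd N (lhs5 \<phi>) (lhs5 \<phi>') b \<and> a - b = bd 3 x"
proof (intro exI conjI)
  show "upd N (rhs5 \<phi>) (rhs5 \<phi>') (ins_pol [{2}, {3}, {4}] x + ins_pol [{1}, {2, 3}, {4}] x + ins_pol [{1}, {2}, {3}] x)"
    unfolding rhs5_def by (intro upd_star upd_ins assms(1))
  show "upd N (lhs5 \<phi>) (lhs5 \<phi>') (ins_pol [{1}, {2}, {3, 4}] x + ins_pol [{1, 2}, {3}, {4}] x)"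
    unfolding lhs5_def by (intro upd_star upd_ins assms(1))
qed (simp add: bd_3[OF assms(2)])

lemma sides_cong:
  assumes "low \<phi>" "low \<phi>'" "\<forall>d\<le>N. \<phi>' d = \<phi> d" "d \<le> N"
  shows "rhs5 \<phi>' d = rhs5 \<phi> d" "lhs5 \<phi>' d = lhs5 \<phi> d"
proof -
  have u: "upd N \<phi> \<phi>' (\<phi>' (N + 1) - \<phi> (N + 1))" using assms by (simp add: upd_def)
  have "upd N (rhs5 \<phi>) (rhs5 \<phi>') (ins_pol [{2}, {3}, {4}] (\<phi>' (N + 1) - \<phi> (N + 1)) +
      ins_pol [{1}, {2, 3}, {4}] (\<phi>' (N + 1) - \<phi> (N + 1)) + ins_pol [{1}, {2}, {3}] (\<phi>' (N + 1) - \<phi> (N + 1)))"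
    unfolding rhs5_def by (intro upd_star upd_ins u)
  then show "rhs5 \<phi>' d = rhs5 \<phi> d" using assms(4) by (simp add: upd_def)
  have "upd N (lhs5 \<phi>) (lhs5 \<phi>') (ins_pol [{1}, {2}, {3, 4}] (\<phi>' (N + 1) - \<phi> (N + 1)) +
      ins_pol [{1, 2}, {3}, {4}] (\<phi>' (N + 1) - \<phi> (N + 1)))"
    unfolding lhs5_def by (intro upd_star upd_ins u)
  then show "lhs5 \<phi>' d = lhs5 \<phi> d" using assms(4) by (simp add: upd_def)
qed

subsection \<open>The obstruction is a cocycle\<close>

lemma comp_slots_simps [simp]: "comp_slots Q [] = []" "comp_slots Q (S # P) = (\<Union>j\<in>S. Q ! (j - 1)) # comp_slots Q P"
  by (simp_all add: comp_slots_def)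

text \<open>The series \<open>\<psi>\<close> with \<open>\<psi> \<star> lhs5 \<phi> = rhs5 \<phi>\<close> starts with \<open>e\<close> in degree \<open>N + 1\<close>. If one of the
  four slots is evaluated at zero, both sides of the equation become \<open>\<phi>\<close>, and \<open>\<psi>\<close> becomes trivial;
  so \<open>e\<close> has positive degree in every slot. The insertions of \<open>\<psi>\<close> into five slots by the six cofaces
  are the defects of the pentagons of the associahedron, and their leading terms are the summands of
  \<open>bd 4 e\<close>.\<close>
lemma obstruction_cocycle:
  assumes \<phi>: "\<phi> \<in> cochains 3" and N: "N > 0" and agree: "\<forall>d\<le>N. rhs5 \<phi> d = lhs5 \<phi> d"
  defines "e \<equiv> rhs5 \<phi> (N + 1) - lhs5 \<phi> (N + 1)"
  shows "e \<in> cochain 4 (N + 1)" "bd 4 e = 0"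
proof -
  have \<phi>3: "\<phi> \<in> inv_series 3" by (rule cochains_inv_series[OF \<phi>]) simp
  define L where "L = lhs5 \<phi>"
  define R where "R = rhs5 \<phi>"
  have LR: "L \<in> inv_series 4" "R \<in> inv_series 4" unfolding L_def R_def by (intro sides_inv_series \<phi>3)+
  then have low: "low L" "low R" by (auto simp: inv_series_low)
  define \<psi> where "\<psi> = R \<star> neg L"
  have \<psi>4: "\<psi> \<in> inv_series 4" unfolding \<psi>_def by (intro star_inv_series neg_inv_series LR)
  then have low\<psi>: "low \<psi>" by (rule inv_series_low)
  have \<Phi>\<psi>: "\<Phi> \<psi> * \<Phi> L = \<Phi> R"
    unfolding \<psi>_def using low by (simp add: \<Phi>_star mult.assoc \<Phi>_neg)
  have \<psi>L: "\<psi> \<star> L = R"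
    by (rule \<Phi>_inj) (simp_all add: low_star low low\<psi> \<Phi>_star \<Phi>\<psi>)
  have \<psi>0: "\<psi> d = 0" if "d \<le> N" for d
  proof -
    have "\<psi> d = (L \<star> neg L) d"
      unfolding \<psi>_def by (rule star_cong[where n = N]) (use low agree that in \<open>auto simp: L_def R_def\<close>)
    moreover have "L \<star> neg L = (\<lambda>n. 0)"
      by (rule \<Phi>_inj) (use low in \<open>simp_all add: low_star \<Phi>_star \<Phi>_neg \<Phi>_0, simp add: low_def\<close>)
    ultimately show ?thesis by simp
  qed
  have \<psi>e: "\<psi> (N + 1) = e"
  proof -
    have "(\<psi> \<star> L) (N + 1) - \<psi> (N + 1) - L (N + 1) = ((\<lambda>n. 0) \<star> L) (N + 1) - 0 - L (N + 1)"
      by (rule star_cong_next[where n = N]) (use low low\<psi> \<psi>0 in \<open>auto simp: low_def\<close>)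
    then have "R (N + 1) - \<psi> (N + 1) - L (N + 1) = L (N + 1) - 0 - L (N + 1)"
      unfolding \<psi>L zero_star[OF low(1)] .
    then show ?thesis by (simp add: e_def L_def R_def algebra_simps)
  qed
  have \<Phi>ins: "\<Phi> (ins Q \<psi>) * \<Phi> (ins Q L) = \<Phi> (ins Q R)" if "length Q = 4" "slots l Q" for Q l
    unfolding \<psi>L[symmetric] ins_star[OF \<psi>4 LR(1) that] by (simp add: \<Phi>_star low_ins low low\<psi>)
  have "\<psi> \<in> cochains 4"
  proof (rule cochains_if_drop_slot[OF \<psi>4])
    fix s :: nat assume s: "s \<in> {1..4}"
    have id: "ins [{1}, {2}, {3}] \<phi> = \<phi>"
      by (rule ins_id[OF \<phi>3]) (auto simp: interval_lists)
    have one: "\<Phi> (ins P \<phi>) = 1" if "length P = 3" "{} \<in> set P" for P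
      using ins_empty_slot[OF \<phi> that] by (simp add: \<Phi>_0)
    have D: "length (drop_slot 4 s) = 4" "slots 3 (drop_slot 4 s)"
      using s unfolding interval_lists by (auto simp: drop_slot_4 slots_def)
    have "\<Phi> (ins (drop_slot 4 s) L) = \<Phi> \<phi>" "\<Phi> (ins (drop_slot 4 s) R) = \<Phi> \<phi>"
      unfolding L_def R_def \<Phi>_ins_sides[OF \<phi>3 D]
      using s unfolding interval_lists by (auto simp: drop_slot_4 one id)
    then have "\<Phi> (ins (drop_slot 4 s) \<psi>) * \<Phi> \<phi> = \<Phi> \<phi>" using \<Phi>ins[OF D] by simp
    then have "\<Phi> (ins (drop_slot 4 s) \<psi>) * (\<Phi> \<phi> * \<Phi> (neg \<phi>)) = \<Phi> \<phi> * \<Phi> (neg \<phi>)"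
      by (simp only: mult.assoc[symmetric])
    then have "\<Phi> (ins (drop_slot 4 s) \<psi>) = 1"
      unfolding \<Phi>_neg(1)[OF inv_series_low[OF \<phi>3]] by simp
    then show "ins (drop_slot 4 s) \<psi> = (\<lambda>n. 0)"
      by (intro \<Phi>_inj) (simp_all add: low_ins low\<psi> \<Phi>_0, simp add: low_def)
  qed
  then show "e \<in> cochain 4 (N + 1)" unfolding \<psi>e[symmetric] by (simp add: cochains_def)
  define p where "p P = \<Phi> (ins P \<phi>)" for P
  define s where "s Q = \<Phi> (ins Q \<psi>)" for Q
  have p0: "p P $ 0 = 1" for P by (simp add: p_def \<Phi>_def)
  have pent: "p (comp_slots Q [{2}, {3}, {4}]) * p (comp_slots Q [{1}, {2, 3}, {4}]) * p (comp_slots Q [{1}, {2}, {3}]) =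
      s Q * p (comp_slots Q [{1}, {2}, {3, 4}]) * p (comp_slots Q [{1, 2}, {3}, {4}])" if "length Q = 4" "slots 5 Q" for Q
    using \<Phi>ins[OF that] unfolding L_def R_def \<Phi>_ins_sides[OF \<phi>3 that] by (simp add: p_def s_def mult.assoc)
  have small: "s Q $ 0 = 1" "\<forall>i. 0 < i \<and> i < N \<longrightarrow> s Q $ i = 0" "s Q $ N = hamil N (ins_pol Q e)" for Q
  proof -
    have "low (ins Q \<psi>)" "\<And>d. d \<le> N \<Longrightarrow> ins Q \<psi> d = 0"
      using low\<psi> \<psi>0 by (auto simp: low_ins) (auto simp: ins_def ins_pol_eq_ssub ssub_simps)
    from \<Phi>_small[OF this] N show "s Q $ 0 = 1" "\<forall>i. 0 < i \<and> i < N \<longrightarrow> s Q $ i = 0" "s Q $ N = hamil N (ins_pol Q e)"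
      by (auto simp: s_def ins_def \<psi>e)
  qed
  have comm: "p P * p Q = p Q * p P"
    if "length P = 3" "slots 5 P" "length Q = 3" "slots 5 Q" "\<forall>T\<in>set Q. \<Union>(set P) \<subseteq> T \<or> \<Union>(set P) \<inter> T = {}" for P Q
    unfolding p_def by (rule \<Phi>_ins_commute[OF \<phi>3 that(1,2) \<phi>3 that(3-5)])
  have "s [{2}, {3}, {4}, {5}] $ N - s [{1, 2}, {3}, {4}, {5}] $ N + s [{1}, {2, 3}, {4}, {5}] $ N
      - s [{1}, {2}, {3, 4}, {5}] $ N + s [{1}, {2}, {3}, {4, 5}] $ N - s [{1}, {2}, {3}, {4}] $ N = 0"
  proof (rule associahedron)
    show "p [{3}, {4}, {5}] * p [{2}, {3, 4}, {5}] * p [{2}, {3}, {4}] =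
        s [{2}, {3}, {4}, {5}] * p [{2}, {3}, {4, 5}] * p [{2, 3}, {4}, {5}]"
      using pent[of "[{2}, {3}, {4}, {5}]"] by (simp add: slots_def insert_commute)
    show "p [{3}, {4}, {5}] * p [{1, 2}, {3, 4}, {5}] * p [{1, 2}, {3}, {4}] =
        s [{1, 2}, {3}, {4}, {5}] * p [{1, 2}, {3}, {4, 5}] * p [{1, 2, 3}, {4}, {5}]"
      using pent[of "[{1, 2}, {3}, {4}, {5}]"] by (simp add: slots_def insert_commute)
    show "p [{2, 3}, {4}, {5}] * p [{1}, {2, 3, 4}, {5}] * p [{1}, {2, 3}, {4}] =
        s [{1}, {2, 3}, {4}, {5}] * p [{1}, {2, 3}, {4, 5}] * p [{1, 2, 3}, {4}, {5}]"
      using pent[of "[{1}, {2, 3}, {4}, {5}]"] by (simp add: slots_def insert_commute)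
    show "p [{2}, {3, 4}, {5}] * p [{1}, {2, 3, 4}, {5}] * p [{1}, {2}, {3, 4}] =
        s [{1}, {2}, {3, 4}, {5}] * p [{1}, {2}, {3, 4, 5}] * p [{1, 2}, {3, 4}, {5}]"
      using pent[of "[{1}, {2}, {3, 4}, {5}]"] by (simp add: slots_def insert_commute)
    show "p [{2}, {3}, {4, 5}] * p [{1}, {2, 3}, {4, 5}] * p [{1}, {2}, {3}] =
        s [{1}, {2}, {3}, {4, 5}] * p [{1}, {2}, {3, 4, 5}] * p [{1, 2}, {3}, {4, 5}]"
      using pent[of "[{1}, {2}, {3}, {4, 5}]"] by (simp add: slots_def insert_commute)
    show "p [{2}, {3}, {4}] * p [{1}, {2, 3}, {4}] * p [{1}, {2}, {3}] =
        s [{1}, {2}, {3}, {4}] * p [{1}, {2}, {3, 4}] * p [{1, 2}, {3}, {4}]"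
      using pent[of "[{1}, {2}, {3}, {4}]"] by (simp add: slots_def insert_commute)
    show "p [{1, 2, 3}, {4}, {5}] * p [{1}, {2}, {3}] = p [{1}, {2}, {3}] * p [{1, 2, 3}, {4}, {5}]"
      by (rule comm[symmetric]) (simp_all add: slots_def)
    show "p [{2}, {3}, {4}] * p [{1}, {2, 3, 4}, {5}] = p [{1}, {2, 3, 4}, {5}] * p [{2}, {3}, {4}]"
      by (rule comm) (simp_all add: slots_def)
    show "p [{3}, {4}, {5}] * p [{1}, {2}, {3, 4, 5}] = p [{1}, {2}, {3, 4, 5}] * p [{3}, {4}, {5}]"
      by (rule comm) (simp_all add: slots_def)
  qed (use p0 small(1,2) N in auto)
  then have "hamil N (bd 4 e) = 0"
    unfolding small(3) \<psi>e[symmetric] bd_4[OF inv_series_vars[OF \<psi>4]]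
    by (simp only: hamil_simps diff_conv_add_uminus)
  then show "bd 4 e = 0" using N by (rule hamil_inj)
qed

subsection \<open>The twist\<close>

lemma cochains_neg: "f \<in> cochains k \<Longrightarrow> neg f \<in> cochains k"
  using cochain_Const_mult[of _ _ _ "-1"] by (auto simp: cochains_def neg_def)

lemma slots_twist: "slots 3 [{2}, {3}]" "slots 3 [{1}, {2, 3}]" "slots 3 [{1, 2}, {3}]" "slots 3 [{1}, {2}]"
  by (simp_all add: slots_def)

lemma twist_inv_series:
  assumes "\<sigma> \<in> inv_series 2" "\<phi> \<in> inv_series 3" shows "twist \<sigma> \<phi> \<in> inv_series 3"
  unfolding twist_def
  by (intro star_inv_series ins_inv_series[where k = 2] neg_inv_series assms slots_twist) (simp_all add: numeral_2_eq_2)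

lemma \<Phi>_ins_twist:
  assumes \<sigma>: "\<sigma> \<in> inv_series 2" and \<phi>: "\<phi> \<in> inv_series 3" and Q: "length Q = 3" "slots l Q"
  shows "\<Phi> (ins Q (twist \<sigma> \<phi>)) = \<Phi> (ins (comp_slots Q [{2}, {3}]) \<sigma>) * \<Phi> (ins (comp_slots Q [{1}, {2, 3}]) \<sigma>) * \<Phi> (ins Q \<phi>) *
    \<Phi> (ins (comp_slots Q [{1, 2}, {3}]) (neg \<sigma>)) * \<Phi> (ins (comp_slots Q [{1}, {2}]) (neg \<sigma>))"
proof -
  have i: "ins P f \<in> inv_series 3" "ins Q (ins P f) = ins (comp_slots Q P) f" "low (ins (comp_slots Q P) f)"
    if "f \<in> inv_series 2" "length P = 2" "slots 3 P" for P f
    using ins_inv_series[OF that] ins_ins[OF that Q] low_ins inv_series_low[OF that(1)] by auto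
  show ?thesis
    unfolding twist_def
    using inv_series_low[OF \<sigma>] inv_series_low[OF \<phi>]
    by (simp add: star_inv_series ins_star[OF _ _ Q] low_star \<Phi>_star i slots_twist \<sigma> \<phi> neg_inv_series
        low_ins numeral_2_eq_2[symmetric])
qed

text \<open>If one of the three slots is evaluated at zero, \<open>\<phi>\<close> and two of the four factors made from \<open>\<sigma>\<close>
  become trivial, and the other two cancel.\<close>
lemma twist_cochains:
  assumes \<sigma>: "\<sigma> \<in> cochains 2" and \<phi>: "\<phi> \<in> cochains 3" shows "twist \<sigma> \<phi> \<in> cochains 3"
proof (rule cochains_if_drop_slot)
  have \<sigma>2: "\<sigma> \<in> inv_series 2" and \<phi>3: "\<phi> \<in> inv_series 3"
    using cochains_inv_series[OF \<sigma>] cochains_inv_series[OF \<phi>] by auto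
  show t: "twist \<sigma> \<phi> \<in> inv_series 3" by (rule twist_inv_series[OF \<sigma>2 \<phi>3])
  fix s :: nat assume s: "s \<in> {1..3}"
  have one: "\<Phi> (ins P f) = 1" if "f \<in> cochains k" "length P = k" "{} \<in> set P" for P f k
    using ins_empty_slot[OF that] by (simp add: \<Phi>_0)
  have neg: "\<Phi> (ins P \<sigma>) * \<Phi> (ins P (neg \<sigma>)) = 1" for P
    unfolding ins_neg by (rule \<Phi>_neg(1)) (simp add: low_ins inv_series_low[OF \<sigma>2])
  have D: "length (drop_slot 3 s) = 3" "slots 2 (drop_slot 3 s)"
    using s unfolding interval_lists by (auto simp: drop_slot_3 slots_def)
  have "\<Phi> (ins (drop_slot 3 s) (twist \<sigma> \<phi>)) = 1"
    unfolding \<Phi>_ins_twist[OF \<sigma>2 \<phi>3 D]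
    using s unfolding interval_lists
    by (auto simp: drop_slot_3 one[OF \<phi>] one[OF \<sigma>] one[OF cochains_neg[OF \<sigma>]] neg)
  then show "ins (drop_slot 3 s) (twist \<sigma> \<phi>) = (\<lambda>n. 0)"
    by (intro \<Phi>_inj) (simp_all add: low_ins inv_series_low[OF t] \<Phi>_0, simp add: low_def)
qed

text \<open>The commutation relations needed hold because the slots of one factor lie in a single slot of
  the other one, or outside of its slots.\<close>
lemma twist_pentagon:
  assumes \<sigma>: "\<sigma> \<in> inv_series 2" and \<phi>: "\<phi> \<in> inv_series 3" and pent: "pentagon \<phi>"
  shows "pentagon (twist \<sigma> \<phi>)"
proof -
  define s where "s P = \<Phi> (ins P \<sigma>)" for P
  define S where "S P = \<Phi> (ins P (neg \<sigma>))" for P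
  define p where "p P = \<Phi> (ins P \<phi>)" for P
  note t = twist_inv_series[OF \<sigma> \<phi>]
  have tw: "\<Phi> (ins Q (twist \<sigma> \<phi>)) = s (comp_slots Q [{2}, {3}]) * s (comp_slots Q [{1}, {2, 3}]) * p Q *
      S (comp_slots Q [{1, 2}, {3}]) * S (comp_slots Q [{1}, {2}])" if "length Q = 3" "slots 4 Q" for Q
    unfolding s_def S_def p_def by (rule \<Phi>_ins_twist[OF \<sigma> \<phi> that])
  have inv: "S P * s P = 1" for P
    unfolding s_def S_def ins_neg by (rule \<Phi>_neg(2)) (simp add: low_ins inv_series_low[OF \<sigma>])
  have low: "low (ins P \<phi>)" "low (ins P (twist \<sigma> \<phi>))" for P
    by (simp_all add: low_ins inv_series_low[OF \<phi>] inv_series_low[OF t])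
  have comm: "\<Phi> (ins P f) * \<Phi> (ins Q g) = \<Phi> (ins Q g) * \<Phi> (ins P f)"
    if "f \<in> inv_series (length P)" "slots 4 P" "g \<in> inv_series (length Q)" "slots 4 Q"
      "\<forall>T\<in>set Q. \<Union>(set P) \<subseteq> T \<or> \<Union>(set P) \<inter> T = {}" for P Q f g
    using \<Phi>_ins_commute[OF that(1) _ that(2,3) _ that(4,5)] by simp
  note cm = neg_inv_series \<sigma>[unfolded numeral_2_eq_2] \<phi>[unfolded numeral_3_eq_3] slots_def
  have "\<Phi> (lhs5 (twist \<sigma> \<phi>)) = \<Phi> (rhs5 (twist \<sigma> \<phi>))"
  proof -
    have "p [{1}, {2}, {3, 4}] * p [{1, 2}, {3}, {4}] =
        p [{2}, {3}, {4}] * p [{1}, {2, 3}, {4}] * p [{1}, {2}, {3}]"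
      using arg_cong[OF pent[unfolded pentagon_iff], of \<Phi>]
      by (simp add: lhs5_def rhs5_def p_def \<Phi>_star low low_star)
    then have "(s [{2}, {3, 4}] * s [{1}, {2, 3, 4}] * p [{1}, {2}, {3, 4}] * S [{1, 2}, {3, 4}] * S [{1}, {2}]) *
        (s [{3}, {4}] * s [{1, 2}, {3, 4}] * p [{1, 2}, {3}, {4}] * S [{1, 2, 3}, {4}] * S [{1, 2}, {3}]) =
      (s [{3}, {4}] * s [{2}, {3, 4}] * p [{2}, {3}, {4}] * S [{2, 3}, {4}] * S [{2}, {3}]) *
        (s [{2, 3}, {4}] * s [{1}, {2, 3, 4}] * p [{1}, {2, 3}, {4}] * S [{1, 2, 3}, {4}] * S [{1}, {2, 3}]) *
        (s [{2}, {3}] * s [{1}, {2, 3}] * p [{1}, {2}, {3}] * S [{1, 2}, {3}] * S [{1}, {2}])"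
    proof (rule twist_pentagon_monoid)
      show "S [{1}, {2}] * s [{3}, {4}] = s [{3}, {4}] * S [{1}, {2}]"
        "S [{1}, {2}] * s [{1, 2}, {3, 4}] = s [{1, 2}, {3, 4}] * S [{1}, {2}]"
        "S [{1}, {2}] * p [{1, 2}, {3}, {4}] = p [{1, 2}, {3}, {4}] * S [{1}, {2}]"
        "S [{1}, {2}] * S [{1, 2, 3}, {4}] = S [{1, 2, 3}, {4}] * S [{1}, {2}]"
        "S [{1}, {2}] * S [{1, 2}, {3}] = S [{1, 2}, {3}] * S [{1}, {2}]"
        "S [{2}, {3}] * s [{2, 3}, {4}] = s [{2, 3}, {4}] * S [{2}, {3}]"
        "S [{2}, {3}] * s [{1}, {2, 3, 4}] = s [{1}, {2, 3, 4}] * S [{2}, {3}]"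
        "S [{2}, {3}] * p [{1}, {2, 3}, {4}] = p [{1}, {2, 3}, {4}] * S [{2}, {3}]"
        "S [{2}, {3}] * S [{1, 2, 3}, {4}] = S [{1, 2, 3}, {4}] * S [{2}, {3}]"
        "S [{2}, {3}] * S [{1}, {2, 3}] = S [{1}, {2, 3}] * S [{2}, {3}]"
        "p [{2}, {3}, {4}] * s [{1}, {2, 3, 4}] = s [{1}, {2, 3, 4}] * p [{2}, {3}, {4}]"
        unfolding s_def S_def p_def by (rule comm; simp add: cm)+
      show "S [{1, 2}, {3, 4}] * s [{3}, {4}] = s [{3}, {4}] * S [{1, 2}, {3, 4}]"
        "p [{1}, {2}, {3, 4}] * s [{3}, {4}] = s [{3}, {4}] * p [{1}, {2}, {3, 4}]"
        "s [{1}, {2, 3, 4}] * s [{3}, {4}] = s [{3}, {4}] * s [{1}, {2, 3, 4}]"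
        "s [{2}, {3, 4}] * s [{3}, {4}] = s [{3}, {4}] * s [{2}, {3, 4}]"
        "S [{1, 2, 3}, {4}] * p [{1}, {2}, {3}] = p [{1}, {2}, {3}] * S [{1, 2, 3}, {4}]"
        unfolding s_def S_def p_def by (rule comm[symmetric]; simp add: cm)+
    qed (rule inv)+
    then show ?thesis
      unfolding lhs5_def rhs5_def
      using tw[of "[{1}, {2}, {3, 4}]"] tw[of "[{1, 2}, {3}, {4}]"] tw[of "[{2}, {3}, {4}]"]
        tw[of "[{1}, {2, 3}, {4}]"] tw[of "[{1}, {2}, {3}]"]
      by (simp add: \<Phi>_star low low_star slots_def insert_commute)
  qed
  then show ?thesis
    unfolding pentagon_iff by (intro \<Phi>_inj inv_series_low[OF sides_inv_series(1)] inv_series_low[OF sides_inv_series(2)] t)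
qed

text \<open>The four insertions of \<open>\<sigma>\<close> are the four cofaces, those of \<open>- \<sigma>\<close> being the ones with the
  negative sign.\<close>
lemma upd_twist:
  assumes "upd N \<sigma> \<sigma>' x" "vars x \<subseteq> B \<times> {1..2}" "low \<phi>"
  shows "upd N (twist \<sigma> \<phi>) (twist \<sigma>' \<phi>) (bd 2 x)"
proof -
  have "upd N (twist \<sigma> \<phi>) (twist \<sigma>' \<phi>) (ins_pol [{2}, {3}] x + ins_pol [{1}, {2, 3}] x + 0
      + ins_pol [{1, 2}, {3}] (- x) + ins_pol [{1}, {2}] (- x))"
    unfolding twist_def by (intro upd_star upd_ins upd_neg upd_refl assms)
  then show ?thesis by (simp add: bd_2[OF assms(2)] ins_pol_eq_ssub ssub_simps algebra_simps)
qed

lemma twist_zero: assumes "low \<phi>" shows "twist (\<lambda>n. 0) \<phi> = \<phi>"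
proof -
  have z: "ins P (\<lambda>n. 0) = (\<lambda>n. 0)" "neg (\<lambda>n. 0) = (\<lambda>n. 0)" "low (\<lambda>n. 0)" for P
    by (simp_all add: ins_def ins_pol_eq_ssub ssub_simps neg_def low_def)
  show ?thesis
    by (rule \<Phi>_inj) (simp_all add: twist_def z low_star assms \<Phi>_star \<Phi>_0)
qed

end

subsection \<open>Solving the equations degree by degree\<close>

context based_lie_algebra
begin

lemma lead3_eq:
  assumes "f 3 \<in> cochain 3 3" shows "lead3 f = f 3"
proof -
  have "{m. m \<in> Poly_Mapping.keys (f 3) \<and> (\<forall>s\<in>{1..3}. slot_deg s m = 1)} = Poly_Mapping.keys (f 3)"
    using cochain_diagonal_slot_deg[OF assms] by blast
  then show ?thesis unfolding lead3_def by (simp flip: pm_expand)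
qed

lemma Alt_diff: "Alt r (p - p') = Alt r p - Alt r p'"
  by (simp add: Alt_def ins_pol_eq_ssub ssub_simps right_diff_distrib sum_subtractf)

text \<open>The five terms of the coboundary of a trilinear form cancel by additivity.\<close>
lemma cochain_3_3_closed:
  assumes "p \<in> cochain 3 3" shows "bd 3 p = 0"
proof (rule pv_eqI)
  fix v
  obtain F where F: "\<And>v. pv v p = F (v 1) (v 2) (v 3)"
    and add: "\<And>x x' y z. F (x + x') y z = F x y z + F x' y z"
    "\<And>x y y' z. F x (y + y') z = F x y z + F x y' z"
    "\<And>x y z z'. F x y (z + z') = F x y z + F x y z'"
    using cochain_3_3_trilinear[OF assms] by blast
  have "pv v (bd 3 p) = pv (cof 0 v) p - pv (cof 1 v) p + pv (cof 2 v) p - pv (cof 3 v) p + pv (cof 4 v) p"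
    by (simp add: pv_bd eval_nat_numeral One_nat_def)
  also have "\<dots> = 0" unfolding F by (simp add: cof_def add)
  finally show "pv v (bd 3 p) = pv v 0" by (simp add: pv_hom)
qed

lemma wedge3_inv_cochain:
  assumes "Z \<in> wedge3_inv" shows "Z \<in> cochain 3 3"
proof -
  have Z: "Z \<in> Sym 3 3" "\<forall>m\<in>Poly_Mapping.keys Z. \<forall>s\<in>{1..3}. slot_deg s m = 1" "\<forall>x. ad_act x Z = 0"
    using assms by (auto simp: wedge3_inv_def wedge3_def tensor3_def)
  have "\<forall>v. v s = 0 \<longrightarrow> pv v Z = 0" if "s \<in> {1..3}" for s
    using Z(2) that unfolding slot_positive_iff[symmetric] by (metis order_refl)
  then show ?thesis using Z(1,3) by (auto simp: cochain_def Sym_iff)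
qed

lemma Alt_wedge3:
  assumes "Z \<in> wedge3" shows "Alt r Z = Const (of_rat r * 6) * Z"
proof -
  have "(\<Sum>\<tau> | \<tau> permutes {1, 2, 3 :: nat}. Const (of_int (sign \<tau>)) * ins_pol [{\<tau> 1}, {\<tau> 2}, {\<tau> 3}] Z) =
      (\<Sum>\<tau> | \<tau> permutes {1, 2, 3 :: nat}. Z)"
  proof (intro sum.cong refl)
    fix \<tau> :: "nat \<Rightarrow> nat" assume "\<tau> \<in> {\<tau>. \<tau> permutes {1, 2, 3}}"
    then have "ins_pol [{\<tau> 1}, {\<tau> 2}, {\<tau> 3}] Z = Const (of_int (sign \<tau>)) * Z"
      using assms by (auto simp: wedge3_def)
    moreover have "Const (of_int (sign \<tau>)) * (Const (of_int (sign \<tau>)) * Z) = Z"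
      by (cases \<tau> rule: sign_cases) (simp_all add: mult.assoc[symmetric])
    ultimately show "Const (of_int (sign \<tau>)) * ins_pol [{\<tau> 1}, {\<tau> 2}, {\<tau> 3}] Z = Z" by simp
  qed
  also have "\<dots> = Const 6 * Z"
  proof -
    have "card {\<tau>. \<tau> permutes {1, 2, 3 :: nat}} = 6"
      by (subst card_permutations[of _ 3]) (auto simp: fact_numeral)
    moreover have "(Const (of_nat 6 :: 'k) :: ('g, 'k) pol) = of_nat 6" by (rule Const_of_nat)
    ultimately show ?thesis by simp
  qed
  finally show ?thesis by (simp add: Alt_def mult.assoc)
qed

text \<open>Each stage keeps what the previous one has fixed, so the stages have a limit in every degree.\<close>
lemma degreewise_choice:
  assumes base: "\<exists>x. P 0 x" and step: "\<And>n x. P n x \<Longrightarrow> \<exists>y. P (Suc n) y \<and> (\<forall>d\<le>n + k. y d = x d)"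
  shows "\<exists>x f. (\<forall>n. P n (f n) \<and> (\<forall>d\<le>n + k. x d = f n d))"
proof -
  obtain f where f: "\<And>n. P n (f n)" "\<And>n. \<forall>d\<le>n + k. f (Suc n) d = f n d"
    using dependent_nat_choice[of P "\<lambda>n x y. \<forall>d\<le>n + k. y d = x d"] base step by blast
  have f': "f m d = f n d" if "n \<le> m" "d \<le> n + k" for m n d
    using that by (induction m rule: dec_induct) (use f(2) in auto)
  have "f d d = f n d" if "d \<le> n + k" for n d
    using f'[of n d d] f'[of d n d] that by (cases "n \<le> d") auto
  then show ?thesis using f(1) by (intro exI[of _ "\<lambda>d. f d d"] exI[of _ f]) auto
qed

lemma cochains_low: "f \<in> cochains k \<Longrightarrow> k \<ge> 2 \<Longrightarrow> low f"
  by (rule inv_series_low[OF cochains_inv_series])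

lemma cochains_upd: "f \<in> cochains k \<Longrightarrow> x \<in> cochain k n \<Longrightarrow> f(n := x) \<in> cochains k"
  by (auto simp: cochains_def)

text \<open>By induction on \<open>n\<close> a series is found that solves the equation up to degree \<open>n + 4\<close>. The start
  is possible since up to degree \<open>4\<close> the equation is linear for a series that starts in degree \<open>3\<close>.\<close>
theorem lift_exists:
  assumes Z: "Z \<in> wedge3_inv" and r: "r \<noteq> 0" shows "\<exists>\<phi>. is_lift r Z \<phi>"
proof -
  \<comment> \<open>On antisymmetric tensors \<open>Alt r\<close> is multiplication by \<open>6 r\<close>, as there are six permutations.\<close>
  define z where "z = Const (1 / (of_rat r * 6)) * Z"
  have z: "z \<in> cochain 3 3" unfolding z_def by (intro cochain_Const_mult wedge3_inv_cochain Z)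
  have Z_wedge: "Z \<in> wedge3" using Z by (simp add: wedge3_inv_def)
  have "Alt r z = Const (1 / (of_rat r * 6)) * Alt r Z"
    by (simp add: z_def Alt_def ins_pol_eq_ssub ssub_simps sum_distrib_left mult_ac)
  also have "\<dots> = Const (1 / (of_rat r * 6) * (of_rat r * 6)) * Z"
    unfolding Alt_wedge3[OF Z_wedge] by (simp only: Const_simps(4) mult.assoc)
  also have "\<dots> = Z" using r by (simp del: Const_simps(4))
  finally have Alt_z: "Alt r z = Z" .
  define stage where "stage n \<phi> \<longleftrightarrow> \<phi> \<in> cochains 3 \<and> \<phi> 3 = z \<and> (\<forall>d\<le>n + 4. rhs5 \<phi> d = lhs5 \<phi> d)" for n \<phi>
  have "\<exists>\<phi> f. \<forall>n. stage n (f n) \<and> (\<forall>d\<le>n + 4. \<phi> d = f n d)"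
  proof (rule degreewise_choice)
    define \<phi> where "\<phi> = (\<lambda>d :: nat. if d = 3 then z else 0)"
    have \<phi>: "\<phi> \<in> cochains 3" using z by (auto simp: \<phi>_def cochains_def cochain_0)
    have ins_apply: "ins P \<phi> d = ins_pol P (\<phi> d)" for P d by (simp add: ins_def)
    have i0: "ins P \<phi> d = 0" if "d \<le> 2" for P d
      using that by (simp add: \<phi>_def ins_def ins_pol_eq_ssub ssub_simps)
    have i2: "(ins P \<phi> \<star> ins Q \<phi>) d = ins P \<phi> d + ins Q \<phi> d" if "d \<le> 4" for P Q d
      by (rule star_low_degrees) (use i0 that in auto)
    have "rhs5 \<phi> d = lhs5 \<phi> d" if d: "d \<le> 4" for d
    proof -
      have "rhs5 \<phi> d = (ins [{2}, {3}, {4}] \<phi> \<star> ins [{1}, {2, 3}, {4}] \<phi>) d + ins [{1}, {2}, {3}] \<phi> d"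
        unfolding rhs5_def by (rule star_low_degrees) (use i0 i2 d in auto)
      then have "rhs5 \<phi> d - lhs5 \<phi> d = bd 3 (\<phi> d)"
        using cochain_vars[of "\<phi> d" 3 d] \<phi> d
        by (simp add: lhs5_def i2 bd_3 ins_apply cochains_def)
      also have "\<dots> = 0" using cochain_3_3_closed[OF z] by (simp add: \<phi>_def bd_simps)
      finally show ?thesis by simp
    qed
    then show "\<exists>\<phi>. stage 0 \<phi>" using \<phi> by (auto simp: stage_def intro!: exI[of _ \<phi>]) (simp add: \<phi>_def)
  next
    fix n \<phi> assume st: "stage n \<phi>"
    define N where "N = n + 4"
    have \<phi>: "\<phi> \<in> cochains 3" and agree: "\<forall>d\<le>N. rhs5 \<phi> d = lhs5 \<phi> d"
      using st by (auto simp: stage_def N_def)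
    define e where "e = rhs5 \<phi> (N + 1) - lhs5 \<phi> (N + 1)"
    have "e \<in> cochain 4 (N + 1)" "bd 4 e = 0"
      unfolding e_def using obstruction_cocycle[OF \<phi> _ agree] by (auto simp: N_def)
    then obtain x where x: "x \<in> cochain 3 (N + 1)" "bd 3 x = e"
      using cocycle_exact[of e 4 "N + 1"] by (auto simp: N_def)
    define \<phi>' where "\<phi>' = \<phi>(N + 1 := \<phi> (N + 1) - x)"
    have \<phi>': "\<phi>' \<in> cochains 3"
      unfolding \<phi>'_def by (intro cochains_upd cochain_diff x \<phi>) (use \<phi> in \<open>simp add: cochains_def\<close>)
    have u: "upd N \<phi> \<phi>' (- x)"
      using cochains_low[OF \<phi>] cochains_low[OF \<phi>'] by (auto simp: upd_def \<phi>'_def)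
    obtain a b where ab: "upd N (rhs5 \<phi>) (rhs5 \<phi>') a" "upd N (lhs5 \<phi>) (lhs5 \<phi>') b" "a - b = bd 3 (- x)"
      using upd_sides[OF u] cochain_vars[OF x(1)] by auto
    have "rhs5 \<phi>' (N + 1) - lhs5 \<phi>' (N + 1) = e + (a - b)"
      using ab(1,2) by (simp add: upd_def e_def)
    also have "\<dots> = 0" by (simp add: ab(3) bd_simps x(2))
    finally have "rhs5 \<phi>' (Suc N) = lhs5 \<phi>' (Suc N)" by (simp add: Suc_eq_plus1)
    then have "rhs5 \<phi>' d = lhs5 \<phi>' d" if "d \<le> Suc N" for d
      using that ab(1,2) agree by (auto simp: upd_def le_Suc_eq)
    then have "\<forall>d\<le>Suc n + 4. rhs5 \<phi>' d = lhs5 \<phi>' d" by (simp add: N_def)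
    then have "stage (Suc n) \<phi>'"
      using \<phi>' st by (auto simp: stage_def \<phi>'_def N_def)
    then show "\<exists>\<phi>'. stage (Suc n) \<phi>' \<and> (\<forall>d\<le>n + 4. \<phi>' d = \<phi> d)"
      by (intro exI[of _ \<phi>']) (auto simp: \<phi>'_def N_def)
  qed
  then obtain \<phi> f where f: "\<And>n. stage n (f n)" "\<And>n d. d \<le> n + 4 \<Longrightarrow> \<phi> d = f n d" by blast
  have \<phi>: "\<phi> \<in> cochains 3"
    using f by (auto simp: cochains_def stage_def) (metis le_add1)
  have "lhs5 \<phi> d = rhs5 \<phi> d" for d
  proof -
    have "f d \<in> cochains 3" "rhs5 (f d) d = lhs5 (f d) d" using f(1)[of d] by (auto simp: stage_def)
    moreover have "\<forall>d'\<le>d + 4. \<phi> d' = f d d'" using f(2) by blast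
    ultimately show ?thesis
      using sides_cong[of "f d" \<phi> "d + 4" d] cochains_low[OF \<phi>] cochains_low[of "f d" 3] by simp
  qed
  then have "pentagon \<phi>" unfolding pentagon_iff by blast
  moreover have "\<phi> 3 = z" using f(1)[of 0] f(2)[of 3 0] by (simp add: stage_def)
  ultimately have "is_lift r Z \<phi>"
    unfolding is_lift_def max_tensor_invariants_iff
    using \<phi> z Alt_z lead3_eq[of \<phi>] by (simp add: cochains_def)
  then show ?thesis by blast
qed

text \<open>By induction on \<open>n\<close> a series \<open>\<sigma>\<close> is found for which \<open>\<sigma> \<cdot> \<phi>\<close> agrees with \<open>\<phi>'\<close> up to degree
  \<open>n + 3\<close>. Degree \<open>3\<close> is settled by the antisymmetrizations, and from degree \<open>4\<close> on the degree
  exceeds the number of slots.\<close>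
theorem lift_unique:
  assumes \<phi>: "is_lift r Z \<phi>" and \<phi>': "is_lift r Z \<phi>'" and r: "r \<noteq> 0"
  shows "\<exists>\<sigma>\<in>max_tensor 2 \<inter> invariants. \<phi>' = twist \<sigma> \<phi>"
proof -
  have c: "\<phi> \<in> cochains 3" "\<phi>' \<in> cochains 3" and pent: "pentagon \<phi>" "pentagon \<phi>'"
    using \<phi> \<phi>' unfolding is_lift_def max_tensor_invariants_iff by (simp_all add: cochains_def)
  have c3: "\<phi> d \<in> cochain 3 d" "\<phi>' d \<in> cochain 3 d" for d using c by (auto simp: cochains_def)
  note low = cochains_low[OF c(1)]
  have inv3: "\<phi> \<in> inv_series 3" using cochains_inv_series[OF c(1)] by simp
  define stage where "stage n \<sigma> \<longleftrightarrow> \<sigma> \<in> cochains 2 \<and> (\<forall>d\<le>n + 3. twist \<sigma> \<phi> d = \<phi>' d)" for n \<sigma>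
  have "\<exists>\<sigma> f. \<forall>n. stage n (f n) \<and> (\<forall>d\<le>n + 3. \<sigma> d = f n d)"
  proof (rule degreewise_choice)
    have "Alt r (\<phi>' 3 - \<phi> 3) = 0"
      using \<phi> \<phi>' lead3_eq[of \<phi>, OF c3(1)] lead3_eq[of \<phi>', OF c3(2)] by (simp add: Alt_diff is_lift_def)
    then obtain x where x: "x \<in> cochain 2 3" "bd 2 x = \<phi>' 3 - \<phi> 3"
      using alt_zero_exact[OF cochain_diff[OF c3(2) c3(1)] _ r] by blast
    define \<sigma> where "\<sigma> = (\<lambda>d :: nat. if d = 3 then x else 0)"
    have \<sigma>: "\<sigma> \<in> cochains 2" using x by (auto simp: \<sigma>_def cochains_def cochain_0)
    have u: "upd 2 (\<lambda>_. 0) \<sigma> x" by (auto simp: upd_def low_def \<sigma>_def)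
    have "upd 2 \<phi> (twist \<sigma> \<phi>) (\<phi>' 3 - \<phi> 3)"
      using upd_twist[OF u cochain_vars[OF x(1)], of \<phi>] low by (simp add: twist_zero x(2))
    then have t: "\<forall>d\<le>2. twist \<sigma> \<phi> d = \<phi> d" "twist \<sigma> \<phi> 3 = \<phi>' 3" by (auto simp: upd_def)
    have "twist \<sigma> \<phi> d = \<phi>' d" if "d \<le> 3" for d
    proof (cases "d = 3")
      case False
      then have "d < 3" using that by simp
      then show ?thesis using t(1) cochain_low[OF c3(1)[of d]] cochain_low[OF c3(2)[of d]] by simp
    qed (simp add: t(2))
    then show "\<exists>\<sigma>. stage 0 \<sigma>" using \<sigma> by (auto simp: stage_def)
  next
    fix n \<sigma> assume st: "stage n \<sigma>"
    define N where "N = n + 3"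
    define \<chi> where "\<chi> = twist \<sigma> \<phi>"
    have \<sigma>: "\<sigma> \<in> cochains 2" and agree: "\<forall>d\<le>N. \<chi> d = \<phi>' d"
      using st by (auto simp: stage_def N_def \<chi>_def)
    have \<chi>: "\<chi> \<in> cochains 3" unfolding \<chi>_def by (rule twist_cochains[OF \<sigma> c(1)])
    have pent\<chi>: "pentagon \<chi>"
      unfolding \<chi>_def using cochains_inv_series[OF \<sigma>] by (intro twist_pentagon inv3 pent) simp
    define \<delta> where "\<delta> = \<phi>' (N + 1) - \<chi> (N + 1)"
    have \<delta>: "\<delta> \<in> cochain 3 (N + 1)"
      unfolding \<delta>_def using \<chi> by (intro cochain_diff c3) (simp add: cochains_def)
    have u: "upd N \<chi> \<phi>' \<delta>"
      using cochains_low[OF \<chi>] cochains_low[OF c(2)] agree by (auto simp: upd_def \<delta>_def)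
    obtain a b where ab: "upd N (rhs5 \<chi>) (rhs5 \<phi>') a" "upd N (lhs5 \<chi>) (lhs5 \<phi>') b" "a - b = bd 3 \<delta>"
      using upd_sides[OF u cochain_vars[OF \<delta>]] by blast
    have "rhs5 \<phi>' (N + 1) = rhs5 \<chi> (N + 1) + a" "lhs5 \<phi>' (N + 1) = lhs5 \<chi> (N + 1) + b"
      using ab by (auto simp: upd_def)
    then have "bd 3 \<delta> = 0"
      using pent(2) pent\<chi> unfolding ab(3)[symmetric] pentagon_iff by simp
    then obtain x where x: "x \<in> cochain 2 (N + 1)" "bd 2 x = \<delta>"
      using cocycle_exact[OF \<delta>] by (auto simp: N_def)
    define \<sigma>' where "\<sigma>' = \<sigma>(N + 1 := \<sigma> (N + 1) + x)"
    have \<sigma>': "\<sigma>' \<in> cochains 2"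
      unfolding \<sigma>'_def by (intro cochains_upd cochain_add x \<sigma>) (use \<sigma> in \<open>simp add: cochains_def\<close>)
    have "upd N \<sigma> \<sigma>' x"
      using cochains_low[OF \<sigma>] cochains_low[OF \<sigma>'] by (auto simp: upd_def \<sigma>'_def)
    from upd_twist[OF this cochain_vars[OF x(1)], of \<phi>]
    have "upd N \<chi> (twist \<sigma>' \<phi>) \<delta>" using low by (simp add: \<chi>_def x(2))
    then have "twist \<sigma>' \<phi> d = \<phi>' d" if "d \<le> Suc N" for d
      using that agree by (cases "d = N + 1") (auto simp: upd_def \<delta>_def)
    then have "\<forall>d\<le>Suc n + 3. twist \<sigma>' \<phi> d = \<phi>' d" by (simp add: N_def)
    then show "\<exists>\<sigma>'. stage (Suc n) \<sigma>' \<and> (\<forall>d\<le>n + 3. \<sigma>' d = \<sigma> d)"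
      using \<sigma>' by (intro exI[of _ \<sigma>']) (auto simp: stage_def \<sigma>'_def N_def)
  qed
  then obtain \<sigma> f where f: "\<And>n. stage n (f n)" "\<And>n d. d \<le> n + 3 \<Longrightarrow> \<sigma> d = f n d" by blast
  have \<sigma>: "\<sigma> \<in> cochains 2"
    using f by (auto simp: cochains_def stage_def) (metis le_add1)
  have "\<phi>' = twist \<sigma> \<phi>"
  proof
    fix d
    have fd: "f d \<in> cochains 2" "twist (f d) \<phi> d = \<phi>' d" using f(1)[of d] by (auto simp: stage_def)
    have "upd d (f d) \<sigma> (\<sigma> (d + 1) - f d (d + 1))"
      using f(2)[of _ d] cochains_low[OF \<sigma>] cochains_low[OF fd(1)] by (auto simp: upd_def)
    moreover have "\<sigma> (d + 1) - f d (d + 1) \<in> cochain 2 (d + 1)"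
      using \<sigma> fd(1) by (intro cochain_diff) (auto simp: cochains_def)
    ultimately have "upd d (twist (f d) \<phi>) (twist \<sigma> \<phi>) (bd 2 (\<sigma> (d + 1) - f d (d + 1)))"
      using low by (intro upd_twist cochain_vars) auto
    then show "\<phi>' d = twist \<sigma> \<phi> d" using fd(2) by (auto simp: upd_def)
  qed
  moreover have "\<sigma> \<in> max_tensor 2 \<inter> invariants"
    using \<sigma> unfolding max_tensor_invariants_iff by (simp add: cochains_def)
  ultimately show ?thesis by blast
qed

end

theorem proposition1p1:
  fixes scale :: "'k::field_char_0 \<Rightarrow> 'g::ab_group_add \<Rightarrow> 'g"
    and br :: "'g \<Rightarrow> 'g \<Rightarrow> 'g"
    and B :: "'g set"
    and q :: rat
    and Z :: "('g, 'k) pol"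
  assumes "based_lie_algebra scale br B"
    and "q \<noteq> 0"
    and "Z \<in> based_lie_algebra.wedge3_inv scale br B"
  shows "(\<exists>\<phi>. based_lie_algebra.is_lift scale br B q Z \<phi>) \<and>
    (\<forall>\<phi> \<phi>'. based_lie_algebra.is_lift scale br B q Z \<phi> \<longrightarrow>
       based_lie_algebra.is_lift scale br B q Z \<phi>' \<longrightarrow>
       (\<exists>\<sigma> \<in> based_lie_algebra.max_tensor B 2 \<inter> based_lie_algebra.invariants scale br B.
          \<phi>' = based_lie_algebra.twist scale br B \<sigma> \<phi>))"
  using based_lie_algebra.lift_exists[OF assms(1,3,2)] based_lie_algebra.lift_unique[OF assms(1) _ _ assms(2)]
  by blast

end
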